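(* Let $G$ be a generalized Bethe tree. Then $G$ induces a periodic Grover walk if and only if $G$ is isomorphic (as a graph) to one of the following: (a) the path $P_{n+1}$ on $n+1$ vertices, for some $n \in \mathbb{N}$; (b) $S_k(ST_l)$ for some $k \in \mathbb{N}$ and $l \geq 3$; (c) $S_k(B(1,2,3))$ for some $k \in \mathbb{N}$; (d) $S_k(B(s,3))$ for some $k \in \mathbb{N}$ and $s \in \mathbb{N}$ with $s \geq 2$. Moreover, the periods of the Grover walks induced by these graphs are $2n$, $4k$, $12k$ and $12k$, respectively.
   Context: All graphs are finite, simple and connected. For a graph $G=(V,E)$, let $D(G)=\{(u,v),(v,u) : uv \in E\}$ be the set of arcs; for an arc $e=(u,v)$ write $o(e)=u$, $t(e)=v$, $e^{-1}=(v,u)$. The Grover transfer matrix $U=U(G)$ is the matrix indexed by $D(G)$ with $U_{e,f}=2/\deg(t(f))$ if $t(f)=o(e)$ and $e \neq f^{-1}$; $U_{e,f}=2/\deg(t(f))-1$ if $e=f^{-1}$; and $U_{e,f}=0$ otherwise. $G$ induces a periodic Grover walk if $U^k=I$ for some $k\in\mathbb{N}$; the period is the least such $k$ (then $G$ induces a $k$-periodic Grover walk). A generalized Bethe tree $B(d(0),d(1),\dots,d(n-1))$ (with $n\ge 1$ and all $d(i)\ge 1$) is a rooted tree whose vertex set is partitioned into levels $C_0=\{\text{root}\},C_1,\dots,C_n$ such that every vertex of $C_i$ ($0\le i\le n-1$) has exactly $d(i)$ neighbours in $C_{i+1}$ (its children) and exactly one neighbour in $C_{i-1}$ if $i\ge1$,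 and vertices of $C_n$ are leaves. Thus $B(s,3)$ is the rooted tree whose root has $s$ children each having $3$ children, and $B(1,2,3)$ is the rooted tree whose root has one child, which has $2$ children, each of which has $3$ children. $P_m$ denotes the path on $m$ vertices and $ST_m$ the star on $m$ vertices. For $k\in\mathbb{N}$, the $k$-subdivision $S_k(H)$ of a graph $H$ is obtained by replacing each edge of $H$ by a path with $k$ edges (i.e., inserting $k-1$ new vertices on each edge). *)

theory Defs
  imports
    Complex_Main
    "HOL-Library.Multiset"
    "Graph_Theory.Digraph_Component"
    "Graph_Theory.Digraph_Isomorphism"
    "Graph_Theory.Pair_Digraph"
begin

text \<open>
  A finite simple graph is a \<^locale>\<open>pair_graph\<close>: its arc set \<^term>\<open>parcs G\<close> is symmetric and
  loop-free, so it is exactly the set D(G) of both orientations of all edges, with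
  o(e) = \<^term>\<open>fst e\<close>, t(e) = \<^term>\<open>snd e\<close> and inverse arc \<^term>\<open>prod.swap e\<close>.
\<close>

section \<open>Grover walks\<close>

definition grover_matrix :: "'a pair_pre_digraph \<Rightarrow> 'a \<times> 'a \<Rightarrow> 'a \<times> 'a \<Rightarrow> real" where
  "grover_matrix G e f =
    (if snd f = fst e \<and> e \<noteq> prod.swap f then 2 / real (out_degree G (snd f))
     else if e = prod.swap f then 2 / real (out_degree G (snd f)) - 1
     else 0)"

text \<open>Powers of a square matrix whose rows and columns are indexed by the finite set \<open>A\<close>;
  only the entries with both indices in \<open>A\<close> are meaningful.\<close>

primrec matpow_on :: "'i set \<Rightarrow> ('i \<Rightarrow> 'i \<Rightarrow> real) \<Rightarrow> nat \<Rightarrow> 'i \<Rightarrow> 'i \<Rightarrow> real" where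
  "matpow_on A M 0 = (\<lambda>i j. if i = j then 1 else 0)"
| "matpow_on A M (Suc k) = (\<lambda>i j. \<Sum>l\<in>A. M i l * matpow_on A M k l j)"

definition grover_power_is_id :: "'a pair_pre_digraph \<Rightarrow> nat \<Rightarrow> bool" where
  "grover_power_is_id G k \<longleftrightarrow>
    (\<forall>e\<in>parcs G. \<forall>f\<in>parcs G.
       matpow_on (parcs G) (grover_matrix G) k e f = (if e = f then 1 else 0))"

definition periodic_grover_walk :: "'a pair_pre_digraph \<Rightarrow> bool" where
  "periodic_grover_walk G \<longleftrightarrow> (\<exists>k\<ge>1. grover_power_is_id G k)"

text \<open>Unspecified unless \<^term>\<open>periodic_grover_walk G\<close>.\<close>

definition grover_period :: "'a pair_pre_digraph \<Rightarrow> nat" where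
  "grover_period G = (LEAST k. k \<ge> 1 \<and> grover_power_is_id G k)"

section \<open>Generalized Bethe trees\<close>

text \<open>The library predicate \<^const>\<open>tree\<close> is not usable for symmetric digraphs, because there an
  edge traversed back and forth counts as a cycle. In a simple graph, the cycles in the
  undirected sense are the directed ones of length at least 3.\<close>

definition undirected_tree :: "'a pair_pre_digraph \<Rightarrow> bool" where
  "undirected_tree G \<longleftrightarrow>
    pair_graph G \<and> Digraph_Component.connected (with_proj G) \<and>
    \<not> (\<exists>p. pre_digraph.cycle (with_proj G) p \<and> length p \<ge> 3)"

text \<open>\<open>ds\<close> is the list d(0), ..., d(n-1), and the level C_i is the set of vertices \<open>v\<close> with
  \<open>lev v = i\<close>. Leaves in C_n also have their unique neighbour in C_(n-1), so that the levels are
  the distances from the root.\<close>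

definition generalized_bethe_tree :: "nat list \<Rightarrow> 'a pair_pre_digraph \<Rightarrow> bool" where
  "generalized_bethe_tree ds G \<longleftrightarrow>
    ds \<noteq> [] \<and> (\<forall>d\<in>set ds. d \<ge> 1) \<and> undirected_tree G \<and>
    (\<exists>lev :: 'a \<Rightarrow> nat.
       (\<exists>root. {v \<in> pverts G. lev v = 0} = {root}) \<and>
       (\<forall>v\<in>pverts G. lev v \<le> length ds) \<and>
       (\<forall>v\<in>pverts G. lev v < length ds \<longrightarrow>
          card {w. (v, w) \<in> parcs G \<and> lev w = lev v + 1} = ds ! lev v) \<and>
       (\<forall>v\<in>pverts G. lev v \<ge> 1 \<longrightarrow>
          card {w. (v, w) \<in> parcs G \<and> lev w = lev v - 1} = 1) \<and>
       (\<forall>v\<in>pverts G. lev v = length ds \<longrightarrow> out_degree G v = 1))"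

text \<open>The standard representative of B(d(0), ..., d(n-1)): the vertex \<open>[j\<^sub>0, ..., j\<^sub>i]\<close> is the
  \<open>j\<^sub>i\<close>-th child of \<open>[j\<^sub>0, ..., j\<^sub>i\<^sub>-\<^sub>1]\<close>, and \<open>[]\<close> is the root.\<close>

definition bethe_verts :: "nat list \<Rightarrow> nat list set" where
  "bethe_verts ds = {xs. length xs \<le> length ds \<and> (\<forall>i<length xs. xs ! i < ds ! i)}"

definition bethe_graph :: "nat list \<Rightarrow> nat list pair_pre_digraph" where
  "bethe_graph ds = \<lparr>
     pverts = bethe_verts ds,
     parcs = {(xs, ys). xs \<in> bethe_verts ds \<and> ys \<in> bethe_verts ds \<and>
       ((\<exists>j. ys = xs @ [j]) \<or> (\<exists>j. xs = ys @ [j]))} \<rparr>"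

lemma pair_graph_bethe_graph: "pair_graph (bethe_graph ds)"
proof -
  have fin: "finite (bethe_verts ds)"
  proof (rule finite_subset)
    show "bethe_verts ds \<subseteq> {xs. set xs \<subseteq> {..<Suc (sum_list ds)} \<and> length xs \<le> length ds}"
    proof (clarsimp simp: bethe_verts_def in_set_conv_nth)
      fix xs i assume *: "length xs \<le> length ds" "\<forall>i<length xs. xs ! i < ds ! i" "i < length xs"
      then have "xs ! i < ds ! i" by blast
      also have "ds ! i \<le> sum_list ds" using * by (intro member_le_sum_list) auto
      finally show "xs ! i < Suc (sum_list ds)" by simp
    qed
    show "finite {xs. set xs \<subseteq> {..<Suc (sum_list ds)} \<and> length xs \<le> length ds}"
      by (rule finite_lists_length_le) simp
  qed
  then have "finite (bethe_verts ds \<times> bethe_verts ds)" by simp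
  then have "finite (parcs (bethe_graph ds))"
    by (rule rev_finite_subset) (auto simp: bethe_graph_def)
  with fin show ?thesis
    by unfold_locales (auto simp: bethe_graph_def symmetric_def sym_def)
qed

lemma connected_bethe_graph: "Digraph_Component.connected (with_proj (bethe_graph ds))"
proof -
  let ?R = "(parcs (bethe_graph ds))\<^sup>s" and ?V = "bethe_verts ds"
  have root: "[] \<in> ?V" by (simp add: bethe_verts_def)
  have *: "xs \<in> ?V \<Longrightarrow> (xs, []) \<in> rtrancl_on ?V ?R \<and> ([], xs) \<in> rtrancl_on ?V ?R" for xs
  proof (induction xs rule: rev_induct)
    case Nil
    then show ?case by auto
  next
    case (snoc x xs)
    have "xs \<in> ?V" using snoc.prems
      by (auto simp: bethe_verts_def nth_append split: if_splits)
    moreover from this have "(xs, xs @ [x]) \<in> ?R" "(xs @ [x], xs) \<in> ?R"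
      using snoc.prems by (auto simp: bethe_graph_def symcl_def)
    ultimately show ?case
      using snoc.IH snoc.prems
      by (auto intro: rtrancl_on_into_rtrancl_on[of "[]" xs]
          converse_rtrancl_on_into_rtrancl_on[of _ xs])
  qed
  have "(u, v) \<in> rtrancl_on ?V ?R" if "u \<in> ?V" "v \<in> ?V" for u v
    using *[OF that(1)] *[OF that(2)] rtrancl_on_trans[of u "[]" ?V ?R v] by blast
  with root show ?thesis
    by (auto simp: connected_conv bethe_graph_def)
qed

lemma pawalk_verts_conv: "pcas u p v \<Longrightarrow> pawalk_verts u p = u # map snd p"
  by (induction p arbitrary: u) auto

lemma pcas_fst: "pcas u p v \<Longrightarrow> fst ` set p \<subseteq> insert u (snd ` set p)"
  by (induction p arbitrary: u) auto

lemma pcas_append: "pcas u (p @ q) v \<longleftrightarrow> (\<exists>w. pcas u p w \<and> pcas w q v)"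
  by (induction p arbitrary: u) auto

lemma pcas_last: "pcas u p v \<Longrightarrow> p \<noteq> [] \<Longrightarrow> v \<in> snd ` set p"
  by (induction p arbitrary: u) (auto, (metis pcas.simps(1)))

lemma bethe_graph_no_cycle:
  assumes "pre_digraph.cycle (with_proj (bethe_graph ds)) p"
  shows "length p < 3"
proof -
  interpret pair_pre_digraph "bethe_graph ds" .
  obtain u where arcs: "set p \<subseteq> parcs (bethe_graph ds)" and cas: "pcas u p u"
    and dist: "distinct (tl (pawalk_verts u p))" and ne: "p \<noteq> []"
    using assms by (auto simp: cycle_def awalk_def)
  have dist: "distinct (map snd p)"
    using dist pawalk_verts_conv[OF cas] by simp
  have fst_snd: "fst a \<in> snd ` set p" if "a \<in> set p" for a
    using that pcas_fst[OF cas] pcas_last[OF cas ne] by auto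
  define M where "M = Max (length ` snd ` set p)"
  have "M \<in> length ` snd ` set p"
    unfolding M_def using ne by (intro Max_in) auto
  then obtain y x where yx: "(y, x) \<in> set p" "length x = M" by auto
  have le: "length z \<le> length x" if "z \<in> snd ` set p" for z
    unfolding yx(2) M_def using that by (intro Max_ge) auto
  have parent1: "a = butlast x" if "(a, x) \<in> set p" for a
  proof -
    have "(a, x) \<in> parcs (bethe_graph ds)" using that arcs by auto
    moreover have "length a \<le> length x" using fst_snd[OF that] le by auto
    ultimately show ?thesis by (auto simp: bethe_graph_def)
  qed
  have parent2: "b = butlast x" if "(x, b) \<in> set p" for b
  proof -
    have "(x, b) \<in> parcs (bethe_graph ds)" using that arcs by auto
    moreover have "length b \<le> length x" using that by (intro le) force
    ultimately show ?thesis by (auto simp: bethe_graph_def)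
  qed
  have y: "y = butlast x" using yx parent1 by auto
  obtain p1 p2 where p: "p = p1 @ (y, x) # p2" using yx(1) by (meson split_list)
  have c1: "pcas u p1 y" and c2: "pcas x p2 u"
    using cas unfolding p pcas_append by auto
  show ?thesis
  proof (cases p2)
    case Nil
    then have u: "u = x" using c2 by simp
    show ?thesis
    proof (cases p1)
      case Nil
      then show ?thesis using p \<open>p2 = []\<close> by simp
    next
      case (Cons e q)
      obtain b where e: "e = (x, b)" using c1 u Cons by (cases e) auto
      have "b = y" using parent2[of b] y p Cons e by auto
      then have "q = []"
        using pcas_last[of b q y] c1 dist Cons e p by auto
      then show ?thesis using p Cons \<open>p2 = []\<close> by simp
    qed
  next
    case (Cons e q)
    obtain b where e: "e = (x, b)" using c2 Cons by (cases e) auto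
    have b: "b = y" using parent2[of b] y p Cons e by auto
    have "p1 = []"
      using pcas_last[OF c1] dist p Cons e b by auto
    moreover from this have "u = y" using c1 by simp
    then have "q = []"
      using pcas_last[of b q u] c2 dist p Cons e b by auto
    ultimately show ?thesis using p Cons by simp
  qed
qed

lemma generalized_bethe_tree_bethe_graph:
  assumes "ds \<noteq> []" and "\<forall>d\<in>set ds. d \<ge> 1"
  shows "generalized_bethe_tree ds (bethe_graph ds)"
proof -
  let ?G = "bethe_graph ds"
  have pre: "xs \<in> bethe_verts ds" if "xs @ [j] \<in> bethe_verts ds" for xs j
    using that by (auto simp: bethe_verts_def nth_append split: if_splits)
  have children: "{w. (v, w) \<in> parcs ?G \<and> length w = length v + 1} = (\<lambda>j. v @ [j]) ` {..<ds ! length v}"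
    if "v \<in> bethe_verts ds" "length v < length ds" for v
  proof -
    have iff: "v @ [j] \<in> bethe_verts ds \<longleftrightarrow> j < ds ! length v" for j
      using that by (auto simp: bethe_verts_def nth_append less_Suc_eq)
    have "(v, w) \<in> parcs ?G \<and> length w = length v + 1 \<longleftrightarrow>
        w \<in> bethe_verts ds \<and> (\<exists>j. w = v @ [j])" for w
      using that(1) unfolding bethe_graph_def pair_pre_digraph.simps by force
    then have "{w. (v, w) \<in> parcs ?G \<and> length w = length v + 1} =
        {w. w \<in> bethe_verts ds \<and> (\<exists>j. w = v @ [j])}"
      by (intro Collect_cong)
    also have "\<dots> = {v @ [j] | j. v @ [j] \<in> bethe_verts ds}" by blast
    also have "\<dots> = (\<lambda>j. v @ [j]) ` {..<ds ! length v}" unfolding iff by blast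
    finally show ?thesis .
  qed
  have parent: "{w. (v, w) \<in> parcs ?G \<and> length w = length v - 1} = {butlast v}"
    if v_in: "v \<in> bethe_verts ds" and len: "length v \<ge> 1" for v
  proof -
    obtain xs j where v: "v = xs @ [j]" using len by (cases v rule: rev_cases) auto
    show ?thesis using v_in pre[of xs j] unfolding v by (auto simp: bethe_graph_def)
  qed
  have leaf: "out_arcs (with_proj ?G) v = {(v, butlast v)}"
    if v_in: "v \<in> bethe_verts ds" and len: "length v = length ds" for v
  proof -
    obtain xs j where v: "v = xs @ [j]" using len assms(1) by (cases v rule: rev_cases) auto
    have "v @ [i] \<notin> bethe_verts ds" for i using len by (auto simp: bethe_verts_def)
    then show ?thesis using v_in pre[of xs j] unfolding v
      by (auto simp: bethe_graph_def out_arcs_def)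
  qed
  have tree: "undirected_tree ?G"
    unfolding undirected_tree_def
    using pair_graph_bethe_graph connected_bethe_graph bethe_graph_no_cycle
    by (auto simp: not_le[symmetric])
  have V: "pverts ?G = bethe_verts ds" by (simp add: bethe_graph_def)
  have root: "\<exists>r. {v \<in> bethe_verts ds. length v = 0} = {r}"
    by (rule exI[of _ "[]"]) (auto simp: bethe_verts_def)
  have height: "\<forall>v\<in>bethe_verts ds. length v \<le> length ds"
    by (simp add: bethe_verts_def)
  have card_children: "\<forall>v\<in>bethe_verts ds. length v < length ds \<longrightarrow>
      card {w. (v, w) \<in> parcs ?G \<and> length w = length v + 1} = ds ! length v"
  proof (intro ballI impI)
    fix v assume "v \<in> bethe_verts ds" "length v < length ds"
    note children[OF this]
    moreover have "card ((\<lambda>j. v @ [j]) ` {..<ds ! length v}) = ds ! length v"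
      by (subst card_image) (auto intro: inj_onI)
    ultimately show "card {w. (v, w) \<in> parcs ?G \<and> length w = length v + 1} = ds ! length v"
      by argo
  qed
  have card_parent: "\<forall>v\<in>bethe_verts ds. length v \<ge> 1 \<longrightarrow>
      card {w. (v, w) \<in> parcs ?G \<and> length w = length v - 1} = 1"
  proof (intro ballI impI)
    fix v assume "v \<in> bethe_verts ds" "length v \<ge> 1"
    note parent[OF this]
    then show "card {w. (v, w) \<in> parcs ?G \<and> length w = length v - 1} = 1" by simp
  qed
  have degree_leaf: "\<forall>v\<in>bethe_verts ds. length v = length ds \<longrightarrow>
      out_degree (with_proj ?G) v = 1"
    by (simp add: out_degree_def leaf)
  show ?thesis
    unfolding generalized_bethe_tree_def V
    by (intro conjI assms tree exI[of _ "length :: nat list \<Rightarrow> nat"])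
      (fact root height card_children card_parent degree_leaf)+
qed

section \<open>Paths, stars and subdivisions\<close>

definition path_graph :: "nat \<Rightarrow> nat pair_pre_digraph" where
  "path_graph m = \<lparr>
     pverts = {..<m},
     parcs = {(i, j). i < m \<and> j < m \<and> (j = i + 1 \<or> i = j + 1)} \<rparr>"

definition star_graph :: "nat \<Rightarrow> nat pair_pre_digraph" where
  "star_graph m = \<lparr>
     pverts = {..<m},
     parcs = {(i, j). i < m \<and> j < m \<and> i \<noteq> j \<and> (i = 0 \<or> j = 0)} \<rparr>"

text \<open>For an arc \<open>(u, v)\<close>, the vertex at position \<open>i \<le> k\<close> on the path that replaces the edge
  \<open>uv\<close> is the multiset consisting of \<open>k - i\<close> copies of \<open>u\<close> and \<open>i\<close> copies of \<open>v\<close>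
  (discrete barycentric coordinates). Position \<open>i\<close> on \<open>(u, v)\<close> and position \<open>k - i\<close> on
  \<open>(v, u)\<close> are thus the same vertex, and an original vertex \<open>v\<close> becomes \<open>k\<close> copies of \<open>v\<close>.\<close>

definition subdiv_vertex :: "nat \<Rightarrow> 'a \<times> 'a \<Rightarrow> nat \<Rightarrow> 'a multiset" where
  "subdiv_vertex k e i = replicate_mset (k - i) (fst e) + replicate_mset i (snd e)"

definition subdivision_graph :: "nat \<Rightarrow> 'a pair_pre_digraph \<Rightarrow> 'a multiset pair_pre_digraph" where
  "subdivision_graph k H = \<lparr>
     pverts = replicate_mset k ` pverts H \<union> {subdiv_vertex k e i | e i. e \<in> parcs H \<and> i \<le> k},
     parcs = {(subdiv_vertex k e i, subdiv_vertex k e j) | e i j.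
       e \<in> parcs H \<and> i \<le> k \<and> j \<le> k \<and> (j = i + 1 \<or> i = j + 1)} \<rparr>"

lemma pair_graph_subdivision_graph:
  assumes "pair_graph H"
  shows "pair_graph (subdivision_graph k H)"
proof -
  interpret H: pair_graph H by fact
  have loop: "i = j" if "e \<in> parcs H" "subdiv_vertex k e i = subdiv_vertex k e j" for e i j
  proof -
    have "fst e \<noteq> snd e" using that(1) by (rule H.pair_no_loops)
    then have "count (subdiv_vertex k e m) (snd e) = m" for m
      by (simp add: subdiv_vertex_def)
    with that(2) show ?thesis by metis
  qed
  let ?W = "(\<lambda>(e, i). subdiv_vertex k e i) ` (parcs H \<times> {..k})"
  have verts: "pverts (subdivision_graph k H) = replicate_mset k ` pverts H \<union> ?W"
    unfolding subdivision_graph_def pair_pre_digraph.simps by force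
  have arcs: "(x, y) \<in> parcs (subdivision_graph k H) \<longleftrightarrow>
      (\<exists>e\<in>parcs H. \<exists>i\<le>k. \<exists>j\<le>k. x = subdiv_vertex k e i \<and> y = subdiv_vertex k e j \<and>
        (j = i + 1 \<or> i = j + 1))" for x y
    unfolding subdivision_graph_def pair_pre_digraph.simps by blast
  have finW: "finite ?W" using H.pair_finite_arcs by simp
  have sub: "x \<in> ?W \<and> y \<in> ?W \<and> x \<noteq> y \<and> (y, x) \<in> parcs (subdivision_graph k H)"
    if xy: "(x, y) \<in> parcs (subdivision_graph k H)" for x y
  proof -
    obtain e i j where *: "e \<in> parcs H" "i \<le> k" "j \<le> k" "x = subdiv_vertex k e i"
      "y = subdiv_vertex k e j" "j = i + 1 \<or> i = j + 1"
      using xy unfolding arcs by blast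
    have "x \<in> ?W" unfolding *(4) using *(1,2) by (intro image_eqI[of _ _ "(e, i)"]) auto
    moreover have "y \<in> ?W" unfolding *(5) using *(1,3) by (intro image_eqI[of _ _ "(e, j)"]) auto
    moreover have "x \<noteq> y" using loop[OF *(1), of i j] *(4-6) by auto
    moreover have "(y, x) \<in> parcs (subdivision_graph k H)" unfolding arcs using * by blast
    ultimately show ?thesis by blast
  qed
  have finA: "finite (parcs (subdivision_graph k H))"
    by (rule finite_subset[OF _ finite_cartesian_product[OF finW finW]]) (use sub in auto)
  have "sym (parcs (subdivision_graph k H))" using sub by (blast intro: symI)
  with finW finA sub H.pair_finite_verts show ?thesis
    by unfold_locales (simp_all add: verts symmetric_def split_paired_all)
qed

abbreviation graph_iso :: "'a pair_pre_digraph \<Rightarrow> 'b pair_pre_digraph \<Rightarrow> bool"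
    (infix \<open>\<simeq>\<^sub>g\<close> 50) where
  "G \<simeq>\<^sub>g H \<equiv> digraph_iso (with_proj G) (with_proj H)"

end

theory Submission
  imports Defs "HOL-Computational_Algebra.Polynomial_Factorial"
begin

text \<open>
  For the periods, the walk on \<open>S\<^sub>k(H)\<close> is reduced to the walk on \<open>H\<close>: \<open>k\<close> steps on the subdivision
  act as one step of \<open>H\<close> on the arcs at each fixed position \<open>i < k\<close>. This leaves
  an edge, the stars, \<open>B(s,3)\<close> and \<open>B(1,2,3)\<close>, which are computed by hand.

  For the converse, let \<open>U\<close> be periodic on \<open>B(d(0), \<dots>, d(n-1))\<close>. Radial vectors, and vectors that are
  radial and antisymmetric in two branches below one vertex, behave like waves in a layered
  medium with reflection coefficients \<open>(1 - d(i)) / (1 + d(i))\<close>. A wave \<open>V\<close> with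
  \<open>(1 - z U) V = D(z) \<delta>\<close> whose amplitude at a leaf is a power of \<open>z\<close> shows that \<open>D\<close> divides
  \<open>z\<^sup>a (1 - z\<^sup>K)\<close> over the rationals if \<open>U\<^sup>K = 1\<close>. As \<open>D(0) = 1\<close>, the Gauss lemma gives \<open>D\<close>
  integer coefficients. Let \<open>p\<close> be the distance of the lowest branching level to the leaves.
  The integrality of the coefficients of \<open>z\<^bsup>2p\<^esup>\<close> then forces the branching levels to be equally
  spaced, determines their degrees, and leaves at most two of them below the root.
\<close>

section \<open>The Grover walk as an operator\<close>

text \<open>Periodicity would make all eigenvalues roots of unity, but one entry of the resolvent
  suffices. If \<open>U^K = 1\<close>, then \<open>1 - z^K\<close> is a polynomial multiple of
  \<open>1 - z U\<close>; hence at an arc into a leaf, where the wave is a power of z, that power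
  times \<open>1 - z^K\<close> is \<open>D(z)\<close> times a polynomial. The reflection coefficient
  r vanishes at a level with one child, which therefore only delays the wave, and lies strictly
  between -1 and 0 at a branching level. The lowest branching level puts r into the coefficient of
  \<open>z^(2p)\<close>, which is no integer; the next level above it (branching, or the root) can
  add a second term only from distance exactly p. Antisymmetric vectors give \<open>2 * r\<close>,
  so r is -1/2 and the degree is 3. Radial vectors give \<open>r - r\<close>, which is why a single
  branching level below an unbranched root, a star seen from the end of an arm, may have any degree.
  With e children one level above the 3 and again distance p to the next level, the terms are
  \<open>-1 / (1 + e)\<close> and \<open>(1 - e) / (1 + e)\<close>. Their sum is never an integer,
  and their difference only for \<open>e = 2\<close>: this is the origin of B(1,2,3), and the reason
  why its root cannot branch.\<close>

definition nbrs :: "'a pair_pre_digraph \<Rightarrow> 'a \<Rightarrow> 'a set" where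
  "nbrs G v = {w. (w, v) \<in> parcs G}"

definition grover_step :: "'a pair_pre_digraph \<Rightarrow> ('a \<times> 'a \<Rightarrow> real) \<Rightarrow> 'a \<times> 'a \<Rightarrow> real" where
  "grover_step G \<psi> e =
    2 / real (card (nbrs G (fst e))) * (\<Sum>w\<in>nbrs G (fst e). \<psi> (w, fst e)) - \<psi> (prod.swap e)"

lemma (in pair_graph) finite_nbrs: "finite (nbrs G v)"
proof -
  have "nbrs G v \<subseteq> pverts G" unfolding nbrs_def using in_arcsD1 by auto
  then show ?thesis using pair_finite_verts by (rule finite_subset)
qed

lemma (in pair_graph) out_degree_card_nbrs: "out_degree (with_proj G) v = card (nbrs G v)"
proof -
  have "out_arcs (with_proj G) v = Pair v ` nbrs G v"
    by (auto simp: out_arcs_def nbrs_def image_iff intro: arcs_symmetric)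
  then show ?thesis by (simp add: out_degree_def card_image inj_on_def)
qed

lemma (in pair_graph) swap_arc: "e \<in> parcs G \<Longrightarrow> prod.swap e \<in> parcs G"
  by (cases e) (auto intro: arcs_symmetric)

lemma (in pair_graph) grover_matrix_sum:
  assumes "e \<in> parcs G"
  shows "(\<Sum>f\<in>parcs G. grover_matrix G e f * \<psi> f) = grover_step G \<psi> e"
proof -
  let ?c = "2 / real (card (nbrs G (fst e)))"
  \<comment> \<open>The head of \<open>prod.swap e\<close> is \<open>fst e\<close>, so the three
    cases of the matrix are a combination of two indicators.\<close>
  have M: "grover_matrix G e f = (if snd f = fst e then ?c else 0) - (if f = prod.swap e then 1 else 0)" for f
    by (cases e; cases f) (auto simp: grover_matrix_def out_degree_card_nbrs)
  have "{f \<in> parcs G. snd f = fst e} = (\<lambda>w. (w, fst e)) ` nbrs G (fst e)"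
    by (auto simp: nbrs_def)
  then have S: "(\<Sum>f | f \<in> parcs G \<and> snd f = fst e. \<psi> f) = (\<Sum>w\<in>nbrs G (fst e). \<psi> (w, fst e))"
    by (simp add: sum.reindex inj_on_def)
  have "(\<Sum>f\<in>parcs G. grover_matrix G e f * \<psi> f) =
     (\<Sum>f\<in>parcs G. if snd f = fst e then ?c * \<psi> f else 0) - (\<Sum>f\<in>parcs G. if f = prod.swap e then \<psi> f else 0)"
    unfolding sum_subtractf[symmetric] by (intro sum.cong) (auto simp: M left_diff_distrib)
  also have "(\<Sum>f\<in>parcs G. if f = prod.swap e then \<psi> f else 0) = \<psi> (prod.swap e)"
    using pair_finite_arcs swap_arc[OF assms] by simp
  also have "(\<Sum>f\<in>parcs G. if snd f = fst e then ?c * \<psi> f else 0) = ?c * (\<Sum>w\<in>nbrs G (fst e). \<psi> (w, fst e))"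
    unfolding S[symmetric] sum_distrib_left using pair_finite_arcs
    by (simp add: sum.inter_filter del: times_divide_eq_left)
  finally show ?thesis by (simp add: grover_step_def)
qed

lemma (in pair_graph) grover_step_cong:
  assumes "\<And>f. f \<in> parcs G \<Longrightarrow> \<psi> f = \<phi> f" "e \<in> parcs G"
  shows "grover_step G \<psi> e = grover_step G \<phi> e"
  unfolding grover_matrix_sum[OF assms(2), symmetric] using assms(1) by (intro sum.cong) auto

lemma (in pair_graph) grover_step_pow_cong:
  assumes "\<And>f. f \<in> parcs G \<Longrightarrow> \<psi> f = \<phi> f" "e \<in> parcs G"
  shows "(grover_step G ^^ k) \<psi> e = (grover_step G ^^ k) \<phi> e"
  using assms by (induction k arbitrary: e) (auto intro: grover_step_cong)

lemma (in pair_graph) grover_step_pow_matpow: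
  assumes "e \<in> parcs G"
  shows "(grover_step G ^^ k) \<psi> e = (\<Sum>f\<in>parcs G. matpow_on (parcs G) (grover_matrix G) k e f * \<psi> f)"
  using assms
proof (induction k arbitrary: e)
  case 0
  then have "(\<Sum>f\<in>parcs G. matpow_on (parcs G) (grover_matrix G) 0 e f * \<psi> f)
      = (\<Sum>f\<in>parcs G. if e = f then \<psi> f else 0)" by (intro sum.cong) auto
  with 0 show ?case using pair_finite_arcs by simp
next
  case (Suc k)
  let ?A = "parcs G" and ?M = "grover_matrix G"
  have "(grover_step G ^^ Suc k) \<psi> e = (\<Sum>l\<in>?A. ?M e l * (grover_step G ^^ k) \<psi> l)"
    using grover_matrix_sum[OF Suc.prems] by simp
  also have "\<dots> = (\<Sum>l\<in>?A. \<Sum>f\<in>?A. ?M e l * matpow_on ?A ?M k l f * \<psi> f)"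
    by (intro sum.cong) (auto simp: Suc.IH sum_distrib_left mult.assoc)
  also have "\<dots> = (\<Sum>f\<in>?A. \<Sum>l\<in>?A. ?M e l * matpow_on ?A ?M k l f * \<psi> f)"
    by (rule sum.swap)
  finally show ?case by (simp add: sum_distrib_right)
qed

lemma grover_power_is_id_iff:
  assumes "pair_graph G"
  shows "grover_power_is_id G k \<longleftrightarrow> (\<forall>\<psi>. \<forall>e\<in>parcs G. (grover_step G ^^ k) \<psi> e = \<psi> e)"
proof -
  interpret pair_graph G by fact
  let ?P = "matpow_on (parcs G) (grover_matrix G) k"
  have delta: "(\<Sum>f\<in>parcs G. ?P e f * (if f = g then 1 else 0)) = ?P e g" if "g \<in> parcs G" for e g
  proof -
    have "(\<Sum>f\<in>parcs G. ?P e f * (if f = g then 1 else 0)) = (\<Sum>f\<in>parcs G. if f = g then ?P e f else 0)"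
      by (intro sum.cong) auto
    then show ?thesis using that pair_finite_arcs by simp
  qed
  show ?thesis
  proof
    assume id: "grover_power_is_id G k"
    show "\<forall>\<psi>. \<forall>e\<in>parcs G. (grover_step G ^^ k) \<psi> e = \<psi> e"
    proof (intro allI ballI)
      fix \<psi> e assume e: "e \<in> parcs G"
      have "(grover_step G ^^ k) \<psi> e = (\<Sum>f\<in>parcs G. if e = f then \<psi> f else 0)"
        unfolding grover_step_pow_matpow[OF e]
        using id e by (intro sum.cong) (auto simp: grover_power_is_id_def)
      then show "(grover_step G ^^ k) \<psi> e = \<psi> e" using e pair_finite_arcs by simp
    qed
  next
    assume *: "\<forall>\<psi>. \<forall>e\<in>parcs G. (grover_step G ^^ k) \<psi> e = \<psi> e"
    show "grover_power_is_id G k"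
      unfolding grover_power_is_id_def
    proof (intro ballI)
      fix e f assume "e \<in> parcs G" "f \<in> parcs G"
      then show "?P e f = (if e = f then 1 else 0)"
        using * delta[of f e] grover_step_pow_matpow[of e k "\<lambda>x. if x = f then 1 else 0"] by simp
    qed
  qed
qed

section \<open>Exponents k with U^k = 1\<close>

lemma grover_power_is_id_0: "pair_graph G \<Longrightarrow> grover_power_is_id G 0"
  by (simp add: grover_power_is_id_iff)

lemma grover_power_is_id_add:
  assumes "pair_graph G" "grover_power_is_id G m"
  shows "grover_power_is_id G (m + n) \<longleftrightarrow> grover_power_is_id G n"
  using assms by (auto simp: grover_power_is_id_iff funpow_add)

lemma grover_power_is_id_mult:
  assumes "pair_graph G" "grover_power_is_id G m"
  shows "grover_power_is_id G (q * m)"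
  using assms by (induction q) (auto simp: grover_power_is_id_0 grover_power_is_id_add)

text \<open>Division with remainder: the remainder of an exponent modulo the period is again an
  exponent, so by minimality it is 0.\<close>

lemma
  assumes "pair_graph G" "periodic_grover_walk G"
  shows grover_period_pos: "grover_period G \<ge> 1"
    and grover_power_is_id_iff_dvd: "grover_power_is_id G k \<longleftrightarrow> grover_period G dvd k"
proof -
  let ?Q = "\<lambda>k. k \<ge> 1 \<and> grover_power_is_id G k"
  have p: "?Q (grover_period G)"
    using assms(2) LeastI_ex[of ?Q] unfolding periodic_grover_walk_def grover_period_def by blast
  then show "grover_period G \<ge> 1" by simp
  show "grover_power_is_id G k \<longleftrightarrow> grover_period G dvd k"
  proof
    assume k: "grover_power_is_id G k"
    let ?p = "grover_period G"
    have "grover_power_is_id G (k div ?p * ?p + k mod ?p)" using k by simp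
    then have "grover_power_is_id G (k mod ?p)"
      using grover_power_is_id_add[OF assms(1) grover_power_is_id_mult] assms(1) p by blast
    moreover have "k mod ?p < ?p" using p by simp
    ultimately have "\<not> k mod ?p \<ge> 1"
      unfolding grover_period_def using not_less_Least by blast
    then have "k mod ?p = 0" by linarith
    then show "?p dvd k" by (rule mod_0_imp_dvd)
  next
    assume "grover_period G dvd k"
    then have "k = k div grover_period G * grover_period G" by simp
    then show "grover_power_is_id G k" using grover_power_is_id_mult[OF assms(1)] p by metis
  qed
qed

lemma grover_period_eqI:
  assumes "pair_graph G" "p \<ge> 1" "\<And>k. grover_power_is_id G k \<longleftrightarrow> p dvd k"
  shows "periodic_grover_walk G" "grover_period G = p"
proof -
  show per: "periodic_grover_walk G" unfolding periodic_grover_walk_def using assms(2) assms(3)[of p] by auto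
  have "grover_period G dvd k \<longleftrightarrow> p dvd k" for k
    using grover_power_is_id_iff_dvd[OF assms(1) per, of k] assms(3)[of k] by simp
  then show "grover_period G = p"
    using dvd_refl[of p] dvd_refl[of "grover_period G"] by (intro dvd_antisym) blast+
qed

section \<open>Invariance under isomorphism\<close>

definition pair_graph_iso :: "('a \<Rightarrow> 'b) \<Rightarrow> 'a pair_pre_digraph \<Rightarrow> 'b pair_pre_digraph \<Rightarrow> bool" where
  "pair_graph_iso f G H \<longleftrightarrow> bij_betw f (pverts G) (pverts H) \<and>
     (\<forall>u\<in>pverts G. \<forall>v\<in>pverts G. (u, v) \<in> parcs G \<longleftrightarrow> (f u, f v) \<in> parcs H)"

lemma pair_graph_iso_inv:
  assumes "pair_graph_iso f G H"
  shows "pair_graph_iso (the_inv_into (pverts G) f) H G"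
proof -
  have b: "bij_betw f (pverts G) (pverts H)" using assms by (simp add: pair_graph_iso_def)
  let ?g = "the_inv_into (pverts G) f"
  have g: "bij_betw ?g (pverts H) (pverts G)" using b by (rule bij_betw_the_inv_into)
  have *: "?g x \<in> pverts G" "f (?g x) = x" if "x \<in> pverts H" for x
    using that b bij_betwE[OF g] f_the_inv_into_f_bij_betw[OF b] by auto
  show ?thesis
    using assms g * unfolding pair_graph_iso_def by auto
qed

lemma pair_graph_iso_comp:
  assumes "pair_graph_iso f G H" "pair_graph_iso g H K"
  shows "pair_graph_iso (g \<circ> f) G K"
  using assms unfolding pair_graph_iso_def
  by (auto intro: bij_betw_trans dest: bij_betwE)

text \<open>A library isomorphism also carries an arc map and new head and tail functions. Between
  simple graphs these are forced to be \<open>map_prod f f\<close>, \<open>snd\<close> and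
  \<open>fst\<close>, so a vertex map that preserves and reflects adjacency carries all the
  information.\<close>

lemma digraph_iso_iff_pair_graph_iso:
  assumes "pair_graph G" "pair_graph H"
  shows "G \<simeq>\<^sub>g H \<longleftrightarrow> (\<exists>f. pair_graph_iso f G H)"
proof
  interpret G: pair_graph G by fact
  interpret H: pair_graph H by fact
  assume "G \<simeq>\<^sub>g H"
  then obtain h where h: "pre_digraph.digraph_isomorphism (with_proj G) h" "with_proj H = app_iso h (with_proj G)"
    unfolding digraph_iso_def by blast
  let ?f = "iso_verts h"
  have V: "pverts H = ?f ` pverts G" and A: "parcs H = iso_arcs h ` parcs G"
    and T: "iso_tail h = fst" "iso_head h = snd"
    using arg_cong[OF h(2), of verts] arg_cong[OF h(2), of arcs] arg_cong[OF h(2), of tail] arg_cong[OF h(2), of head]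
    by simp_all
  have inj: "inj_on ?f (pverts G)" and ends: "\<And>a. a \<in> parcs G \<Longrightarrow> iso_arcs h a = (?f (fst a), ?f (snd a))"
    using h(1) T unfolding pre_digraph.digraph_isomorphism_def by (auto simp: prod_eq_iff)
  have A': "parcs H = map_prod ?f ?f ` parcs G"
    unfolding A by (intro image_cong) (auto simp: ends)
  have "(u, v) \<in> parcs G \<longleftrightarrow> (?f u, ?f v) \<in> parcs H" if "u \<in> pverts G" "v \<in> pverts G" for u v
  proof
    show "(u, v) \<in> parcs G \<Longrightarrow> (?f u, ?f v) \<in> parcs H" using A' by force
    assume "(?f u, ?f v) \<in> parcs H"
    then obtain a b where ab: "(a, b) \<in> parcs G" "?f a = ?f u" "?f b = ?f v" using A' by force
    then have "a = u" "b = v"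
      using that inj_onD[OF inj] G.in_arcsD1[OF ab(1)] G.in_arcsD2[OF ab(1)] by metis+
    then show "(u, v) \<in> parcs G" using ab(1) by simp
  qed
  then have "pair_graph_iso ?f G H"
    unfolding pair_graph_iso_def bij_betw_def using V inj by simp
  then show "\<exists>f. pair_graph_iso f G H" by blast
next
  interpret G: pair_graph G by fact
  interpret H: pair_graph H by fact
  assume "\<exists>f. pair_graph_iso f G H"
  then obtain f where f: "pair_graph_iso f G H" by blast
  let ?h = "\<lparr>iso_verts = f, iso_arcs = map_prod f f, iso_head = snd, iso_tail = fst\<rparr>"
  have inj: "inj_on f (pverts G)" and V: "pverts H = f ` pverts G"
    using f unfolding pair_graph_iso_def bij_betw_def by auto
  have "inj_on (map_prod f f) (parcs G)"
  proof (rule inj_on_subset)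
    show "inj_on (map_prod f f) (pverts G \<times> pverts G)" using inj inj by (rule map_prod_inj_on)
    show "parcs G \<subseteq> pverts G \<times> pverts G" using G.in_arcsD1 G.in_arcsD2 by auto
  qed
  then have "G.digraph_isomorphism ?h"
    unfolding G.digraph_isomorphism_def using inj by (auto intro: G.wf_digraph_axioms)
  moreover have "parcs H = map_prod f f ` parcs G"
  proof
    show "parcs H \<subseteq> map_prod f f ` parcs G"
    proof
      fix a assume a: "a \<in> parcs H"
      then have "fst a \<in> f ` pverts G" "snd a \<in> f ` pverts G"
        using H.arc_fst_in_verts H.arc_snd_in_verts V by auto
      then obtain u v where uv: "a = (f u, f v)" "u \<in> pverts G" "v \<in> pverts G"
        by (metis imageE prod.collapse)
      then have "(u, v) \<in> parcs G" using f a unfolding pair_graph_iso_def by auto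
      then show "a \<in> map_prod f f ` parcs G" using uv by force
    qed
    show "map_prod f f ` parcs G \<subseteq> parcs H"
      using f unfolding pair_graph_iso_def by (auto dest: G.in_arcsD1 G.in_arcsD2)
  qed
  then have "with_proj H = app_iso ?h (with_proj G)"
    by (simp add: app_iso_def with_proj_def V)
  ultimately show "G \<simeq>\<^sub>g H" unfolding digraph_iso_def by blast
qed

lemma grover_step_iso:
  assumes "pair_graph G" "pair_graph H" "pair_graph_iso f G H" "e \<in> parcs G"
  shows "grover_step G (\<psi> \<circ> map_prod f f) e = grover_step H \<psi> (map_prod f f e)"
proof -
  interpret G: pair_graph G by fact
  interpret H: pair_graph H by fact
  obtain u v where e: "e = (u, v)" "u \<in> pverts G" using assms(4) by (cases e) (auto dest: G.in_arcsD1)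
  have inj: "inj_on f (pverts G)" and V: "pverts H = f ` pverts G"
    using assms(3) unfolding pair_graph_iso_def bij_betw_def by auto
  have sub: "nbrs G u \<subseteq> pverts G" by (auto simp: nbrs_def dest: G.in_arcsD1)
  have N: "nbrs H (f u) = f ` nbrs G u"
  proof
    show "nbrs H (f u) \<subseteq> f ` nbrs G u"
    proof
      fix x assume x: "x \<in> nbrs H (f u)"
      then obtain w where "x = f w" "w \<in> pverts G" using V by (auto simp: nbrs_def dest: H.in_arcsD1)
      then show "x \<in> f ` nbrs G u" using x assms(3) e(2) unfolding pair_graph_iso_def nbrs_def by auto
    qed
    show "f ` nbrs G u \<subseteq> nbrs H (f u)"
      using sub assms(3) e(2) unfolding pair_graph_iso_def nbrs_def by auto
  qed
  have inj': "inj_on f (nbrs G u)" using inj sub by (rule inj_on_subset)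
  show ?thesis
    unfolding grover_step_def e using inj' by (simp add: N card_image sum.reindex)
qed

lemma grover_step_pow_iso:
  assumes "pair_graph G" "pair_graph H" "pair_graph_iso f G H" "e \<in> parcs G"
  shows "(grover_step G ^^ k) (\<psi> \<circ> map_prod f f) e = (grover_step H ^^ k) \<psi> (map_prod f f e)"
  using assms(4)
proof (induction k arbitrary: e)
  case (Suc k)
  interpret G: pair_graph G by fact
  have "(grover_step G ^^ Suc k) (\<psi> \<circ> map_prod f f) e
      = grover_step G ((grover_step H ^^ k) \<psi> \<circ> map_prod f f) e"
    unfolding funpow.simps comp_apply[of "grover_step G"]
    using Suc.prems by (intro G.grover_step_cong) (simp_all add: Suc.IH)
  also have "\<dots> = grover_step H ((grover_step H ^^ k) \<psi>) (map_prod f f e)"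
    by (rule grover_step_iso[OF assms(1-3) Suc.prems])
  finally show ?case
    by (simp only: funpow.simps comp_apply[of "grover_step G"] comp_apply[of "grover_step H"])
qed simp

lemma grover_power_is_id_iso_mono:
  assumes "pair_graph G" "pair_graph H" "pair_graph_iso f G H" "grover_power_is_id H k"
  shows "grover_power_is_id G k"
  unfolding grover_power_is_id_iff[OF assms(1)]
proof (intro allI ballI)
  interpret G: pair_graph G by fact
  fix \<psi> :: "'a \<times> 'a \<Rightarrow> real" and e assume e: "e \<in> parcs G"
  let ?g = "the_inv_into (pverts G) f"
  have inj: "inj_on f (pverts G)" using assms(3) unfolding pair_graph_iso_def bij_betw_def by auto
  \<comment> \<open>Every function on the arcs of \<open>G\<close> is the pullback of one on the
    arcs of \<open>H\<close>.\<close>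
  let ?\<phi> = "\<psi> \<circ> map_prod ?g ?g"
  have *: "(?\<phi> \<circ> map_prod f f) x = \<psi> x" if "x \<in> parcs G" for x
    using that inj G.in_arcsD1 G.in_arcsD2 by (cases x) (simp add: the_inv_into_f_f)
  have "map_prod f f e \<in> parcs H"
    using assms(3) e unfolding pair_graph_iso_def by (cases e) (auto dest: G.in_arcsD1 G.in_arcsD2)
  then have "(grover_step G ^^ k) (?\<phi> \<circ> map_prod f f) e = (?\<phi> \<circ> map_prod f f) e"
    using grover_step_pow_iso[OF assms(1-3) e, of k] assms(4)
    unfolding grover_power_is_id_iff[OF assms(2)] by (simp only: comp_apply)
  moreover have "(grover_step G ^^ k) (?\<phi> \<circ> map_prod f f) e = (grover_step G ^^ k) \<psi> e"
    using * e by (rule G.grover_step_pow_cong)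
  ultimately show "(grover_step G ^^ k) \<psi> e = \<psi> e"
    unfolding *[OF e] by metis
qed

lemma grover_power_is_id_iso:
  assumes "pair_graph G" "pair_graph H" "G \<simeq>\<^sub>g H"
  shows "grover_power_is_id G k \<longleftrightarrow> grover_power_is_id H k"
proof -
  obtain f where "pair_graph_iso f G H"
    using assms(3) unfolding digraph_iso_iff_pair_graph_iso[OF assms(1,2)] by blast
  from grover_power_is_id_iso_mono[OF assms(1,2) this]
    grover_power_is_id_iso_mono[OF assms(2,1) pair_graph_iso_inv[OF this]]
  show ?thesis by blast
qed

lemma grover_walk_iso:
  assumes "pair_graph G" "pair_graph H" "G \<simeq>\<^sub>g H"
  shows "periodic_grover_walk G \<longleftrightarrow> periodic_grover_walk H" "grover_period G = grover_period H"
  unfolding periodic_grover_walk_def grover_period_def grover_power_is_id_iso[OF assms]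
  by (rule refl)+

section \<open>Walks on subdivisions\<close>

text \<open>Position is measured along the arc \<open>e\<close>, not along the edge, so that each
  arc of the subdivision occurs for exactly one pair \<open>(e, i)\<close> with
  \<open>i < k\<close>; its reverse is found on \<open>prod.swap e\<close>.\<close>

definition subdiv_arc :: "nat \<Rightarrow> 'a \<times> 'a \<Rightarrow> nat \<Rightarrow> 'a multiset \<times> 'a multiset" where
  "subdiv_arc k e i = (subdiv_vertex k e i, subdiv_vertex k e (Suc i))"

lemma subdiv_vertex_swap:
  "i \<le> k \<Longrightarrow> subdiv_vertex k (prod.swap e) i = subdiv_vertex k e (k - i)"
  by (simp add: subdiv_vertex_def)

lemma subdiv_vertex_0: "subdiv_vertex k e 0 = replicate_mset k (fst e)"
  and subdiv_vertex_end: "subdiv_vertex k e k = replicate_mset k (snd e)"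
  by (simp_all add: subdiv_vertex_def)

lemma count_subdiv_vertex:
  "count (subdiv_vertex k e i) x = (if x = fst e then k - i else 0) + (if x = snd e then i else 0)"
  by (simp add: subdiv_vertex_def)

lemma subdiv_vertex_inject:
  assumes "fst e \<noteq> snd e" "subdiv_vertex k e i = subdiv_vertex k e j"
  shows "i = j"
  using arg_cong[OF assms(2), of "\<lambda>M. count M (snd e)"] assms(1) by (simp add: count_subdiv_vertex)

text \<open>In an inner vertex both ends of the edge have positive multiplicity. The support
  therefore determines the edge, and the multiplicities determine the position up to
  reversal.\<close>

lemma subdiv_vertex_eq_interior:
  assumes "fst e \<noteq> snd e" "fst f \<noteq> snd f" "0 < i" "i < k" "j \<le> k"
    and eq: "subdiv_vertex k f j = subdiv_vertex k e i"
  shows "f = e \<and> j = i \<or> f = prod.swap e \<and> j = k - i"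
proof -
  have c: "count (subdiv_vertex k f j) x = count (subdiv_vertex k e i) x" for x by (simp add: eq)
  show ?thesis
    using c[of "fst e"] c[of "snd e"] assms(1-5)
    unfolding count_subdiv_vertex prod_eq_iff by (auto split: if_splits)
qed

lemma subdiv_vertex_eq_replicate:
  assumes "fst f \<noteq> snd f" "1 \<le> k" "j \<le> k" and eq: "subdiv_vertex k f j = replicate_mset k u"
  shows "j = 0 \<and> fst f = u \<or> j = k \<and> snd f = u"
proof -
  have c: "count (subdiv_vertex k f j) x = count (replicate_mset k u) x" for x by (simp add: eq)
  show ?thesis
    using c[of u] assms(1-3) unfolding count_subdiv_vertex by (auto split: if_splits)
qed

lemma subdiv_arc_inject:
  assumes "fst e \<noteq> snd e" "fst f \<noteq> snd f" "i < k" "j < k" and eq: "subdiv_arc k f j = subdiv_arc k e i"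
  shows "f = e \<and> j = i"
proof -
  have c: "count (subdiv_vertex k f j) x = count (subdiv_vertex k e i) x"
      "count (subdiv_vertex k f (Suc j)) x = count (subdiv_vertex k e (Suc i)) x" for x
    using eq by (simp_all add: subdiv_arc_def)
  have s: "snd f = snd e"
    using c[of "snd e"] assms(1-4) unfolding count_subdiv_vertex by (auto split: if_splits)
  have "fst f = fst e"
    using c[of "fst e"] s assms(1-4) unfolding count_subdiv_vertex by (auto split: if_splits)
  with s have "f = e" by (simp add: prod_eq_iff)
  with assms(1) eq show ?thesis using subdiv_vertex_inject[of e k j i] by (auto simp: subdiv_arc_def)
qed

lemma arcs_subdivision_graph:
  assumes "pair_graph H"
  shows "parcs (subdivision_graph k H) = {subdiv_arc k e i | e i. e \<in> parcs H \<and> i < k}"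
proof -
  interpret H: pair_graph H by fact
  have "(subdiv_vertex k e i, subdiv_vertex k e j) \<in> {subdiv_arc k e i | e i. e \<in> parcs H \<and> i < k}"
    if "e \<in> parcs H" "i \<le> k" "j \<le> k" "j = i + 1 \<or> i = j + 1" for e i j
    using that(4)
  proof
    assume "j = i + 1"
    then have "(subdiv_vertex k e i, subdiv_vertex k e j) = subdiv_arc k e i" "i < k"
      using that(3) by (simp_all add: subdiv_arc_def)
    then show ?thesis using that(1) by blast
  next
    assume i: "i = j + 1"
    \<comment> \<open>A step down along \<open>e\<close> is a step up along the reverse arc, from
      the mirrored position \<open>k - i\<close>.\<close>
    then have kj: "k - j = Suc (k - i)" using that(2) by simp
    have "(subdiv_vertex k e i, subdiv_vertex k e j) = subdiv_arc k (prod.swap e) (k - i)"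
      using that(2,3) subdiv_vertex_swap[of "k - i" k e] subdiv_vertex_swap[of "k - j" k e]
      unfolding subdiv_arc_def kj[symmetric] by simp
    moreover have "prod.swap e \<in> parcs H" "k - i < k" using that i H.swap_arc by auto
    ultimately show ?thesis by blast
  qed
  then have "parcs (subdivision_graph k H) \<subseteq> {subdiv_arc k e i | e i. e \<in> parcs H \<and> i < k}"
    unfolding subdivision_graph_def pair_pre_digraph.simps by blast
  moreover have "{subdiv_arc k e i | e i. e \<in> parcs H \<and> i < k} \<subseteq> parcs (subdivision_graph k H)"
  proof
    fix x assume "x \<in> {subdiv_arc k e i | e i. e \<in> parcs H \<and> i < k}"
    then obtain e i where "x = subdiv_arc k e i" "e \<in> parcs H" "i < k" by blast
    then show "x \<in> parcs (subdivision_graph k H)"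
      unfolding subdivision_graph_def pair_pre_digraph.simps subdiv_arc_def
      by (intro CollectI exI[of _ e] exI[of _ i] exI[of _ "Suc i"]) simp
  qed
  ultimately show ?thesis by (rule equalityI)
qed

lemma nbrs_subdivision_iff:
  assumes "pair_graph H"
  shows "a \<in> nbrs (subdivision_graph k H) b \<longleftrightarrow>
    (\<exists>e\<in>parcs H. \<exists>i<k. a = subdiv_vertex k e i \<and> b = subdiv_vertex k e (Suc i))"
  unfolding nbrs_def arcs_subdivision_graph[OF assms] subdiv_arc_def mem_Collect_eq prod.inject by blast

lemma subdiv_arc_nbrs:
  assumes "pair_graph H" "e \<in> parcs H" "i < k" "(a, b) = subdiv_arc k e i"
  shows "a \<in> nbrs (subdivision_graph k H) b"
  using assms(2-4) unfolding nbrs_subdivision_iff[OF assms(1)] subdiv_arc_def prod.inject by blast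

lemma nbrs_subdivision_interior:
  assumes "pair_graph H" "e \<in> parcs H" "0 < i" "i < k"
  shows "nbrs (subdivision_graph k H) (subdiv_vertex k e i)
    = {subdiv_vertex k e (i - 1), subdiv_vertex k e (i + 1)}"
proof
  interpret H: pair_graph H by fact
  show "nbrs (subdivision_graph k H) (subdiv_vertex k e i)
      \<subseteq> {subdiv_vertex k e (i - 1), subdiv_vertex k e (i + 1)}"
  proof
    fix w assume "w \<in> nbrs (subdivision_graph k H) (subdiv_vertex k e i)"
    then obtain f j where f: "f \<in> parcs H" "j < k" "w = subdiv_vertex k f j"
      "subdiv_vertex k f (Suc j) = subdiv_vertex k e i"
      unfolding nbrs_subdivision_iff[OF assms(1)] by metis
    have "f = e \<and> Suc j = i \<or> f = prod.swap e \<and> Suc j = k - i"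
      using f assms by (intro subdiv_vertex_eq_interior) (auto dest: H.pair_no_loops)
    then show "w \<in> {subdiv_vertex k e (i - 1), subdiv_vertex k e (i + 1)}"
    proof (elim disjE conjE)
      assume "f = prod.swap e" "Suc j = k - i"
      moreover from this assms(4) have "k - j = i + 1" by simp
      ultimately show ?thesis using f(2,3) by (simp add: subdiv_vertex_swap)
    qed (use f in auto)
  qed
  have "(subdiv_vertex k e (i - 1), subdiv_vertex k e i) = subdiv_arc k e (i - 1)"
    using assms(3) by (simp add: subdiv_arc_def)
  moreover have "(subdiv_vertex k e (i + 1), subdiv_vertex k e i) = subdiv_arc k (prod.swap e) (k - i - 1)"
    using assms(3,4) by (simp add: subdiv_arc_def subdiv_vertex_swap Suc_diff_Suc)
  moreover have "i - 1 < k" "k - i - 1 < k" using assms(3,4) by auto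
  ultimately show "{subdiv_vertex k e (i - 1), subdiv_vertex k e (i + 1)}
      \<subseteq> nbrs (subdivision_graph k H) (subdiv_vertex k e i)"
    using subdiv_arc_nbrs[OF assms(1,2)] subdiv_arc_nbrs[OF assms(1) H.swap_arc[OF assms(2)]]
    by (intro insert_subsetI empty_subsetI) metis+
qed

lemma nbrs_subdivision_original:
  assumes "pair_graph H" "1 \<le> k"
  shows "nbrs (subdivision_graph k H) (replicate_mset k u)
    = (\<lambda>w. subdiv_vertex k (w, u) (k - 1)) ` nbrs H u"
proof
  interpret H: pair_graph H by fact
  show "nbrs (subdivision_graph k H) (replicate_mset k u)
      \<subseteq> (\<lambda>w. subdiv_vertex k (w, u) (k - 1)) ` nbrs H u"
  proof
    fix w assume "w \<in> nbrs (subdivision_graph k H) (replicate_mset k u)"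
    then obtain f j where f: "f \<in> parcs H" "j < k" "w = subdiv_vertex k f j"
      "subdiv_vertex k f (Suc j) = replicate_mset k u"
      unfolding nbrs_subdivision_iff[OF assms(1)] by metis
    then have "Suc j = 0 \<and> fst f = u \<or> Suc j = k \<and> snd f = u"
      using assms by (intro subdiv_vertex_eq_replicate) (auto dest: H.pair_no_loops)
    then show "w \<in> (\<lambda>w. subdiv_vertex k (w, u) (k - 1)) ` nbrs H u"
      using f by (intro image_eqI[of _ _ "fst f"]) (auto simp: nbrs_def)
  qed
  show "(\<lambda>w. subdiv_vertex k (w, u) (k - 1)) ` nbrs H u \<subseteq> nbrs (subdivision_graph k H) (replicate_mset k u)"
  proof
    fix x assume "x \<in> (\<lambda>w. subdiv_vertex k (w, u) (k - 1)) ` nbrs H u"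
    then obtain w where w: "(w, u) \<in> parcs H" "x = subdiv_vertex k (w, u) (k - 1)" by (auto simp: nbrs_def)
    then have "(x, replicate_mset k u) = subdiv_arc k (w, u) (k - 1)"
      using assms(2) by (simp add: subdiv_arc_def subdiv_vertex_end)
    moreover have "k - 1 < k" using assms(2) by simp
    ultimately show "x \<in> nbrs (subdivision_graph k H) (replicate_mset k u)"
      using subdiv_arc_nbrs[OF assms(1) w(1)] by metis
  qed
qed

lemma inj_subdiv_vertex_end:
  assumes "pair_graph H" "1 \<le> k"
  shows "inj_on (\<lambda>w. subdiv_vertex k (w, u) (k - 1)) (nbrs H u)"
proof (rule inj_onI)
  interpret H: pair_graph H by fact
  fix v w assume v: "v \<in> nbrs H u" and w: "w \<in> nbrs H u"
    and eq: "subdiv_vertex k (v, u) (k - 1) = subdiv_vertex k (w, u) (k - 1)"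
  have "count (subdiv_vertex k (v, u) (k - 1)) v = count (subdiv_vertex k (w, u) (k - 1)) v" by (simp only: eq)
  moreover have "v \<noteq> u" using v H.pair_no_loops unfolding nbrs_def by fastforce
  ultimately show "v = w" using assms(2) by (simp add: count_subdiv_vertex split: if_splits)
qed

text \<open>An inner vertex has degree 2, where the Grover coin is \<open>(x + y) - y = x\<close>:
  the amplitude passes on without reflection. Only the original vertices scatter, exactly as in
  \<open>H\<close>.\<close>

lemma grover_step_subdivision:
  assumes "pair_graph H" "e \<in> parcs H" "i < k"
  shows "grover_step (subdivision_graph k H) \<psi> (subdiv_arc k e i) =
    (if i = 0 then grover_step H (\<lambda>f. \<psi> (subdiv_arc k f (k - 1))) e else \<psi> (subdiv_arc k e (i - 1)))"
proof (cases "i = 0")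
  interpret H: pair_graph H by fact
  case True
  obtain u v where e: "e = (u, v)" by (cases e)
  have "prod.swap e \<in> parcs H" using assms(2) by (rule H.swap_arc)
  have sw: "(subdiv_vertex k e 1, subdiv_vertex k e 0) = subdiv_arc k (prod.swap e) (k - 1)"
    using assms(3) by (simp add: subdiv_arc_def subdiv_vertex_swap)
  show ?thesis
    using True assms(1,3) sw inj_subdiv_vertex_end[OF assms(1), of k u] unfolding grover_step_def
    by (simp add: subdiv_arc_def e subdiv_vertex_0 nbrs_subdivision_original card_image sum.reindex
      subdiv_vertex_end)
next
  case False
  interpret H: pair_graph H by fact
  have ne: "subdiv_vertex k e (i - 1) \<noteq> subdiv_vertex k e (i + 1)"
    using subdiv_vertex_inject[of e k "i - 1" "i + 1"] H.pair_no_loops[OF assms(2)] by auto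
  show ?thesis
    using False assms ne unfolding grover_step_def
    by (simp add: subdiv_arc_def nbrs_subdivision_interior)
qed

lemma grover_step_pow_subdivision_shift:
  assumes "pair_graph H" "e \<in> parcs H" "i < k" "t \<le> i"
  shows "(grover_step (subdivision_graph k H) ^^ t) \<psi> (subdiv_arc k e i) = \<psi> (subdiv_arc k e (i - t))"
  using assms(3,4)
proof (induction t arbitrary: i)
  case (Suc t)
  then show ?case using grover_step_subdivision[OF assms(1,2), of i k] by simp
qed simp

lemma grover_step_pow_subdivision:
  assumes "pair_graph H" "e \<in> parcs H" "i < k"
  shows "(grover_step (subdivision_graph k H) ^^ k) \<psi> (subdiv_arc k e i)
    = grover_step H (\<lambda>f. \<psi> (subdiv_arc k f i)) e"
proof -
  interpret H: pair_graph H by fact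
  let ?U = "grover_step (subdivision_graph k H)"
  \<comment> \<open>Looking back in time from position \<open>i\<close>: \<open>i\<close> shifts
    reach position 0, one step of \<open>H\<close> leads to position \<open>k - 1\<close> of the
    incoming arcs, and \<open>k - 1 - i\<close> shifts lead back to position
    \<open>i\<close>.\<close>
  have "k = i + Suc (k - 1 - i)" using assms(3) by simp
  then have "(?U ^^ k) \<psi> = (?U ^^ i) (?U ((?U ^^ (k - 1 - i)) \<psi>))"
    by (metis comp_apply funpow.simps(2) funpow_add)
  then have "(?U ^^ k) \<psi> (subdiv_arc k e i) = ?U ((?U ^^ (k - 1 - i)) \<psi>) (subdiv_arc k e 0)"
    using grover_step_pow_subdivision_shift[OF assms, of i] by simp
  also have "\<dots> = grover_step H (\<lambda>f. (?U ^^ (k - 1 - i)) \<psi> (subdiv_arc k f (k - 1))) e"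
    using grover_step_subdivision[OF assms(1,2), of 0 k] assms(3) by simp
  also have "\<dots> = grover_step H (\<lambda>f. \<psi> (subdiv_arc k f i)) e"
    using assms(2,3) by (intro H.grover_step_cong) (simp_all add: grover_step_pow_subdivision_shift[OF assms(1)])
  finally show ?thesis .
qed

lemma grover_step_pow_mult_subdivision:
  assumes "pair_graph H" "e \<in> parcs H" "i < k"
  shows "(grover_step (subdivision_graph k H) ^^ (q * k)) \<psi> (subdiv_arc k e i)
    = (grover_step H ^^ q) (\<lambda>f. \<psi> (subdiv_arc k f i)) e"
  using assms(2)
proof (induction q arbitrary: e)
  case (Suc q)
  interpret H: pair_graph H by fact
  let ?U = "grover_step (subdivision_graph k H)"
  have "(?U ^^ (Suc q * k)) \<psi> (subdiv_arc k e i) = (?U ^^ k) ((?U ^^ (q * k)) \<psi>) (subdiv_arc k e i)"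
    by (simp add: funpow_add)
  also have "\<dots> = grover_step H (\<lambda>f. (?U ^^ (q * k)) \<psi> (subdiv_arc k f i)) e"
    by (rule grover_step_pow_subdivision[OF assms(1) Suc.prems assms(3)])
  also have "\<dots> = grover_step H ((grover_step H ^^ q) (\<lambda>f. \<psi> (subdiv_arc k f i))) e"
    using Suc by (intro H.grover_step_cong) auto
  finally show ?case by simp
qed simp

theorem grover_power_is_id_subdivision:
  assumes "pair_graph H" "parcs H \<noteq> {}" "1 \<le> k"
  shows "grover_power_is_id (subdivision_graph k H) m \<longleftrightarrow> k dvd m \<and> grover_power_is_id H (m div k)"
proof -
  interpret H: pair_graph H by fact
  let ?S = "subdivision_graph k H"
  have S: "pair_graph ?S" using assms(1) by (rule pair_graph_subdivision_graph)
  obtain e0 where e0: "e0 \<in> parcs H" using assms(2) by blast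
  have arc: "subdiv_arc k e i \<in> parcs ?S" if "e \<in> parcs H" "i < k" for e i
    using that unfolding arcs_subdivision_graph[OF assms(1)] by blast
  have inj: "f = e \<and> j = i"
    if "e \<in> parcs H" "f \<in> parcs H" "i < k" "j < k" "subdiv_arc k f j = subdiv_arc k e i" for e f i j
    using that H.pair_no_loops by (intro subdiv_arc_inject) auto
  show ?thesis
  proof
    assume id: "grover_power_is_id ?S m"
    have "m mod k = 0"
    proof (rule ccontr)
      assume "m mod k \<noteq> 0"
      define t where "t = m mod k"
      have t: "0 < t" "t \<le> k - 1" "k - 1 < k"
        using \<open>m mod k \<noteq> 0\<close> assms(3) mod_less_divisor[of k m] unfolding t_def by linarith+
      \<comment> \<open>The indicator of the last position. With a remainder \<open>t > 0\<close>,
        the value after \<open>m\<close> steps is computed from position \<open>k - 1 - t\<close>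
        alone, where this function vanishes.\<close>
      define \<psi> :: "_ \<Rightarrow> real" where "\<psi> a = (if \<exists>f\<in>parcs H. a = subdiv_arc k f (k - 1) then 1 else 0)" for a
      have "m = t + m div k * k" unfolding t_def by simp
      then have "(grover_step ?S ^^ m) \<psi> (subdiv_arc k e0 (k - 1))
          = (grover_step ?S ^^ (m div k * k)) \<psi> (subdiv_arc k e0 (k - 1 - t))"
        using grover_step_pow_subdivision_shift[OF assms(1) e0 t(3,2)] funpow_add[of t "m div k * k" "grover_step ?S"]
        by simp
      also have "\<dots> = (grover_step H ^^ (m div k)) (\<lambda>f. \<psi> (subdiv_arc k f (k - 1 - t))) e0"
        using t by (intro grover_step_pow_mult_subdivision[OF assms(1) e0]) simp
      also have "\<dots> = (grover_step H ^^ (m div k)) (\<lambda>_. 0) e0"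
      proof (rule H.grover_step_pow_cong[OF _ e0])
        fix f assume f: "f \<in> parcs H"
        have "\<not> (\<exists>g\<in>parcs H. subdiv_arc k f (k - 1 - t) = subdiv_arc k g (k - 1))"
          using inj[OF _ f, of _ "k - 1" "k - 1 - t"] t by fastforce
        then show "\<psi> (subdiv_arc k f (k - 1 - t)) = 0" by (simp add: \<psi>_def)
      qed
      also have "\<dots> = 0"
      proof -
        have "(grover_step H ^^ n) (\<lambda>_. 0) = (\<lambda>_. 0)" for n
          by (induction n) (simp_all add: grover_step_def fun_eq_iff)
        then show ?thesis by simp
      qed
      also have "(grover_step ?S ^^ m) \<psi> (subdiv_arc k e0 (k - 1)) = \<psi> (subdiv_arc k e0 (k - 1))"
        using id arc[OF e0 t(3)] unfolding grover_power_is_id_iff[OF S] by blast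
      also have "\<dots> = 1" using e0 by (auto simp: \<psi>_def)
      finally show False by simp
    qed
    then have dvd: "k dvd m" by (rule mod_0_imp_dvd)
    moreover have "grover_power_is_id H (m div k)"
      unfolding grover_power_is_id_iff[OF assms(1)]
    proof (intro allI ballI)
      fix \<phi> :: "_ \<Rightarrow> real" and e assume e: "e \<in> parcs H"
      \<comment> \<open>\<open>\<phi>\<close> is transplanted to position 0. The other values are
        unspecified; a multiple of \<open>k\<close> steps, evaluated at position 0, reads only
        position 0.\<close>
      define \<psi> where "\<psi> a = \<phi> (SOME f. f \<in> parcs H \<and> a = subdiv_arc k f 0)" for a
      have \<psi>: "\<psi> (subdiv_arc k f 0) = \<phi> f" if "f \<in> parcs H" for f
      proof -
        have "(SOME g. g \<in> parcs H \<and> subdiv_arc k f 0 = subdiv_arc k g 0) = f"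
          using that inj[of _ f 0 0] assms(3) by (intro some_equality) fastforce+
        then show ?thesis by (simp add: \<psi>_def)
      qed
      have "(grover_step H ^^ (m div k)) \<phi> e = (grover_step H ^^ (m div k)) (\<lambda>f. \<psi> (subdiv_arc k f 0)) e"
        using \<psi> e by (intro H.grover_step_pow_cong) auto
      also have "\<dots> = (grover_step ?S ^^ (m div k * k)) \<psi> (subdiv_arc k e 0)"
        using assms(3) grover_step_pow_mult_subdivision[OF assms(1) e, of 0 k] by simp
      also have "\<dots> = \<psi> (subdiv_arc k e 0)"
        using id arc[OF e, of 0] assms(3) dvd unfolding grover_power_is_id_iff[OF S] by simp
      finally show "(grover_step H ^^ (m div k)) \<phi> e = \<phi> e" using \<psi> e by simp
    qed
    ultimately show "k dvd m \<and> grover_power_is_id H (m div k)" by blast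
  next
    assume *: "k dvd m \<and> grover_power_is_id H (m div k)"
    show "grover_power_is_id ?S m"
      unfolding grover_power_is_id_iff[OF S]
    proof (intro allI ballI)
      fix \<psi> a assume "a \<in> parcs ?S"
      then obtain e i where a: "a = subdiv_arc k e i" "e \<in> parcs H" "i < k"
        unfolding arcs_subdivision_graph[OF assms(1)] by blast
      have "(grover_step ?S ^^ (m div k * k)) \<psi> a = (grover_step H ^^ (m div k)) (\<lambda>f. \<psi> (subdiv_arc k f i)) e"
        unfolding a(1) using a by (intro grover_step_pow_mult_subdivision[OF assms(1)])
      also have "\<dots> = \<psi> a"
        using * a unfolding grover_power_is_id_iff[OF assms(1)] by simp
      finally show "(grover_step ?S ^^ m) \<psi> a = \<psi> a" using * by simp
    qed
  qed
qed

lemma grover_period_subdivision: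
  assumes "pair_graph H" "parcs H \<noteq> {}" "1 \<le> k" "periodic_grover_walk H"
  shows "periodic_grover_walk (subdivision_graph k H)"
    and "grover_period (subdivision_graph k H) = k * grover_period H"
proof -
  have "grover_power_is_id (subdivision_graph k H) m \<longleftrightarrow> k * grover_period H dvd m" for m
  proof -
    have "k dvd m \<and> grover_period H dvd m div k \<longleftrightarrow> k * grover_period H dvd m"
      using assms(3) by (metis dvd_div_iff_mult dvd_mult_left mult.commute not_one_le_zero)
    then show ?thesis
      unfolding grover_power_is_id_subdivision[OF assms(1-3)] grover_power_is_id_iff_dvd[OF assms(1,4)] .
  qed
  moreover have "k * grover_period H \<ge> 1"
    using assms(3) grover_period_pos[OF assms(1,4)] by simp
  ultimately show "periodic_grover_walk (subdivision_graph k H)"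
    "grover_period (subdivision_graph k H) = k * grover_period H"
    using grover_period_eqI[OF pair_graph_subdivision_graph[OF assms(1)]] by blast+
qed

section \<open>Trees given by their levels\<close>

text \<open>Connectedness and absence of cycles are replaced by the last clause: edges join
  consecutive levels. With unique parents and prescribed numbers of children this local description
  determines the graph. Vertices of level \<open>length ds\<close> have no children because no level
  is higher.\<close>

definition leveled_tree :: "nat list \<Rightarrow> ('a \<Rightarrow> nat) \<Rightarrow> 'a \<Rightarrow> 'a pair_pre_digraph \<Rightarrow> bool" where
  "leveled_tree ds lev rt G \<longleftrightarrow> pair_graph G \<and>
     {v \<in> pverts G. lev v = 0} = {rt} \<and>
     (\<forall>v\<in>pverts G. lev v \<le> length ds) \<and>
     (\<forall>v\<in>pverts G. lev v < length ds \<longrightarrow> card {w \<in> nbrs G v. lev w = Suc (lev v)} = ds ! lev v) \<and>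
     (\<forall>v\<in>pverts G. lev v \<noteq> 0 \<longrightarrow> card {w \<in> nbrs G v. Suc (lev w) = lev v} = 1) \<and>
     (\<forall>v\<in>pverts G. \<forall>w\<in>nbrs G v. lev w = Suc (lev v) \<or> lev v = Suc (lev w))"

definition children :: "('a \<Rightarrow> nat) \<Rightarrow> 'a pair_pre_digraph \<Rightarrow> 'a \<Rightarrow> 'a set" where
  "children lev G v = {w \<in> nbrs G v. lev w = Suc (lev v)}"

lemma (in pair_graph) nbrs_sym: "w \<in> nbrs G v \<longleftrightarrow> v \<in> nbrs G w"
  using arcs_symmetric unfolding nbrs_def by blast

lemma (in pair_graph) nbrs_in_verts: "w \<in> nbrs G v \<Longrightarrow> w \<in> pverts G" "w \<in> nbrs G v \<Longrightarrow> v \<in> pverts G"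
  using in_arcsD1 in_arcsD2 unfolding nbrs_def by blast+

lemma bethe_verts_snoc:
  "xs @ [j] \<in> bethe_verts ds \<longleftrightarrow> xs \<in> bethe_verts ds \<and> length xs < length ds \<and> j < ds ! length xs"
  by (auto simp: bethe_verts_def nth_append less_Suc_eq)

text \<open>Number the children of every vertex. An address is sent to the vertex reached from the
  root by following its entries; this is injective because parents are unique, and surjective
  because every vertex climbs to the root.\<close>

lemma leveled_tree_iso_bethe_graph:
  assumes "leveled_tree ds lev rt G"
  shows "bethe_graph ds \<simeq>\<^sub>g G"
proof -
  interpret G: pair_graph G using assms by (simp add: leveled_tree_def)
  let ?C = "children lev G"
  have root: "rt \<in> pverts G" "lev rt = 0" "\<And>v. v \<in> pverts G \<Longrightarrow> lev v = 0 \<Longrightarrow> v = rt"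
    and le: "\<And>v. v \<in> pverts G \<Longrightarrow> lev v \<le> length ds"
    and card: "\<And>v. v \<in> pverts G \<Longrightarrow> lev v < length ds \<Longrightarrow> card (?C v) = ds ! lev v"
    and parent: "\<And>v. v \<in> pverts G \<Longrightarrow> lev v \<noteq> 0 \<Longrightarrow> card {w \<in> nbrs G v. Suc (lev w) = lev v} = 1"
    and arc: "\<And>v w. v \<in> pverts G \<Longrightarrow> w \<in> nbrs G v \<Longrightarrow> lev w = Suc (lev v) \<or> lev v = Suc (lev w)"
    using assms unfolding leveled_tree_def children_def by (simp_all add: set_eq_iff, metis+)
  have C: "w \<in> pverts G \<and> v \<in> pverts G \<and> lev w = Suc (lev v) \<and> v \<in> nbrs G w" if "w \<in> ?C v" for v w
    using that G.nbrs_in_verts[of w v] G.nbrs_sym[of w v] unfolding children_def by simp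
  have uniq: "u = v" if wu: "w \<in> ?C u" and wv: "w \<in> ?C v" for u v w
  proof -
    have "u \<in> {x \<in> nbrs G w. Suc (lev x) = lev w}" "v \<in> {x \<in> nbrs G w. Suc (lev x) = lev w}"
      using C[OF wu] C[OF wv] by simp_all
    moreover obtain y where "{x \<in> nbrs G w. Suc (lev x) = lev w} = {y}"
      using parent[of w] C[OF wu] card_1_singletonE[of "{x \<in> nbrs G w. Suc (lev x) = lev w}"] by auto
    ultimately show ?thesis by simp
  qed
  have "\<exists>h. bij_betw h {..<ds ! lev v} (?C v)" if "v \<in> pverts G" "lev v < length ds" for v
  proof -
    have "finite (?C v)" using G.finite_nbrs[of v] by (simp add: children_def)
    from ex_bij_betw_nat_finite[OF this] show ?thesis
      unfolding card[OF that] atLeast0LessThan .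
  qed
  then obtain h where h: "\<And>v. v \<in> pverts G \<Longrightarrow> lev v < length ds \<Longrightarrow> bij_betw (h v) {..<ds ! lev v} (?C v)"
    by metis
  define g where "g = foldl h rt"
  have g: "g [] = rt" "g (xs @ [j]) = h (g xs) j" for xs j by (simp_all add: g_def)
  have g_vert: "g xs \<in> pverts G \<and> lev (g xs) = length xs" if "xs \<in> bethe_verts ds" for xs
    using that
  proof (induction xs rule: rev_induct)
    case (snoc j xs)
    then have "g (xs @ [j]) \<in> ?C (g xs)"
      using h[of "g xs"] bij_betwE[of "h (g xs)"] by (auto simp: bethe_verts_snoc g)
    with snoc C show ?case by (auto simp: bethe_verts_snoc)
  qed (simp add: root g)
  have g_child: "g (xs @ [j]) \<in> ?C (g xs)" if "xs @ [j] \<in> bethe_verts ds" for xs j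
    using that h[of "g xs"] g_vert[of xs] bij_betwE[of "h (g xs)"] by (auto simp: bethe_verts_snoc g)
  have g_child_ex: "\<exists>j. w = g (xs @ [j]) \<and> xs @ [j] \<in> bethe_verts ds"
    if xs: "xs \<in> bethe_verts ds" and w: "w \<in> ?C (g xs)" for xs w
  proof -
    have len: "length xs < length ds" using le[of w] C[OF w] g_vert[OF xs] by simp
    then have "bij_betw (h (g xs)) {..<ds ! length xs} (?C (g xs))"
      using h[of "g xs"] g_vert[OF xs] by simp
    then obtain j where "j < ds ! length xs" "w = h (g xs) j" using w unfolding bij_betw_def by auto
    then show ?thesis using xs len by (auto simp: bethe_verts_snoc g)
  qed
  have g_inj: "xs = ys" if "xs \<in> bethe_verts ds" "ys \<in> bethe_verts ds" "g xs = g ys" for xs ys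
    using that
  proof (induction xs arbitrary: ys rule: rev_induct)
    case Nil
    then show ?case using g_vert[of ys] g_vert[of "[]"] by simp
  next
    case (snoc i xs)
    have "length ys = Suc (length xs)" using g_vert[OF snoc.prems(1)] g_vert[OF snoc.prems(2)] snoc.prems(3) by simp
    then obtain zs j where ys: "ys = zs @ [j]" by (cases ys rule: rev_cases) auto
    have "g xs = g zs" using uniq g_child[OF snoc.prems(1)] g_child[of zs j] snoc.prems ys by metis
    with snoc ys have zs: "xs = zs" by (auto simp: bethe_verts_snoc)
    have "bij_betw (h (g xs)) {..<ds ! length xs} (?C (g xs))"
      using h[of "g xs"] g_vert[of xs] snoc.prems(1) by (simp add: bethe_verts_snoc)
    then have "i = j"
      using snoc.prems ys zs unfolding bij_betw_def inj_on_def by (auto simp: bethe_verts_snoc g)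
    with ys zs show ?case by simp
  qed
  have g_surj: "\<exists>xs\<in>bethe_verts ds. v = g xs" if "v \<in> pverts G" for v
    using that
  proof (induction "lev v" arbitrary: v)
    case 0
    then have "v = g []" using root g by simp
    then show ?case by (intro bexI[of _ "[]"]) (auto simp: bethe_verts_def)
  next
    case (Suc n)
    have "lev v \<noteq> 0" using Suc.hyps(2) by simp
    then obtain u where "{w \<in> nbrs G v. Suc (lev w) = lev v} = {u}"
      using card_1_singletonE[OF parent[OF Suc.prems]] by metis
    then have u: "u \<in> nbrs G v" "Suc (lev u) = lev v" by auto
    then obtain xs where xs: "xs \<in> bethe_verts ds" "u = g xs"
      using Suc.hyps(1)[of u] Suc.hyps(2) G.nbrs_in_verts(1)[OF u(1)] by auto
    have "v \<in> ?C (g xs)" using u xs(2) G.nbrs_sym[of u v] by (simp add: children_def)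
    then show ?case using g_child_ex[OF xs(1)] by blast
  qed
  have "bij_betw g (pverts (bethe_graph ds)) (pverts G)"
  proof (rule bij_betw_imageI)
    show "inj_on g (pverts (bethe_graph ds))"
      using g_inj by (intro inj_onI) (simp add: bethe_graph_def)
    show "g ` pverts (bethe_graph ds) = pverts G"
      using g_vert g_surj by (fastforce simp: bethe_graph_def)
  qed
  moreover have "(xs, ys) \<in> parcs (bethe_graph ds) \<longleftrightarrow> (g xs, g ys) \<in> parcs G"
    if xy: "xs \<in> bethe_verts ds" "ys \<in> bethe_verts ds" for xs ys
  proof
    assume "(xs, ys) \<in> parcs (bethe_graph ds)"
    then consider j where "ys = xs @ [j]" | j where "xs = ys @ [j]" by (auto simp: bethe_graph_def)
    then show "(g xs, g ys) \<in> parcs G"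
    proof cases
      case 1
      then have "g xs \<in> nbrs G (g ys)" using g_child[of xs j] C xy by blast
      then show ?thesis by (simp add: nbrs_def)
    next
      case 2
      then have "g xs \<in> nbrs G (g ys)" using g_child[of ys j] xy by (simp add: children_def)
      then show ?thesis by (simp add: nbrs_def)
    qed
  next
    assume a: "(g xs, g ys) \<in> parcs G"
    then have n: "g xs \<in> nbrs G (g ys)" "g ys \<in> nbrs G (g xs)"
      using G.nbrs_sym[of "g xs" "g ys"] by (auto simp: nbrs_def)
    then consider "g xs \<in> ?C (g ys)" | "g ys \<in> ?C (g xs)"
      using arc[of "g ys" "g xs"] g_vert[OF xy(2)] unfolding children_def by auto
    then show "(xs, ys) \<in> parcs (bethe_graph ds)"
    proof cases
      case 1
      then obtain j where "g xs = g (ys @ [j])" "ys @ [j] \<in> bethe_verts ds"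
        using g_child_ex[OF xy(2)] by blast
      then show ?thesis using g_inj[OF xy(1)] xy by (auto simp: bethe_graph_def)
    next
      case 2
      then obtain j where "g ys = g (xs @ [j])" "xs @ [j] \<in> bethe_verts ds"
        using g_child_ex[OF xy(1)] by blast
      then show ?thesis using g_inj[OF xy(2)] xy by (auto simp: bethe_graph_def)
    qed
  qed
  ultimately have "pair_graph_iso g (bethe_graph ds) G"
    unfolding pair_graph_iso_def by (simp add: bethe_graph_def)
  then show ?thesis
    unfolding digraph_iso_iff_pair_graph_iso[OF pair_graph_bethe_graph G.pair_graph] by blast
qed

lemma graph_iso_sym:
  assumes "pair_graph G" "pair_graph H" "G \<simeq>\<^sub>g H"
  shows "H \<simeq>\<^sub>g G"
proof -
  obtain f where "pair_graph_iso f G H"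
    using assms(3) unfolding digraph_iso_iff_pair_graph_iso[OF assms(1,2)] ..
  then have "pair_graph_iso (the_inv_into (pverts G) f) H G" by (rule pair_graph_iso_inv)
  then show ?thesis unfolding digraph_iso_iff_pair_graph_iso[OF assms(2,1)] by blast
qed

lemma graph_iso_trans:
  assumes "pair_graph G" "pair_graph H" "pair_graph K" "G \<simeq>\<^sub>g H" "H \<simeq>\<^sub>g K"
  shows "G \<simeq>\<^sub>g K"
proof -
  obtain f where "pair_graph_iso f G H"
    using assms(4) unfolding digraph_iso_iff_pair_graph_iso[OF assms(1,2)] ..
  moreover obtain g where "pair_graph_iso g H K"
    using assms(5) unfolding digraph_iso_iff_pair_graph_iso[OF assms(2,3)] ..
  ultimately have "pair_graph_iso (g \<circ> f) G K" by (rule pair_graph_iso_comp)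
  then show ?thesis unfolding digraph_iso_iff_pair_graph_iso[OF assms(1,3)] by blast
qed

lemma leveled_tree_unique:
  assumes "leveled_tree ds lev r G" "leveled_tree ds lev' r' H"
  shows "G \<simeq>\<^sub>g H"
proof -
  have G: "pair_graph G" and H: "pair_graph H" using assms by (simp_all add: leveled_tree_def)
  show ?thesis
    by (rule graph_iso_trans[OF G pair_graph_bethe_graph H])
      (rule graph_iso_sym[OF pair_graph_bethe_graph G] leveled_tree_iso_bethe_graph assms)+
qed

text \<open>A tree edge that does not join a vertex to its parent would close a cycle with the two
  paths of parent edges from its ends to the root.\<close>

lemma generalized_bethe_tree_leveled:
  assumes "generalized_bethe_tree ds G"
  shows "\<exists>lev r. leveled_tree ds lev r G"
proof -
  from assms obtain lev rt where tree: "undirected_tree G"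
    and root: "{v \<in> pverts G. lev v = 0} = {rt}"
    and le: "\<And>v. v \<in> pverts G \<Longrightarrow> lev v \<le> length ds"
    and card: "\<And>v. v \<in> pverts G \<Longrightarrow> lev v < length ds \<Longrightarrow>
      card {w. (v, w) \<in> parcs G \<and> lev w = lev v + 1} = ds ! lev v"
    and parent: "\<And>v. v \<in> pverts G \<Longrightarrow> lev v \<ge> 1 \<Longrightarrow>
      card {w. (v, w) \<in> parcs G \<and> lev w = lev v - 1} = 1"
    unfolding generalized_bethe_tree_def by (elim conjE exE) simp
  interpret G: pair_graph G using tree by (simp add: undirected_tree_def)
  have nbr: "(v, w) \<in> parcs G \<longleftrightarrow> w \<in> nbrs G v" for v w
    using G.arcs_symmetric unfolding nbrs_def by blast
  \<comment> \<open>\<open>T\<close> keeps the arcs between consecutive levels, and in it every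
    vertex is joined to the root. An arc of \<open>G\<close> outside \<open>T\<close> has its ends
    joined by a path in \<open>T\<close> of length at least 2, which it closes to a cycle of length
    at least 3.\<close>
  define T where "T = \<lparr>pverts = pverts G,
    parcs = {(u, v) \<in> parcs G. lev v = Suc (lev u) \<or> lev u = Suc (lev v)}\<rparr>"
  have T: "pverts T = pverts G" "parcs T = {(u, v) \<in> parcs G. lev v = Suc (lev u) \<or> lev u = Suc (lev v)}"
    by (simp_all add: T_def)
  interpret T: pair_wf_digraph T
    by unfold_locales (use G.in_arcsD1 G.in_arcsD2 in \<open>fastforce simp: T\<close>)+
  have symT: "(u, v) \<in> parcs T \<Longrightarrow> (v, u) \<in> parcs T" for u v
    using G.arcs_symmetric unfolding T by auto
  have to_root: "(\<exists>p. T.awalk v p rt) \<and> (\<exists>p. T.awalk rt p v)" if "v \<in> pverts G" for v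
    using that
  proof (induction "lev v" arbitrary: v)
    case 0
    then have "v = rt" using root by auto
    moreover have "T.awalk v [] v" using 0 by (simp add: T.awalk_Nil_iff T)
    ultimately show ?case by blast
  next
    case (Suc n)
    have "lev v \<ge> 1" using Suc.hyps(2) by simp
    then obtain u where "{w. (v, w) \<in> parcs G \<and> lev w = lev v - 1} = {u}"
      using card_1_singletonE[OF parent[OF Suc.prems]] by metis
    then have "u \<in> {w. (v, w) \<in> parcs G \<and> lev w = lev v - 1}" by simp
    then have u: "(v, u) \<in> parcs G" "lev u = n" using Suc.hyps(2)[symmetric] by simp_all
    then have vu: "(v, u) \<in> parcs T" using Suc.hyps(2)[symmetric] by (simp add: T)
    have "(\<exists>p. T.awalk u p rt) \<and> (\<exists>p. T.awalk rt p u)"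
      using u by (intro Suc.hyps(1) G.in_arcsD2[OF u(1)]) simp
    then obtain p q where p: "T.awalk u p rt" "T.awalk rt q u" by metis
    have "T.awalk v ((v, u) # p) rt" using vu p by (simp add: T.awalk_Cons_iff)
    moreover have "T.awalk u [(u, v)] v"
      using symT[OF vu] Suc.prems by (simp add: T.awalk_Cons_iff T.awalk_Nil_iff T)
    with p(2) have "T.awalk rt (q @ [(u, v)]) v" by (rule T.awalk_appendI)
    ultimately show ?case by blast
  qed
  have arc: "lev w = Suc (lev v) \<or> lev v = Suc (lev w)" if vw: "(v, w) \<in> parcs G" for v w
  proof (rule ccontr)
    assume neg: "\<not> ?thesis"
    have v: "v \<in> pverts G" and w: "w \<in> pverts G" using G.in_arcsD1[OF vw] G.in_arcsD2[OF vw] by simp_all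
    obtain p1 p2 where "T.awalk w p1 rt" "T.awalk rt p2 v" using to_root[OF v] to_root[OF w] by metis
    then have "T.awalk w (p1 @ p2) v" by (rule T.awalk_appendI)
    then obtain p where p: "T.apath w p v"
      using T.apath_awalk_to_apath by metis
    then have pT: "set p \<subseteq> parcs T" and pc: "pcas w p v" and dist: "distinct (pawalk_verts w p)"
      unfolding T.apath_def T.awalk_def by simp_all
    have "w \<noteq> v" using G.no_loops'[OF vw] by simp
    then have ne: "p \<noteq> []" using pc by (cases p) simp_all
    have "length p \<noteq> 1"
    proof
      assume "length p = 1"
      then obtain e where e: "p = [e]" by (cases p) auto
      then have "(w, v) \<in> parcs T" using pc pT by (cases e) auto
      then show False using neg by (auto simp: T)
    qed
    then have len: "length p \<ge> 2" using ne by (cases "length p") auto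
    have cas: "pcas v ((v, w) # p) v" using pc by simp
    have vs: "tl (pawalk_verts v ((v, w) # p)) = pawalk_verts w p" by simp
    have "G.cycle ((v, w) # p)"
      unfolding G.cycle_def G.awalk_def
    proof (intro exI[of _ v] conjI)
      show "set ((v, w) # p) \<subseteq> parcs G" using vw pT by (auto simp: T)
      show "distinct (tl (pawalk_verts v ((v, w) # p)))" unfolding vs by (rule dist)
    qed (use v cas in simp_all)
    moreover have "length ((v, w) # p) \<ge> 3" using len by simp
    ultimately show False using tree unfolding undirected_tree_def by blast
  qed
  have "leveled_tree ds lev rt G"
    unfolding leveled_tree_def
  proof (intro conjI ballI impI)
    show "pair_graph G" by (rule G.pair_graph)
    show "{v \<in> pverts G. lev v = 0} = {rt}" by (rule root)
    fix v assume v: "v \<in> pverts G"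
    show "lev v \<le> length ds" using le v .
    show "card {w \<in> nbrs G v. lev w = Suc (lev v)} = ds ! lev v" if "lev v < length ds"
      using card[OF v that] by (simp add: nbr)
    show "card {w \<in> nbrs G v. Suc (lev w) = lev v} = 1" if "lev v \<noteq> 0"
    proof -
      have "{w \<in> nbrs G v. Suc (lev w) = lev v} = {w. (v, w) \<in> parcs G \<and> lev w = lev v - 1}"
        using that by (auto simp: nbr)
      then show ?thesis using parent[OF v] that by simp
    qed
    fix w assume "w \<in> nbrs G v"
    then show "lev w = Suc (lev v) \<or> lev v = Suc (lev w)" using arc[of v w] by (simp add: nbr)
  qed
  then show ?thesis by blast
qed

section \<open>Neighbourhoods in the standard representative\<close>

lemma nbrs_bethe_graph:
  assumes "xs \<in> bethe_verts ds"
  shows "nbrs (bethe_graph ds) xs = (if xs = [] then {} else {butlast xs}) \<union>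
    (if length xs < length ds then (\<lambda>j. xs @ [j]) ` {..<ds ! length xs} else {})"
proof (cases xs rule: rev_cases)
  case Nil
  then show ?thesis
    using assms bethe_verts_snoc[of xs _ ds] unfolding nbrs_def bethe_graph_def by auto
next
  case (snoc ys y)
  then have "ys \<in> bethe_verts ds" using assms by (simp add: bethe_verts_snoc)
  then show ?thesis
    using assms snoc bethe_verts_snoc[of xs _ ds] unfolding nbrs_def bethe_graph_def by auto
qed

lemma sum_nbrs_bethe_graph:
  assumes "xs \<in> bethe_verts ds"
  shows "(\<Sum>w\<in>nbrs (bethe_graph ds) xs. f w) = (if xs = [] then 0 else f (butlast xs)) +
    (if length xs < length ds then \<Sum>j<ds ! length xs. f (xs @ [j]) else 0 :: 'b :: comm_monoid_add)"
proof -
  let ?A = "if xs = [] then {} else {butlast xs}"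
  let ?B = "if length xs < length ds then (\<lambda>j. xs @ [j]) ` {..<ds ! length xs} else {}"
  have "ys \<noteq> zs" if "ys \<in> ?A" "zs \<in> ?B" for ys zs
  proof -
    have "length ys = length xs - 1" "length zs = Suc (length xs)"
      using that by (auto split: if_splits)
    then show ?thesis by auto
  qed
  then have "?A \<inter> ?B = {}" by blast
  moreover have "sum f ?B = (if length xs < length ds then \<Sum>j<ds ! length xs. f (xs @ [j]) else 0)"
    by (simp add: sum.reindex inj_on_def)
  moreover have "sum f ?A = (if xs = [] then 0 else f (butlast xs))" by simp
  ultimately show ?thesis
    unfolding nbrs_bethe_graph[OF assms] by (subst sum.union_disjoint) simp_all
qed

lemma card_nbrs_bethe_graph:
  assumes "xs \<in> bethe_verts ds"
  shows "card (nbrs (bethe_graph ds) xs) = (if xs = [] then 0 else 1) +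
    (if length xs < length ds then ds ! length xs else 0)"
  unfolding card_eq_sum sum_nbrs_bethe_graph[OF assms] by simp

section \<open>Child counts and levels in a k-subdivision\<close>

definition stretch :: "nat \<Rightarrow> nat list \<Rightarrow> nat list" where
  "stretch k ds = concat (map (\<lambda>d. d # replicate (k - 1) 1) ds)"

lemma length_stretch: "1 \<le> k \<Longrightarrow> length (stretch k ds) = k * length ds"
  by (induction ds) (simp_all add: stretch_def)

lemma nth_stretch:
  assumes "l < length ds" "i < k"
  shows "stretch k ds ! (k * l + i) = (if i = 0 then ds ! l else 1)"
  using assms(1)
proof (induction ds arbitrary: l)
  case (Cons d ds)
  have S: "stretch k (d # ds) = (d # replicate (k - 1) 1) @ stretch k ds" by (simp add: stretch_def)
  have len: "length (d # replicate (k - 1) 1) = k" using assms(2) by simp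
  show ?case
  proof (cases l)
    case 0
    then show ?thesis using assms(2) by (cases i) (simp_all add: S nth_append less_diff_conv)
  next
    case (Suc m)
    have "stretch k (d # ds) ! (k + (k * m + i)) = stretch k ds ! (k * m + i)"
      unfolding S using len by (metis nth_append_length_plus)
    then show ?thesis using Suc Cons by (simp add: add.assoc)
  qed
qed simp

lemma sum_level_subdiv_vertex:
  fixes lev :: "'a \<Rightarrow> nat"
  shows "(\<Sum>x\<in>#subdiv_vertex k e i. lev x) = (k - i) * lev (fst e) + i * lev (snd e)"
  by (simp add: subdiv_vertex_def)

text \<open>Inner vertices are written along the arc that leads away from the root, so that the
  level increases with \<open>i\<close>.\<close>

lemma subdivision_verts_cases:
  assumes "leveled_tree ds lev r H" "1 \<le> k" "v \<in> pverts (subdivision_graph k H)"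
  obtains u where "u \<in> pverts H" "v = replicate_mset k u"
  | e i where "e \<in> parcs H" "lev (snd e) = Suc (lev (fst e))" "0 < i" "i < k" "v = subdiv_vertex k e i"
proof -
  interpret H: pair_graph H using assms(1) by (simp add: leveled_tree_def)
  consider (orig) u where "u \<in> pverts H" "v = replicate_mset k u"
    | (sub) e i where "e \<in> parcs H" "i \<le> k" "v = subdiv_vertex k e i"
    using assms(3) unfolding subdivision_graph_def pair_pre_digraph.simps by blast
  then show thesis
  proof cases
    case sub
    have V: "fst e \<in> pverts H" "snd e \<in> pverts H"
      using sub(1) H.arc_fst_in_verts H.arc_snd_in_verts by blast+
    consider "i = 0" | "i = k" | "0 < i" "i < k" using sub(2) by linarith
    then show thesis
    proof cases
      case 3
      have "fst e \<in> nbrs H (snd e)" using sub(1) by (simp add: nbrs_def)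
      then consider "lev (snd e) = Suc (lev (fst e))" | "lev (fst e) = Suc (lev (snd e))"
        using assms(1) V unfolding leveled_tree_def by blast
      then show thesis
      proof cases
        case 1
        then show thesis using that(2) sub 3 by blast
      next
        case 2
        show thesis
        proof (rule that(2))
          show "prod.swap e \<in> parcs H" using sub(1) by (rule H.swap_arc)
          show "v = subdiv_vertex k (prod.swap e) (k - i)" using 3 sub(3) by (simp add: subdiv_vertex_def)
        qed (use 2 3 in simp_all)
      qed
    next
      case 1
      show thesis by (rule that(1)[OF V(1)]) (simp add: sub(3) 1 subdiv_vertex_0)
    next
      case 2
      show thesis by (rule that(1)[OF V(2)]) (simp add: sub(3) 2 subdiv_vertex_end)
    qed
  qed (rule that(1))
qed

text \<open>The level extends linearly in the barycentric coordinates: \<open>k - i\<close> copies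
  of a vertex of level l and \<open>i\<close> copies of a child have total level
  \<open>(k - i) * l + i * (l + 1) = k * l + i\<close>. The inserted levels have one child each,
  which is what \<open>stretch\<close> records.\<close>

lemma leveled_tree_subdivision:
  assumes H: "leveled_tree ds lev r H" and k: "1 \<le> k"
  shows "leveled_tree (stretch k ds) (\<lambda>M. \<Sum>x\<in>#M. lev x) (replicate_mset k r) (subdivision_graph k H)"
proof -
  let ?S = "subdivision_graph k H" and ?L = "\<lambda>M. \<Sum>x\<in>#M. lev x"
  interpret H: pair_graph H using H by (simp add: leveled_tree_def)
  have root: "r \<in> pverts H" "lev r = 0" "\<And>v. v \<in> pverts H \<Longrightarrow> lev v = 0 \<Longrightarrow> v = r"
    and le: "\<And>v. v \<in> pverts H \<Longrightarrow> lev v \<le> length ds"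
    and card: "\<And>v. v \<in> pverts H \<Longrightarrow> lev v < length ds \<Longrightarrow> card {w \<in> nbrs H v. lev w = Suc (lev v)} = ds ! lev v"
    and parent: "\<And>v. v \<in> pverts H \<Longrightarrow> lev v \<noteq> 0 \<Longrightarrow> card {w \<in> nbrs H v. Suc (lev w) = lev v} = 1"
    and arc: "\<And>v w. v \<in> pverts H \<Longrightarrow> w \<in> nbrs H v \<Longrightarrow> lev w = Suc (lev v) \<or> lev v = Suc (lev w)"
    using H unfolding leveled_tree_def by (simp_all add: set_eq_iff, metis+)
  have L_orig: "?L (replicate_mset k u) = k * lev u" for u by simp
  have L_sub: "?L (subdiv_vertex k e i) = k * lev (fst e) + i"
    if "lev (snd e) = Suc (lev (fst e))" "i \<le> k" for e i
  proof -
    define m where "m = k - i"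
    then have "k = i + m" using that(2) by simp
    then show ?thesis using that(1) by (simp add: sum_level_subdiv_vertex algebra_simps)
  qed
  obtain m where m: "k = Suc m" using k by (cases k) auto
  have L_end: "?L (subdiv_vertex k (w, u) (k - 1)) = lev w + m * lev u" for w u
    by (simp add: m sum_level_subdiv_vertex)
  have nbrs_orig: "nbrs ?S (replicate_mset k u) = (\<lambda>w. subdiv_vertex k (w, u) (k - 1)) ` nbrs H u" for u
    by (rule nbrs_subdivision_original[OF H.pair_graph k])
  \<comment> \<open>The neighbour towards \<open>w\<close> consists of one copy of \<open>w\<close>
    and \<open>m = k - 1\<close> copies of \<open>u\<close>, so its level differs from that of
    \<open>u\<close> exactly as \<open>lev w\<close> differs from \<open>lev u\<close>.\<close>
  have card_orig: "card {w \<in> nbrs ?S (replicate_mset k u). P (?L w)} = card {w \<in> nbrs H u. P (lev w + m * lev u)}" for u P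
  proof -
    have "{w \<in> nbrs ?S (replicate_mset k u). P (?L w)}
        = (\<lambda>w. subdiv_vertex k (w, u) (k - 1)) ` {w \<in> nbrs H u. P (lev w + m * lev u)}"
      unfolding nbrs_orig using L_end by fastforce
    moreover have "inj_on (\<lambda>w. subdiv_vertex k (w, u) (k - 1)) {w \<in> nbrs H u. P (lev w + m * lev u)}"
      by (rule inj_on_subset[OF inj_subdiv_vertex_end[OF H.pair_graph k]]) blast
    ultimately show ?thesis by (simp add: card_image)
  qed
  have nbrs_sub: "nbrs ?S (subdiv_vertex k e i) = {subdiv_vertex k e (i - 1), subdiv_vertex k e (i + 1)}"
    and L_nbrs_sub: "Suc (?L (subdiv_vertex k e (i - 1))) = ?L (subdiv_vertex k e i)"
      "?L (subdiv_vertex k e (i + 1)) = Suc (?L (subdiv_vertex k e i))"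
    if "e \<in> parcs H" "lev (snd e) = Suc (lev (fst e))" "0 < i" "i < k" for e i
    using nbrs_subdivision_interior[OF H.pair_graph that(1,3,4)] that by (simp_all add: L_sub)
  have lev_lt: "lev (fst e) < length ds" if "e \<in> parcs H" "lev (snd e) = Suc (lev (fst e))" for e
    using le[OF H.arc_snd_in_verts[OF that(1)]] that(2) by simp
  show ?thesis
    unfolding leveled_tree_def length_stretch[OF k]
  proof (intro conjI ballI impI)
    show "pair_graph ?S" by (rule pair_graph_subdivision_graph[OF H.pair_graph])
    have "replicate_mset k r \<in> pverts ?S" using root(1) by (simp add: subdivision_graph_def)
    moreover have "v = replicate_mset k r" if "v \<in> pverts ?S" "?L v = 0" for v
      using H k that(1)
    proof (cases rule: subdivision_verts_cases)
      case (1 u)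
      then show ?thesis using that(2) root(3)[of u] k by (simp add: L_orig)
    next
      case (2 e i)
      then show ?thesis using that(2) L_sub[of e i] by simp
    qed
    moreover have "?L (replicate_mset k r) = 0" using root(2) L_orig[of r] by simp
    ultimately show "{v \<in> pverts ?S. ?L v = 0} = {replicate_mset k r}" by blast
  next
    fix v assume v: "v \<in> pverts ?S"
    show "?L v \<le> k * length ds"
      using H k v
    proof (cases rule: subdivision_verts_cases)
      case (1 u)
      then show ?thesis using le[of u] by (simp add: L_orig)
    next
      case (2 e i)
      then have "k * lev (fst e) + i \<le> k * Suc (lev (fst e))" by simp
      also have "\<dots> \<le> k * length ds" using lev_lt[of e] 2 by (intro mult_le_mono2) simp
      finally show ?thesis using 2 L_sub[of e i] by simp
    qed
    show "card {w \<in> nbrs ?S v. ?L w = Suc (?L v)} = stretch k ds ! ?L v" if "?L v < k * length ds"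
      using H k v
    proof (cases rule: subdivision_verts_cases)
      case (1 u)
      then have "lev u < length ds" using that by (simp add: L_orig)
      moreover have "lev w + m * lev u = Suc (k * lev u) \<longleftrightarrow> lev w = Suc (lev u)" for w
        by (simp add: m)
      ultimately show ?thesis
        using 1 card[of u] nth_stretch[of "lev u" ds 0 k] k card_orig[of u "\<lambda>l. l = Suc (k * lev u)"]
        by (simp add: L_orig)
    next
      case (2 e i)
      have "{w \<in> nbrs ?S v. ?L w = Suc (?L v)} = {subdiv_vertex k e (i + 1)}"
        using L_nbrs_sub[OF 2(1-4)] unfolding 2(5) nbrs_sub[OF 2(1-4)] by auto
      then show ?thesis
        using 2 L_sub[of e i] nth_stretch[of "lev (fst e)" ds i k] lev_lt[of e] by simp
    qed
    show "card {w \<in> nbrs ?S v. Suc (?L w) = ?L v} = 1" if "?L v \<noteq> 0"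
      using H k v
    proof (cases rule: subdivision_verts_cases)
      case (1 u)
      then have "lev u \<noteq> 0" using that by (simp add: L_orig)
      moreover have "Suc (lev w + m * lev u) = k * lev u \<longleftrightarrow> Suc (lev w) = lev u" for w
        by (auto simp: m)
      ultimately show ?thesis
        using 1 parent[of u] card_orig[of u "\<lambda>l. Suc l = k * lev u"] by (simp add: L_orig)
    next
      case (2 e i)
      have "{w \<in> nbrs ?S v. Suc (?L w) = ?L v} = {subdiv_vertex k e (i - 1)}"
        using L_nbrs_sub[OF 2(1-4)] unfolding 2(5) nbrs_sub[OF 2(1-4)] by auto
      then show ?thesis by simp
    qed
    fix w assume w: "w \<in> nbrs ?S v"
    show "?L w = Suc (?L v) \<or> ?L v = Suc (?L w)"
      using H k v
    proof (cases rule: subdivision_verts_cases)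
      case (1 u)
      then obtain x where x: "x \<in> nbrs H u" "w = subdiv_vertex k (x, u) (k - 1)"
        using w nbrs_orig by auto
      then show ?thesis using arc[OF 1(1) x(1)] 1(2) L_end[of x u] by (auto simp: L_orig m)
    next
      case (2 e i)
      then show ?thesis using w nbrs_sub[OF 2(1-4)] L_nbrs_sub[OF 2(1-4)] by auto
    qed
  qed
qed

lemma pair_graph_leveled_tree: "leveled_tree ds lev r G \<Longrightarrow> pair_graph G"
  by (simp add: leveled_tree_def)

lemma leveled_tree_bethe_graph: "leveled_tree ds length [] (bethe_graph ds)"
  unfolding leveled_tree_def
proof (intro conjI ballI impI)
  have V: "pverts (bethe_graph ds) = bethe_verts ds" by (simp add: bethe_graph_def)
  show "pair_graph (bethe_graph ds)" by (rule pair_graph_bethe_graph)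
  show "{v \<in> pverts (bethe_graph ds). length v = 0} = {[]}" by (auto simp: V bethe_verts_def)
  fix v assume v: "v \<in> pverts (bethe_graph ds)"
  then show "length v \<le> length ds" by (auto simp: V bethe_verts_def)
  note N = nbrs_bethe_graph[OF v[unfolded V]]
  show "card {w \<in> nbrs (bethe_graph ds) v. length w = Suc (length v)} = ds ! length v" if "length v < length ds"
  proof -
    have "{w \<in> nbrs (bethe_graph ds) v. length w = Suc (length v)} = (\<lambda>j. v @ [j]) ` {..<ds ! length v}"
      unfolding N using that by auto
    then show ?thesis by (simp add: card_image inj_on_def)
  qed
  show "card {w \<in> nbrs (bethe_graph ds) v. Suc (length w) = length v} = 1" if "length v \<noteq> 0"
  proof -
    have "{w \<in> nbrs (bethe_graph ds) v. Suc (length w) = length v} = {butlast v}"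
      unfolding N using that by auto
    then show ?thesis by simp
  qed
  show "length w = Suc (length v) \<or> length v = Suc (length w)" if "w \<in> nbrs (bethe_graph ds) v" for w
    using that unfolding N by (auto split: if_splits)
qed

section \<open>Paths and stars as leveled trees\<close>

lemma leveled_tree_path_graph: "leveled_tree (replicate n 1) id 0 (path_graph (n + 1))"
proof -
  let ?P = "path_graph (n + 1)"
  have V: "pverts ?P = {..n}" by (auto simp: path_graph_def)
  have N: "nbrs ?P v = {w. w \<le> n \<and> (v = Suc w \<or> w = Suc v)}" if "v \<le> n" for v
    using that by (auto simp: nbrs_def path_graph_def)
  have "finite (parcs ?P)"
    by (rule finite_subset[of _ "{..n} \<times> {..n}"]) (auto simp: path_graph_def)
  moreover have "symmetric ?P" "finite (pverts ?P)"
    by (auto simp: path_graph_def symmetric_def sym_def)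
  moreover have "fst e \<noteq> snd e" "fst e \<in> pverts ?P" "snd e \<in> pverts ?P" if "e \<in> parcs ?P" for e
    using that by (auto simp: path_graph_def)
  ultimately have "pair_graph ?P" by unfold_locales simp_all
  moreover have "card {w \<in> nbrs ?P v. w = Suc v} = 1" if "v < n" for v
  proof -
    have "{w \<in> nbrs ?P v. w = Suc v} = {Suc v}" unfolding N[OF less_imp_le[OF that]] using that by auto
    then show ?thesis by simp
  qed
  moreover have "card {w \<in> nbrs ?P v. Suc w = v} = 1" if "v \<le> n" "v \<noteq> 0" for v
  proof -
    have "{w \<in> nbrs ?P v. Suc w = v} = {v - 1}" unfolding N[OF that(1)] using that by auto
    then show ?thesis by simp
  qed
  moreover have "{v. v \<le> n \<and> v = 0} = {0}" by auto
  moreover have "w = Suc v \<or> v = Suc w" if "v \<le> n" "w \<in> nbrs ?P v" for v w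
    using that(2) N[OF that(1)] by blast
  ultimately show ?thesis
    unfolding leveled_tree_def V by simp
qed

lemma pair_graph_star_graph: "pair_graph (star_graph l)"
proof -
  have "finite (parcs (star_graph l))"
    by (rule finite_subset[of _ "{..<l} \<times> {..<l}"]) (auto simp: star_graph_def)
  moreover have "symmetric (star_graph l)" "finite (pverts (star_graph l))"
    by (auto simp: star_graph_def symmetric_def sym_def)
  moreover have "fst e \<noteq> snd e" "fst e \<in> pverts (star_graph l)" "snd e \<in> pverts (star_graph l)"
    if "e \<in> parcs (star_graph l)" for e
    using that by (auto simp: star_graph_def)
  ultimately show ?thesis by unfold_locales simp_all
qed

lemma nbrs_star_graph:
  "v < l \<Longrightarrow> nbrs (star_graph l) v = (if v = 0 then {1..<l} else {0})"
  by (auto simp: nbrs_def star_graph_def)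

lemma leveled_tree_star_graph:
  assumes "l \<ge> 2"
  shows "leveled_tree [l - 1] (\<lambda>v. if v = 0 then 0 else 1) 0 (star_graph l)"
proof -
  have V: "pverts (star_graph l) = {..<l}" by (simp add: star_graph_def)
  have 1: "{w \<in> nbrs (star_graph l) 0. w \<noteq> 0} = {1..<l}" using assms by (auto simp: nbrs_star_graph)
  have 2: "{w \<in> nbrs (star_graph l) v. w = 0} = {0}" if "v < l" "v \<noteq> 0" for v
    using that by (auto simp: nbrs_star_graph)
  have 3: "{w. 0 < w \<and> (0 < w \<longrightarrow> w < l)} = {1..<l}" by auto
  show ?thesis
    unfolding leveled_tree_def using assms pair_graph_star_graph[of l]
    by (auto simp: V 1 2 3 nbrs_star_graph)
qed

text \<open>The same star seen from the end of an arm. Generalized Bethe trees of the form B(1, d),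
  stretched, are subdivided stars for this reason.\<close>

lemma leveled_tree_star_graph_leaf:
  assumes "l \<ge> 3"
  shows "leveled_tree [1, l - 2] (\<lambda>v. if v = 1 then 0 else if v = 0 then 1 else 2) 1 (star_graph l)"
    (is "leveled_tree _ ?lev _ _")
proof -
  have V: "pverts (star_graph l) = {..<l}" by (simp add: star_graph_def)
  have 1: "{w \<in> nbrs (star_graph l) 0. ?lev w = Suc (?lev 0)} = {2..<l}"
    using assms by (auto simp: nbrs_star_graph split: if_splits)
  have 2: "{w \<in> nbrs (star_graph l) v. Suc (?lev w) = ?lev v} = {0}" if "v < l" "v \<noteq> 0" "v \<noteq> 1" for v
    using that by (auto simp: nbrs_star_graph)
  have 3: "{w \<in> nbrs (star_graph l) 0. Suc (?lev w) = ?lev 0} = {1}"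
    using assms by (auto simp: nbrs_star_graph split: if_splits)
  have 4: "{w \<in> nbrs (star_graph l) 1. ?lev w = Suc (?lev 1)} = {0}"
    using assms by (auto simp: nbrs_star_graph split: if_splits)
  show ?thesis
    unfolding leveled_tree_def
  proof (intro conjI ballI impI)
    show "{v \<in> pverts (star_graph l). ?lev v = 0} = {1}" using assms by (auto simp: V)
    fix v assume v: "v \<in> pverts (star_graph l)"
    then have vl: "v < l" by (simp add: V)
    show "?lev v \<le> length [1, l - 2]" by simp
    show "card {w \<in> nbrs (star_graph l) v. ?lev w = Suc (?lev v)} = [1, l - 2] ! ?lev v"
      if lt: "?lev v < length [1, l - 2]"
    proof -
      consider "v = 0" | "v = 1" using lt by (auto split: if_splits)
      then show ?thesis by cases (simp_all only: 1 4, simp_all)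
    qed
    show "card {w \<in> nbrs (star_graph l) v. Suc (?lev w) = ?lev v} = 1" if "?lev v \<noteq> 0"
    proof (cases "v = 0")
      case True
      then show ?thesis by (simp only: 3) simp
    next
      case False
      from that have "v \<noteq> 1" by (auto split: if_splits)
      show ?thesis unfolding 2[OF vl False \<open>v \<noteq> 1\<close>] by simp
    qed
    fix w assume "w \<in> nbrs (star_graph l) v"
    then show "?lev w = Suc (?lev v) \<or> ?lev v = Suc (?lev w)"
      using vl by (auto simp: nbrs_star_graph split: if_splits)
  qed (rule pair_graph_star_graph)
qed

section \<open>Periods of the base graphs\<close>

lemma grover_step_bethe_graph:
  assumes "xs \<in> bethe_verts ds"
  shows "grover_step (bethe_graph ds) \<psi> (xs, ys) =
    2 / real ((if xs = [] then 0 else 1) + (if length xs < length ds then ds ! length xs else 0)) *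
      ((if xs = [] then 0 else \<psi> (butlast xs, xs)) +
       (if length xs < length ds then \<Sum>j<ds ! length xs. \<psi> (xs @ [j], xs) else 0)) - \<psi> (ys, xs)"
  unfolding grover_step_def fst_conv card_nbrs_bethe_graph[OF assms] sum_nbrs_bethe_graph[OF assms] by simp

lemma bethe_graph_arc_cases:
  assumes "e \<in> parcs (bethe_graph ds)"
  obtains xs j where "xs @ [j] \<in> bethe_verts ds" "e = (xs, xs @ [j]) \<or> e = (xs @ [j], xs)"
  using assms unfolding bethe_graph_def by auto

lemma bethe_graph_arcI:
  assumes "xs @ [j] \<in> bethe_verts ds"
  shows "(xs, xs @ [j]) \<in> parcs (bethe_graph ds)" "(xs @ [j], xs) \<in> parcs (bethe_graph ds)"
  using assms by (auto simp: bethe_graph_def bethe_verts_snoc)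

text \<open>Formulated for an orbit \<open>\<psi> t\<close>, so that the step equations of a
  concrete tree can be used as recurrences in \<open>t\<close>.\<close>

lemma grover_power_is_idI:
  assumes "pair_graph G"
    and "\<And>e \<psi>. e \<in> parcs G \<Longrightarrow> (\<And>t. \<psi> (Suc t) = grover_step G (\<psi> t)) \<Longrightarrow> \<psi> k e = \<psi> (0::nat) e"
  shows "grover_power_is_id G k"
  unfolding grover_power_is_id_iff[OF assms(1)]
proof (intro allI ballI)
  fix \<psi> e assume "e \<in> parcs G"
  then have "(grover_step G ^^ k) \<psi> e = (grover_step G ^^ 0) \<psi> e"
    by (rule assms(2)[of e "\<lambda>t. (grover_step G ^^ t) \<psi>"]) simp
  then show "(grover_step G ^^ k) \<psi> e = \<psi> e" by simp
qed

lemma grover_power_not_idI: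
  assumes "pair_graph G" "e \<in> parcs G"
    and "\<And>\<psi>. \<psi> 0 = \<phi> \<Longrightarrow> (\<And>t. \<psi> (Suc t) = grover_step G (\<psi> t)) \<Longrightarrow> \<psi> k e \<noteq> \<phi> e"
  shows "\<not> grover_power_is_id G k"
  using assms(3)[of "\<lambda>t. (grover_step G ^^ t) \<phi>"] assms(2)
  unfolding grover_power_is_id_iff[OF assms(1)] by auto

text \<open>A divisor \<open>k\<close> of \<open>n\<close> cannot be the period as soon as one
  multiple of \<open>k\<close> fails. Thus few exponents need testing: 2 for period 4, and 4 and 6
  for period 12.\<close>

lemma grover_periodI:
  assumes "pair_graph G" "1 \<le> n" "grover_power_is_id G n"
    and "\<And>k. k dvd n \<Longrightarrow> k \<noteq> n \<Longrightarrow> \<exists>m. k dvd m \<and> \<not> grover_power_is_id G m"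
  shows "periodic_grover_walk G" "grover_period G = n"
proof -
  show per: "periodic_grover_walk G" using assms(2,3) unfolding periodic_grover_walk_def by auto
  note iff = grover_power_is_id_iff_dvd[OF assms(1) per]
  have "grover_period G dvd n" using assms(3) unfolding iff .
  then show "grover_period G = n" using assms(4)[of "grover_period G"] unfolding iff by auto
qed

lemma grover_period_12I:
  assumes "pair_graph G" "grover_power_is_id G 12" "\<not> grover_power_is_id G 6" "\<not> grover_power_is_id G 4"
  shows "periodic_grover_walk G" "grover_period G = 12"
proof -
  have "\<exists>m. k dvd m \<and> \<not> grover_power_is_id G m" if "k dvd 12" "k \<noteq> 12" for k
  proof -
    have "k \<le> 12" using that(1) by (intro dvd_imp_le) auto
    then have "k \<in> {0,1,2,3,4,5,6,7,8,9,10,11}"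
      using that(2) unfolding insert_iff empty_iff by presburger
    then have "k dvd 6 \<or> k dvd 4" using that(1) by auto
    then show ?thesis using assms(3,4) by blast
  qed
  then show "periodic_grover_walk G" "grover_period G = 12"
    using grover_periodI[OF assms(1), of 12] assms(2) by simp_all
qed

lemma bethe_verts_1: "[a] \<in> bethe_verts (d # ds) \<longleftrightarrow> a < d"
  and bethe_verts_2: "[a, b] \<in> bethe_verts (d # d' # ds) \<longleftrightarrow> a < d \<and> b < d'"
  and bethe_verts_3: "[a, b, c] \<in> bethe_verts (d # d' # d'' # ds) \<longleftrightarrow> a < d \<and> b < d' \<and> c < d''"
  and bethe_verts_Nil: "[] \<in> bethe_verts es"
proof -
  show Nil: "[] \<in> bethe_verts es" for es by (simp add: bethe_verts_def)
  show 1: "[a] \<in> bethe_verts (d # ds) \<longleftrightarrow> a < d" for ds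
    using bethe_verts_snoc[of "[]" a "d # ds"] by (simp add: Nil)
  show 2: "[a, b] \<in> bethe_verts (d # d' # ds) \<longleftrightarrow> a < d \<and> b < d'" for ds
    using bethe_verts_snoc[of "[a]" b "d # d' # ds"] by (simp add: 1)
  show "[a, b, c] \<in> bethe_verts (d # d' # d'' # ds) \<longleftrightarrow> a < d \<and> b < d' \<and> c < d''"
    using bethe_verts_snoc[of "[a, b]" c "d # d' # d'' # ds"] by (simp add: 2)
qed

section \<open>Stars and the single edge\<close>

lemma star_recurrence:
  fixes x :: "nat \<Rightarrow> nat \<Rightarrow> real"
  assumes "s \<ge> 1" "\<And>t a. a < s \<Longrightarrow> x (t + 2) a = 2 / s * (\<Sum>b<s. x t b) - x t a" "a < s"
  shows "x (t + 4) a = x t a"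
proof -
  \<comment> \<open>Reflection in the mean preserves the sum, so the second reflection undoes the
    first.\<close>
  have S: "(\<Sum>b<s. x (t + 2) b) = (\<Sum>b<s. x t b)" for t
  proof -
    have "(\<Sum>b<s. x (t + 2) b) = (\<Sum>b<s. 2 / s * (\<Sum>b<s. x t b) - x t b)"
      by (intro sum.cong refl assms(2)) simp
    then show ?thesis using assms(1) by (simp add: sum_subtractf)
  qed
  have "x (t + 2 + 2) a = x t a" unfolding assms(2)[OF assms(3)] S by simp
  moreover have "t + 2 + 2 = t + 4" by simp
  ultimately show ?thesis by (simp only:)
qed

lemma bethe_1_steps:
  assumes "\<And>t. \<psi> (Suc t) = grover_step (bethe_graph [s]) (\<psi> t)" "a < s"
  shows "\<psi> (Suc t) ([], [a]) = 2 / s * (\<Sum>b<s. \<psi> t ([b], [])) - \<psi> t ([a], [])"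
    and "\<psi> (Suc t) ([a], []) = \<psi> t ([], [a])"
  unfolding assms(1)[of t]
  using assms(2) by (simp_all add: grover_step_bethe_graph bethe_verts_Nil bethe_verts_1)

lemma bethe_1_power_4:
  assumes "s \<ge> 1"
  shows "grover_power_is_id (bethe_graph [s]) 4"
proof (rule grover_power_is_idI[OF pair_graph_bethe_graph])
  fix e \<psi> assume e: "e \<in> parcs (bethe_graph [s])" and \<psi>: "\<And>t. \<psi> (Suc t) = grover_step (bethe_graph [s]) (\<psi> t)"
  obtain a where a: "a < s" "e = ([], [a]) \<or> e = ([a], [])"
    using e by (elim bethe_graph_arc_cases) (auto simp: bethe_verts_snoc bethe_verts_1)
  note st = bethe_1_steps[of \<psi>, OF \<psi>]
  have "\<psi> (t + 2) ([], [b]) = 2 / s * (\<Sum>c<s. \<psi> t ([], [c])) - \<psi> t ([], [b])"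
    "\<psi> (t + 2) ([b], []) = 2 / s * (\<Sum>c<s. \<psi> t ([c], [])) - \<psi> t ([b], [])" if "b < s" for t b
    using that st by simp_all
  then have "\<psi> (0 + 4) ([], [a]) = \<psi> 0 ([], [a])" "\<psi> (0 + 4) ([a], []) = \<psi> 0 ([a], [])"
    using star_recurrence[OF assms, of "\<lambda>t a. \<psi> t ([], [a])" a 0]
      star_recurrence[OF assms, of "\<lambda>t a. \<psi> t ([a], [])" a 0] a(1) by blast+
  then show "\<psi> 4 e = \<psi> 0 e" using a(2) by auto
qed

lemma period_star:
  assumes "s \<ge> 2"
  shows "periodic_grover_walk (bethe_graph [s])" "grover_period (bethe_graph [s]) = 4"
proof -
  \<comment> \<open>A vector with opposite values on two arms has mean zero and is negated by two
    steps.\<close>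
  have not: "\<not> grover_power_is_id (bethe_graph [s]) 2"
  proof (rule grover_power_not_idI[OF pair_graph_bethe_graph,
      of "([], [0])" _ "\<lambda>e. if e = ([], [0]) then 1 else if e = ([], [1]) then - 1 else 0"])
    show "([], [0]) \<in> parcs (bethe_graph [s])"
      using bethe_graph_arcI(1)[of "[]" 0 "[s]"] assms by (simp add: bethe_verts_1)
    fix \<psi> assume 0: "\<psi> 0 = (\<lambda>e. if e = ([], [0]) then 1 else if e = ([], [1]) then - 1 else 0)"
      and \<psi>: "\<And>t. \<psi> (Suc t) = grover_step (bethe_graph [s]) (\<psi> t)"
    obtain m where m: "s = Suc (Suc m)" using assms by (metis add_2_eq_Suc le_Suc_ex)
    have "(\<Sum>b<s. \<psi> 0 ([], [b])) = 0" unfolding m sum.lessThan_Suc_shift by (simp add: 0)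
    then have "\<psi> (Suc (Suc 0)) ([], [0]) = - \<psi> 0 ([], [0])"
      using bethe_1_steps[of \<psi>, OF \<psi>] assms by simp
    then show "\<psi> 2 ([], [0]) \<noteq> (if ([], [0]) = ([], [0::nat]) then 1
        else if ([], [0]) = ([], [1::nat]) then - 1 else 0)"
      by (simp add: 0 numeral_2_eq_2)
  qed
  have "\<exists>m. k dvd m \<and> \<not> grover_power_is_id (bethe_graph [s]) m" if "k dvd 4" "k \<noteq> 4" for k
  proof -
    have "k \<le> 4" using that(1) by (intro dvd_imp_le) auto
    then have "k \<in> {0,1,2,3}" using that(2) by auto
    then have "k dvd 2" using that(1) by auto
    then show ?thesis using not by blast
  qed
  then show "periodic_grover_walk (bethe_graph [s])" "grover_period (bethe_graph [s]) = 4"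
    using grover_periodI[OF pair_graph_bethe_graph, of 4 "[s]"] bethe_1_power_4[of s] assms by simp_all
qed

lemma period_edge:
  "periodic_grover_walk (bethe_graph [1])" "grover_period (bethe_graph [1]) = 2"
proof -
  have e: "e = ([], [0]) \<or> e = ([0], [])" if "e \<in> parcs (bethe_graph [1])" for e
    using that by (elim bethe_graph_arc_cases) (auto simp: bethe_verts_snoc bethe_verts_1)
  have st: "\<psi> (Suc t) ([], [0]) = \<psi> t ([0], [])" "\<psi> (Suc t) ([0], []) = \<psi> t ([], [0])"
    if "\<And>t. \<psi> (Suc t) = grover_step (bethe_graph [1]) (\<psi> t)" for \<psi> t
    using bethe_1_steps[of \<psi> 1 0 t] that by simp_all
  have id: "grover_power_is_id (bethe_graph [1]) 2"
  proof (rule grover_power_is_idI[OF pair_graph_bethe_graph])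
    fix a \<psi> assume a: "a \<in> parcs (bethe_graph [1])"
      and \<psi>: "\<And>t. \<psi> (Suc t) = grover_step (bethe_graph [1]) (\<psi> t)"
    show "\<psi> 2 a = \<psi> 0 a"
      using e[OF a] by (elim disjE) (simp_all only: numeral_2_eq_2 st[of \<psi>, OF \<psi>])
  qed
  have not: "\<not> grover_power_is_id (bethe_graph [1]) 1"
  proof (rule grover_power_not_idI[OF pair_graph_bethe_graph, of "([], [0])" _ "\<lambda>e. if e = ([], [0]) then 1 else 0"])
    show "([], [0]) \<in> parcs (bethe_graph [1])"
      using bethe_graph_arcI(1)[of "[]" 0 "[1]"] by (simp add: bethe_verts_1)
    fix \<psi> assume "\<psi> 0 = (\<lambda>e. if e = ([], [0]) then 1 else 0)" "\<And>t. \<psi> (Suc t) = grover_step (bethe_graph [1]) (\<psi> t)"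
    then show "\<psi> 1 ([], [0]) \<noteq> (if ([], [0]) = ([], [0::nat]) then 1 else 0)"
      using st(1)[of \<psi> 0] by simp
  qed
  have "\<exists>m. k dvd m \<and> \<not> grover_power_is_id (bethe_graph [1]) m" if "k dvd 2" "k \<noteq> 2" for k
  proof -
    have "k \<le> 2" using that(1) by (intro dvd_imp_le) auto
    then have "k \<in> {0, 1}" using that(2) by auto
    then have "k dvd 1" using that(1) by auto
    then show ?thesis using not by blast
  qed
  then show "periodic_grover_walk (bethe_graph [1])" "grover_period (bethe_graph [1]) = 2"
    using grover_periodI[OF pair_graph_bethe_graph, of 2 "[1]"] id by simp_all
qed

section \<open>The trees B(s,3)\<close>

lemma sum_lessThan_3: "(\<Sum>b<3. f b) = f 0 + f 1 + f (2::nat)" for f :: "nat \<Rightarrow> real"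
  by (simp add: eval_nat_numeral)

text \<open>Two steps preserve the space of functions on the arcs leaving even levels.
  \<open>\<alpha> n a\<close> is the amplitude on the arc from the root to its child
  \<open>a\<close>, and \<open>\<delta> n a b\<close> the one on the arc from leaf \<open>b\<close>
  up to \<open>a\<close>, with \<open>n\<close> counting double steps.\<close>

locale bethe_s3_recurrence =
  fixes s :: nat and \<alpha> :: "nat \<Rightarrow> nat \<Rightarrow> real" and \<delta> :: "nat \<Rightarrow> nat \<Rightarrow> nat \<Rightarrow> real"
  assumes s: "s \<ge> 1"
    and \<alpha>_Suc: "a < s \<Longrightarrow> \<alpha> (Suc n) a =
      2 / s * (\<Sum>b<s. (\<delta> n b 0 + \<delta> n b 1 + \<delta> n b 2 - \<alpha> n b) / 2) - (\<delta> n a 0 + \<delta> n a 1 + \<delta> n a 2 - \<alpha> n a) / 2"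
    and \<delta>_Suc: "a < s \<Longrightarrow> b < 3 \<Longrightarrow> \<delta> (Suc n) a b = (\<alpha> n a + (\<delta> n a 0 + \<delta> n a 1 + \<delta> n a 2)) / 2 - \<delta> n a b"
begin

definition h where "h n a = \<delta> n a 0 + \<delta> n a 1 + \<delta> n a 2"
definition A where "A n = (\<Sum>a<s. \<alpha> n a) / s"
definition B where "B n = (\<Sum>a<s. h n a) / s"

lemma sum_\<alpha>: "(\<Sum>a<s. \<alpha> n a) = s * A n" and sum_h: "(\<Sum>a<s. h n a) = s * B n"
  using s by (simp_all add: A_def B_def)

lemma sum_diff: "(\<Sum>b<s. (h n b - \<alpha> n b) / 2) = s * (B n - A n) / 2"
  unfolding sum_divide_distrib[symmetric] sum_subtractf sum_\<alpha> sum_h by (simp add: right_diff_distrib)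

lemma \<alpha>_1:
  assumes "a < s"
  shows "\<alpha> (Suc n) a = B n - A n - (h n a - \<alpha> n a) / 2"
proof -
  have "\<alpha> (Suc n) a = 2 / s * (\<Sum>b<s. (h n b - \<alpha> n b) / 2) - (h n a - \<alpha> n a) / 2"
    unfolding h_def by (rule \<alpha>_Suc[OF assms])
  then show ?thesis using s unfolding sum_diff by simp
qed

lemma h_1: "a < s \<Longrightarrow> h (Suc n) a = 3 / 2 * \<alpha> n a + h n a / 2"
  using \<delta>_Suc[of a 0 n] \<delta>_Suc[of a 1 n] \<delta>_Suc[of a 2 n] by (simp add: h_def field_simps)

lemma A_1: "A (Suc n) = (B n - A n) / 2"
proof -
  have "(\<Sum>a<s. \<alpha> (Suc n) a) = (\<Sum>a<s. B n - A n - (h n a - \<alpha> n a) / 2)"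
    by (intro sum.cong refl \<alpha>_1) simp
  also have "\<dots> = s * ((B n - A n) / 2)"
    by (simp only: sum_subtractf sum_diff) (simp add: field_simps)
  finally show ?thesis using s unfolding sum_\<alpha> by simp
qed

lemma B_1: "B (Suc n) = 3 / 2 * A n + B n / 2"
proof -
  have "(\<Sum>a<s. h (Suc n) a) = (\<Sum>a<s. 3 / 2 * \<alpha> n a + h n a / 2)"
    by (intro sum.cong refl h_1) simp
  also have "\<dots> = 3 / 2 * (\<Sum>a<s. \<alpha> n a) + (\<Sum>a<s. h n a) / 2"
    by (simp add: sum.distrib sum_distrib_left sum_divide_distrib)
  finally show ?thesis unfolding A_def B_def by (simp add: add_divide_distrib)
qed

text \<open>By \<open>A_1\<close> and \<open>B_1\<close> a double step acts on the means as an
  involution. By this lemma and \<open>\<delta>_3\<close>, three double steps negate the deviations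
  \<open>\<alpha> n a - A n\<close> and \<open>\<delta> n a b - B n / 3\<close>. Hence six double
  steps are the identity.\<close>

lemma \<alpha>_3: "a < s \<Longrightarrow> \<alpha> (Suc (Suc (Suc n))) a = (B n - A n) / 2 - (\<alpha> n a - A n)"
  by (simp add: \<alpha>_1 h_1 A_1 B_1 field_simps)

lemma \<delta>_1: "a < s \<Longrightarrow> b < 3 \<Longrightarrow> \<delta> (Suc n) a b = (\<alpha> n a + h n a) / 2 - \<delta> n a b"
  using \<delta>_Suc by (simp add: h_def)

lemma \<delta>_3: "a < s \<Longrightarrow> b < 3 \<Longrightarrow> \<delta> (Suc (Suc (Suc n))) a b = (A n + B n) / 2 - \<delta> n a b"
  by (simp add: \<alpha>_1 h_1 A_1 B_1 \<delta>_1 field_simps)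

lemma \<alpha>_6: "a < s \<Longrightarrow> \<alpha> 6 a = \<alpha> 0 a"
  and \<delta>_6: "a < s \<Longrightarrow> b < 3 \<Longrightarrow> \<delta> 6 a b = \<delta> 0 a b"
proof -
  have 6: "6 = Suc (Suc (Suc (Suc (Suc (Suc 0)))))" by simp
  show "a < s \<Longrightarrow> \<alpha> 6 a = \<alpha> 0 a" "a < s \<Longrightarrow> b < 3 \<Longrightarrow> \<delta> 6 a b = \<delta> 0 a b"
    unfolding 6 by (simp_all add: \<alpha>_3 \<delta>_3 A_1 B_1 field_simps)
qed

end

lemma bethe_s3_steps:
  assumes "\<And>t. \<psi> (Suc t) = grover_step (bethe_graph [s, 3]) (\<psi> t)" "a < s"
  shows "\<psi> (Suc t) ([], [a]) = 2 / s * (\<Sum>b<s. \<psi> t ([b], [])) - \<psi> t ([a], [])"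
    and "\<psi> (Suc t) ([a], []) = (\<psi> t ([a, 0], [a]) + \<psi> t ([a, 1], [a]) + \<psi> t ([a, 2], [a]) - \<psi> t ([], [a])) / 2"
    and "b < 3 \<Longrightarrow> \<psi> (Suc t) ([a], [a, b]) =
      (\<psi> t ([], [a]) + (\<psi> t ([a, 0], [a]) + \<psi> t ([a, 1], [a]) + \<psi> t ([a, 2], [a]))) / 2 - \<psi> t ([a, b], [a])"
    and "b < 3 \<Longrightarrow> \<psi> (Suc t) ([a, b], [a]) = \<psi> t ([a], [a, b])"
  unfolding assms(1)[of t] using assms(2)
  by (simp_all add: grover_step_bethe_graph bethe_verts_Nil bethe_verts_1 bethe_verts_2 sum_lessThan_3 field_simps)

lemma bethe_s3_double_steps:
  assumes "\<And>t. \<psi> (Suc t) = grover_step (bethe_graph [s, 3]) (\<psi> t)" "a < s"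
  shows "\<psi> (Suc (Suc t)) ([], [a]) = 2 / s * (\<Sum>b<s. (\<psi> t ([b, 0], [b]) + \<psi> t ([b, 1], [b])
        + \<psi> t ([b, 2], [b]) - \<psi> t ([], [b])) / 2)
      - (\<psi> t ([a, 0], [a]) + \<psi> t ([a, 1], [a]) + \<psi> t ([a, 2], [a]) - \<psi> t ([], [a])) / 2"
    and "b < 3 \<Longrightarrow> \<psi> (Suc (Suc t)) ([a, b], [a]) =
      (\<psi> t ([], [a]) + (\<psi> t ([a, 0], [a]) + \<psi> t ([a, 1], [a]) + \<psi> t ([a, 2], [a]))) / 2 - \<psi> t ([a, b], [a])"
proof -
  note st = bethe_s3_steps[of \<psi>, OF assms(1)]
  have "(\<Sum>b<s. \<psi> (Suc t) ([b], [])) = (\<Sum>b<s. (\<psi> t ([b, 0], [b]) + \<psi> t ([b, 1], [b])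
      + \<psi> t ([b, 2], [b]) - \<psi> t ([], [b])) / 2)"
    by (intro sum.cong refl st(2)) simp
  then show "\<psi> (Suc (Suc t)) ([], [a]) = 2 / s * (\<Sum>b<s. (\<psi> t ([b, 0], [b]) + \<psi> t ([b, 1], [b])
        + \<psi> t ([b, 2], [b]) - \<psi> t ([], [b])) / 2)
      - (\<psi> t ([a, 0], [a]) + \<psi> t ([a, 1], [a]) + \<psi> t ([a, 2], [a]) - \<psi> t ([], [a])) / 2"
    unfolding st(1)[OF assms(2), of "Suc t"] st(2)[OF assms(2)] by simp
  show "b < 3 \<Longrightarrow> \<psi> (Suc (Suc t)) ([a, b], [a]) =
      (\<psi> t ([], [a]) + (\<psi> t ([a, 0], [a]) + \<psi> t ([a, 1], [a]) + \<psi> t ([a, 2], [a]))) / 2 - \<psi> t ([a, b], [a])"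
    using st(3,4)[OF assms(2)] by metis
qed

lemma bethe_s3_power_12:
  assumes "s \<ge> 1"
  shows "grover_power_is_id (bethe_graph [s, 3]) 12"
proof (rule grover_power_is_idI[OF pair_graph_bethe_graph])
  fix e \<psi> assume e: "e \<in> parcs (bethe_graph [s, 3])"
    and \<psi>: "\<And>t. \<psi> (Suc t) = grover_step (bethe_graph [s, 3]) (\<psi> t)"
  note st = bethe_s3_steps[of \<psi>, OF \<psi>]
  \<comment> \<open>The offset \<open>c\<close> admits starting times of either parity;
    \<open>c = 1\<close> is used for the arcs leaving level 1.\<close>
  have E: "\<psi> (2 * 6 + c) ([], [a]) = \<psi> c ([], [a])"
    "b < 3 \<Longrightarrow> \<psi> (2 * 6 + c) ([a, b], [a]) = \<psi> c ([a, b], [a])" if "a < s" for c a b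
  proof -
    interpret bethe_s3_recurrence s "\<lambda>n a. \<psi> (2 * n + c) ([], [a])" "\<lambda>n a b. \<psi> (2 * n + c) ([a, b], [a])"
    proof
      show "s \<ge> 1" by fact
    next
      fix a n assume "a < s"
      from bethe_s3_double_steps[where \<psi> = \<psi> and t = "2 * n + c", OF \<psi> this] show
        "\<psi> (2 * Suc n + c) ([], [a]) = 2 / s * (\<Sum>b<s. (\<psi> (2 * n + c) ([b, 0], [b])
            + \<psi> (2 * n + c) ([b, 1], [b]) + \<psi> (2 * n + c) ([b, 2], [b]) - \<psi> (2 * n + c) ([], [b])) / 2)
          - (\<psi> (2 * n + c) ([a, 0], [a]) + \<psi> (2 * n + c) ([a, 1], [a]) + \<psi> (2 * n + c) ([a, 2], [a])
            - \<psi> (2 * n + c) ([], [a])) / 2"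
        "b < 3 \<Longrightarrow> \<psi> (2 * Suc n + c) ([a, b], [a]) = (\<psi> (2 * n + c) ([], [a]) + (\<psi> (2 * n + c) ([a, 0], [a])
            + \<psi> (2 * n + c) ([a, 1], [a]) + \<psi> (2 * n + c) ([a, 2], [a]))) / 2 - \<psi> (2 * n + c) ([a, b], [a])" for b
        by (simp_all only: mult_Suc_right add_2_eq_Suc add_Suc)
    qed
    show "\<psi> (2 * 6 + c) ([], [a]) = \<psi> c ([], [a])"
      "b < 3 \<Longrightarrow> \<psi> (2 * 6 + c) ([a, b], [a]) = \<psi> c ([a, b], [a])"
      using \<alpha>_6[OF that] \<delta>_6[OF that] by simp_all
  qed
  \<comment> \<open>The reflection at the root is its own inverse, so the amplitudes on arcs leaving
    level 1 can be read off one step later from arcs leaving even levels.\<close>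
  have S: "(\<Sum>a<s. \<psi> (Suc t) ([], [a])) = (\<Sum>a<s. \<psi> t ([a], []))" for t
    using assms by (simp add: st(1) sum_subtractf)
  have O1: "\<psi> t ([a], []) = 2 / s * (\<Sum>a<s. \<psi> (Suc t) ([], [a])) - \<psi> (Suc t) ([], [a])" if "a < s" for t a
    unfolding S st(1)[OF that] by simp
  have O2: "\<psi> 12 ([a], []) = \<psi> 0 ([a], [])" if "a < s" for a
    unfolding O1[OF that] using E(1)[of _ 1] that by simp
  have O3: "\<psi> 12 ([a], [a, b]) = \<psi> 0 ([a], [a, b])" if "a < s" "b < 3" for a b
    using E(2)[OF that, of 1] st(4)[OF that, of 12] st(4)[OF that, of 0] by (simp add: eval_nat_numeral)
  obtain xs j where xs: "xs @ [j] \<in> bethe_verts [s, 3]" and e': "e = (xs, xs @ [j]) \<or> e = (xs @ [j], xs)"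
    using e by (rule bethe_graph_arc_cases)
  have "length xs < 2" using xs by (simp add: bethe_verts_snoc)
  then consider "xs = []" | a where "xs = [a]" by (cases xs) (auto simp: less_Suc_eq)
  then show "\<psi> 12 e = \<psi> 0 e"
  proof cases
    case 1
    then have "j < s" using xs by (simp add: bethe_verts_1)
    then show ?thesis using 1 e' E(1)[of j 0] O2[of j] by auto
  next
    case (2 a)
    then have "a < s" "j < 3" using xs by (simp_all add: bethe_verts_2)
    then show ?thesis using 2 e' E(2)[of a j 0] O3[of a j] by auto
  qed
qed

lemma period_bethe_s3:
  assumes "s \<ge> 2"
  shows "periodic_grover_walk (bethe_graph [s, 3])" "grover_period (bethe_graph [s, 3]) = 12"
proof -
  \<comment> \<open>Opposite signs on two branches make all means vanish. Three double steps then
    negate the vector, and two give -1/2 on the chosen arc, which excludes the exponents 6 and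
    4.\<close>
  let ?\<phi> = "\<lambda>e. if e = ([], [0]) then 1 else if e = ([], [1::nat]) then - 1 else 0 :: real"
  have e: "([], [0]) \<in> parcs (bethe_graph [s, 3])"
    using bethe_graph_arcI(1)[of "[]" 0 "[s, 3]"] assms by (simp add: bethe_verts_1)
  have \<phi>: "\<psi> 4 ([], [0]) = - 1 / 2" "\<psi> 6 ([], [0]) = - 1"
    if 0: "\<psi> 0 = ?\<phi>" and \<psi>: "\<And>t. \<psi> (Suc t) = grover_step (bethe_graph [s, 3]) (\<psi> t)" for \<psi>
  proof -
    interpret bethe_s3_recurrence s "\<lambda>n a. \<psi> (2 * n) ([], [a])" "\<lambda>n a b. \<psi> (2 * n) ([a, b], [a])"
    proof
      show "s \<ge> 1" using assms by simp
    next
      fix a n assume "a < s"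
      from bethe_s3_double_steps[where \<psi> = \<psi> and t = "2 * n", OF \<psi> this] show
        "\<psi> (2 * Suc n) ([], [a]) = 2 / s * (\<Sum>b<s. (\<psi> (2 * n) ([b, 0], [b])
            + \<psi> (2 * n) ([b, 1], [b]) + \<psi> (2 * n) ([b, 2], [b]) - \<psi> (2 * n) ([], [b])) / 2)
          - (\<psi> (2 * n) ([a, 0], [a]) + \<psi> (2 * n) ([a, 1], [a]) + \<psi> (2 * n) ([a, 2], [a])
            - \<psi> (2 * n) ([], [a])) / 2"
        "b < 3 \<Longrightarrow> \<psi> (2 * Suc n) ([a, b], [a]) = (\<psi> (2 * n) ([], [a]) + (\<psi> (2 * n) ([a, 0], [a])
            + \<psi> (2 * n) ([a, 1], [a]) + \<psi> (2 * n) ([a, 2], [a]))) / 2 - \<psi> (2 * n) ([a, b], [a])" for b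
        by (simp_all only: mult_Suc_right add_2_eq_Suc add_Suc)
    qed
    have s: "0 < s" using assms by simp
    obtain m where m: "s = Suc (Suc m)" using assms by (metis add_2_eq_Suc le_Suc_ex)
    have "(\<Sum>a<s. \<psi> 0 ([], [a])) = 0" unfolding m sum.lessThan_Suc_shift by (simp add: 0)
    then have AB: "A 0 = 0" "B 0 = 0" "h 0 0 = 0" by (simp_all add: A_def B_def h_def 0)
    have \<alpha>0: "\<psi> (2 * 0) ([], [0]) = 1" by (simp add: 0)
    have "\<psi> (2 * Suc (Suc (Suc 0))) ([], [0]) = - 1"
      unfolding \<alpha>_3[OF s] AB \<alpha>0 by simp
    then show "\<psi> 6 ([], [0]) = - 1" by (simp add: eval_nat_numeral)
    have "\<psi> (2 * Suc (Suc 0)) ([], [0]) = - 1 / 2"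
      unfolding \<alpha>_1[OF s] A_1 B_1 h_1[OF s] AB \<alpha>0 by simp
    then show "\<psi> 4 ([], [0]) = - 1 / 2" by (simp add: eval_nat_numeral)
  qed
  have "\<not> grover_power_is_id (bethe_graph [s, 3]) 6"
    by (rule grover_power_not_idI[OF pair_graph_bethe_graph e, of ?\<phi>]) (simp only: \<phi>(2), simp)
  moreover have "\<not> grover_power_is_id (bethe_graph [s, 3]) 4"
    by (rule grover_power_not_idI[OF pair_graph_bethe_graph e, of ?\<phi>]) (simp only: \<phi>(1), simp)
  ultimately show "periodic_grover_walk (bethe_graph [s, 3])" "grover_period (bethe_graph [s, 3]) = 12"
    using grover_period_12I[OF pair_graph_bethe_graph] bethe_s3_power_12 assms by auto
qed

section \<open>The tree B(1,2,3)\<close>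

lemma bethe_123_steps:
  assumes "\<And>t. \<psi> (Suc t) = grover_step (bethe_graph [1, 2, 3]) (\<psi> t)"
  shows "\<psi> (Suc t) ([], [0]) = \<psi> t ([0], [])"
    and "\<psi> (Suc t) ([0], []) =
      2 / 3 * (\<psi> t ([], [0]) + \<psi> t ([0, 0], [0]) + \<psi> t ([0, 1], [0])) - \<psi> t ([], [0])"
    and "a < 2 \<Longrightarrow> \<psi> (Suc t) ([0], [0, a]) =
      2 / 3 * (\<psi> t ([], [0]) + \<psi> t ([0, 0], [0]) + \<psi> t ([0, 1], [0])) - \<psi> t ([0, a], [0])"
    and "a < 2 \<Longrightarrow> \<psi> (Suc t) ([0, a], [0]) = (\<psi> t ([0, a, 0], [0, a]) + \<psi> t ([0, a, 1], [0, a])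
      + \<psi> t ([0, a, 2], [0, a]) - \<psi> t ([0], [0, a])) / 2"
    and "a < 2 \<Longrightarrow> b < 3 \<Longrightarrow> \<psi> (Suc t) ([0, a], [0, a, b]) = (\<psi> t ([0], [0, a]) + (\<psi> t ([0, a, 0], [0, a])
      + \<psi> t ([0, a, 1], [0, a]) + \<psi> t ([0, a, 2], [0, a]))) / 2 - \<psi> t ([0, a, b], [0, a])"
    and "a < 2 \<Longrightarrow> b < 3 \<Longrightarrow> \<psi> (Suc t) ([0, a, b], [0, a]) = \<psi> t ([0, a], [0, a, b])"
  unfolding assms(1)[of t]
  by (simp_all add: grover_step_bethe_graph bethe_verts_Nil bethe_verts_1 bethe_verts_2 bethe_verts_3
      sum_lessThan_3 lessThan_Suc numeral_2_eq_2 field_simps)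

text \<open>On the span of the arcs leaving odd levels, the sixth power of the walk is twice the projection
  to the radial vectors minus the identity.\<close>

lemma bethe_123_six_steps:
  assumes \<psi>: "\<And>t. \<psi> (Suc t) = grover_step (bethe_graph [1, 2, 3]) (\<psi> t)" and a: "a < 2"
  defines "h \<equiv> \<lambda>t a. \<psi> t ([0, a, 0], [0, a]) + \<psi> t ([0, a, 1], [0, a]) + \<psi> t ([0, a, 2], [0, a])"
  shows "\<psi> (t + 6) ([0], []) = \<psi> t ([0], [])"
    and "\<psi> (t + 6) ([0], [0, a]) = \<psi> t ([0], [0, 0]) + \<psi> t ([0], [0, 1]) - \<psi> t ([0], [0, a])"
    and "b < 3 \<Longrightarrow> \<psi> (t + 6) ([0, a, b], [0, a]) = (h t 0 + h t 1) / 3 - \<psi> t ([0, a, b], [0, a])"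
    and "\<psi> t ([0], []) = 0 \<Longrightarrow> \<psi> t ([0], [0, 0]) = 1 \<Longrightarrow> \<psi> t ([0], [0, 1]) = - 1 \<Longrightarrow>
      h t 0 = 0 \<Longrightarrow> h t 1 = 0 \<Longrightarrow> \<psi> (t + 4) ([0], [0, 0]) = - 1 / 2"
proof -
  note st = bethe_123_steps[of \<psi>, OF \<psi>]
  have a01: "(0::nat) < 2" "(1::nat) < 2" by simp_all
  define q where "q t = \<psi> t ([0], [])" for t
  define \<alpha> where "\<alpha> t a = \<psi> t ([0], [0, a])" for t a
  define \<delta> where "\<delta> t a b = \<psi> t ([0, a, b], [0, a])" for t a b
  \<comment> \<open>Twice the mean of the three amplitudes that enter the vertex of level 1 halfway
    through a double step.\<close>
  define T where "T t = 2 / 3 * (q t + (h t 0 - \<alpha> t 0) / 2 + (h t 1 - \<alpha> t 1) / 2)" for t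
  have q2: "q (Suc (Suc t)) = T t - q t" for t
    unfolding T_def q_def \<alpha>_def h_def st(2)[of "Suc t"] st(1) st(4)[OF a01(1)] st(4)[OF a01(2)] by simp
  have \<alpha>2: "\<alpha> (Suc (Suc t)) a = T t - (h t a - \<alpha> t a) / 2" if "a < 2" for t a
    unfolding T_def q_def \<alpha>_def h_def st(3)[OF that, of "Suc t"] st(1) st(4)[OF a01(1)]
      st(4)[OF a01(2)] st(4)[OF that] by simp
  have \<delta>2: "\<delta> (Suc (Suc t)) a b = (\<alpha> t a + h t a) / 2 - \<delta> t a b" if "a < 2" "b < 3" for t a b
    unfolding \<delta>_def \<alpha>_def h_def st(6)[OF that, of "Suc t"] st(5)[OF that] ..
  have h: "h t a = \<delta> t a 0 + \<delta> t a 1 + \<delta> t a 2" for t a by (simp add: h_def \<delta>_def)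
  have h2: "h (Suc (Suc t)) a = 3 / 2 * \<alpha> t a + h t a / 2" if "a < 2" for t a
    using \<delta>2[OF that, of 0 t] \<delta>2[OF that, of 1 t] \<delta>2[OF that, of 2 t] by (simp add: h field_simps)
  have \<alpha>2': "\<alpha> (Suc (Suc t)) 0 = T t - (h t 0 - \<alpha> t 0) / 2" "\<alpha> (Suc (Suc t)) 1 = T t - (h t 1 - \<alpha> t 1) / 2"
      "h (Suc (Suc t)) 0 = 3 / 2 * \<alpha> t 0 + h t 0 / 2" "h (Suc (Suc t)) 1 = 3 / 2 * \<alpha> t 1 + h t 1 / 2" for t
    using \<alpha>2[of 0 t] \<alpha>2[of 1 t] h2[of 0 t] h2[of 1 t] by simp_all
  have T2: "T (Suc (Suc t)) = 2 / 3 * (T t - q t + (3 / 2 * \<alpha> t 0 + h t 0 / 2 - (T t - (h t 0 - \<alpha> t 0) / 2)) / 2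
      + (3 / 2 * \<alpha> t 1 + h t 1 / 2 - (T t - (h t 1 - \<alpha> t 1) / 2)) / 2)" for t
    unfolding T_def[of "Suc (Suc t)"] q2 \<alpha>2' ..
  have t6: "t + 6 = Suc (Suc (Suc (Suc (Suc (Suc t)))))" "t + 4 = Suc (Suc (Suc (Suc t)))" for t by simp_all
  have "q (t + 6) = q t" unfolding t6 q2 T2 \<alpha>2' by (simp add: T_def field_simps)
  then show "\<psi> (t + 6) ([0], []) = \<psi> t ([0], [])" by (simp only: q_def)
  have "\<alpha> (t + 6) a = \<alpha> t 0 + \<alpha> t 1 - \<alpha> t a"
    unfolding t6 \<alpha>2[OF a] h2[OF a] T2 q2 \<alpha>2' by (simp add: T_def field_simps)
  then show "\<psi> (t + 6) ([0], [0, a]) = \<psi> t ([0], [0, 0]) + \<psi> t ([0], [0, 1]) - \<psi> t ([0], [0, a])"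
    by (simp only: \<alpha>_def)
  have "\<delta> (t + 6) a b = (h t 0 + h t 1) / 3 - \<delta> t a b" if "b < 3"
    unfolding t6 \<delta>2[OF a that] \<alpha>2[OF a] h2[OF a] T2 q2 \<alpha>2' by (simp add: T_def field_simps)
  then show "b < 3 \<Longrightarrow> \<psi> (t + 6) ([0, a, b], [0, a]) = (h t 0 + h t 1) / 3 - \<psi> t ([0, a, b], [0, a])"
    by (simp only: \<delta>_def)
  show "\<psi> (t + 4) ([0], [0, 0]) = - 1 / 2"
    if "\<psi> t ([0], []) = 0" "\<psi> t ([0], [0, 0]) = 1" "\<psi> t ([0], [0, 1]) = - 1" "h t 0 = 0" "h t 1 = 0"
  proof -
    have "q t = 0" "\<alpha> t 0 = 1" "\<alpha> t 1 = - 1" using that by (simp_all only: q_def \<alpha>_def)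
    then have "\<alpha> (t + 4) 0 = - 1 / 2" unfolding t6 \<alpha>2' T2 using that(4,5) by (simp add: T_def)
    then show ?thesis by (simp only: \<alpha>_def)
  qed
qed

lemma bethe_123_power_12: "grover_power_is_id (bethe_graph [1, 2, 3]) 12"
proof (rule grover_power_is_idI[OF pair_graph_bethe_graph])
  fix e \<psi> assume e: "e \<in> parcs (bethe_graph [1, 2, 3])"
    and \<psi>: "\<And>t. \<psi> (Suc t) = grover_step (bethe_graph [1, 2, 3]) (\<psi> t)"
  note st = bethe_123_steps[of \<psi>, OF \<psi>]
  note six = bethe_123_six_steps[where \<psi> = \<psi>, OF \<psi>]
  have a01: "(0::nat) < 2" "(1::nat) < 2" by simp_all
  have b012: "(0::nat) < 3" "(1::nat) < 3" "(2::nat) < 3" by simp_all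
  have t12: "t + 12 = t + 6 + 6" for t :: nat by simp
  have q: "\<psi> (t + 12) ([0], []) = \<psi> t ([0], [])" for t
    unfolding t12 six(1)[OF a01(1)] ..
  have \<alpha>: "\<psi> (t + 12) ([0], [0, a]) = \<psi> t ([0], [0, a])" if "a < 2" for t a
    unfolding t12 six(2)[OF that] six(2)[OF a01(1)] six(2)[OF a01(2)] by simp
  have \<delta>: "\<psi> (t + 12) ([0, a, b], [0, a]) = \<psi> t ([0, a, b], [0, a])" if "a < 2" "b < 3" for t a b
    unfolding t12 six(3)[OF that] six(3)[OF a01(1) b012(1)] six(3)[OF a01(1) b012(2)] six(3)[OF a01(1) b012(3)]
      six(3)[OF a01(2) b012(1)] six(3)[OF a01(2) b012(2)] six(3)[OF a01(2) b012(3)] by (simp add: field_simps)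
  \<comment> \<open>The reflection at the vertex of level 1 is an involution: its incoming
    amplitudes are recovered from the outgoing ones a step later, so the arcs leaving even levels
    inherit the exponent 12.\<close>
  have p': "\<psi> t ([], [0]) = 2 / 3 * (\<psi> (Suc t) ([0], []) + \<psi> (Suc t) ([0], [0, 0]) + \<psi> (Suc t) ([0], [0, 1]))
      - \<psi> (Suc t) ([0], [])" for t
    unfolding st(2)[of t] st(3)[OF a01(1), of t] st(3)[OF a01(2), of t] by (simp add: field_simps)
  have \<beta>': "\<psi> t ([0, a], [0]) = 2 / 3 * (\<psi> (Suc t) ([0], []) + \<psi> (Suc t) ([0], [0, 0]) + \<psi> (Suc t) ([0], [0, 1]))
      - \<psi> (Suc t) ([0], [0, a])" if "a < 2" for t a
    unfolding st(2)[of t] st(3)[OF a01(1), of t] st(3)[OF a01(2), of t] st(3)[OF that, of t] by (simp add: field_simps)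
  have s12: "Suc (t + 12) = Suc t + 12" for t by simp
  have p: "\<psi> (t + 12) ([], [0]) = \<psi> t ([], [0])" for t
    unfolding p' s12 q \<alpha>[OF a01(1)] \<alpha>[OF a01(2)] ..
  have \<beta>: "\<psi> (t + 12) ([0, a], [0]) = \<psi> t ([0, a], [0])" if "a < 2" for t a
    unfolding \<beta>'[OF that] s12 q \<alpha>[OF a01(1)] \<alpha>[OF a01(2)] \<alpha>[OF that] ..
  have \<gamma>: "\<psi> (t + 12) ([0, a], [0, a, b]) = \<psi> t ([0, a], [0, a, b])" if "a < 2" "b < 3" for t a b
    unfolding st(6)[OF that, symmetric] s12 \<delta>[OF that] ..
  obtain xs j where xs: "xs @ [j] \<in> bethe_verts [1, 2, 3]" and e': "e = (xs, xs @ [j]) \<or> e = (xs @ [j], xs)"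
    using e by (rule bethe_graph_arc_cases)
  have len: "length xs < 3" and pre: "xs \<in> bethe_verts [1, 2, 3]" using xs by (simp_all add: bethe_verts_snoc)
  consider "xs = []" | c where "xs = [c]" | c a where "xs = [c, a]"
    using len by (cases xs; cases "tl xs") (auto simp: less_Suc_eq)
  then show "\<psi> 12 e = \<psi> 0 e"
  proof cases
    case 1
    then have "j = 0" using xs by (simp add: bethe_verts_1)
    then show ?thesis using 1 e' q[of 0] p[of 0] by auto
  next
    case (2 c)
    then have "c = 0" "j < 2" using xs by (simp_all add: bethe_verts_2)
    then show ?thesis using 2 e' \<alpha>[of j 0] \<beta>[of j 0] by auto
  next
    case (3 c a)
    then have "c = 0" "a < 2" "j < 3" using xs by (simp_all add: bethe_verts_3)
    then show ?thesis using 3 e' \<gamma>[of a j 0] \<delta>[of a j 0] by auto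
  qed
qed

lemma period_bethe_123:
  "periodic_grover_walk (bethe_graph [1, 2, 3])" "grover_period (bethe_graph [1, 2, 3]) = 12"
proof -
  \<comment> \<open>Antisymmetric in the two branches, hence with zero radial projection: six steps
    negate it.\<close>
  let ?\<phi> = "\<lambda>e. if e = ([0], [0, 0]) then 1 else if e = ([0], [0, 1::nat]) then - 1 else 0 :: real"
  have e: "([0], [0, 0]) \<in> parcs (bethe_graph [1, 2, 3])"
    using bethe_graph_arcI(1)[of "[0]" 0 "[1, 2, 3]"] by (simp add: bethe_verts_2)
  have \<phi>: "\<psi> 4 ([0], [0, 0]) = - 1 / 2" "\<psi> 6 ([0], [0, 0]) = - 1"
    if 0: "\<psi> 0 = ?\<phi>" and \<psi>: "\<And>t. \<psi> (Suc t) = grover_step (bethe_graph [1, 2, 3]) (\<psi> t)" for \<psi>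
  proof -
    have "(0::nat) < 2" by simp
    note six = bethe_123_six_steps[where \<psi> = \<psi> and t = 0, OF \<psi> this]
    show "\<psi> 4 ([0], [0, 0]) = - 1 / 2" using six(4) by (simp add: 0)
    show "\<psi> 6 ([0], [0, 0]) = - 1" using six(2) by (simp add: 0)
  qed
  have "\<not> grover_power_is_id (bethe_graph [1, 2, 3]) 6"
    by (rule grover_power_not_idI[OF pair_graph_bethe_graph e, of ?\<phi>]) (simp only: \<phi>(2), simp)
  moreover have "\<not> grover_power_is_id (bethe_graph [1, 2, 3]) 4"
    by (rule grover_power_not_idI[OF pair_graph_bethe_graph e, of ?\<phi>]) (simp only: \<phi>(1), simp)
  ultimately show "periodic_grover_walk (bethe_graph [1, 2, 3])" "grover_period (bethe_graph [1, 2, 3]) = 12"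
    using grover_period_12I[OF pair_graph_bethe_graph] bethe_123_power_12 by auto
qed

section \<open>Integrality of divisors\<close>

definition int_coeffs :: "real poly \<Rightarrow> bool" where
  "int_coeffs p \<longleftrightarrow> (\<forall>i. coeff p i \<in> \<int>)"

lemma common_denominator:
  fixes p :: "real poly"
  assumes "\<And>i. coeff p i \<in> \<rat>"
  shows "\<exists>N::nat. N \<ge> 1 \<and> int_coeffs (smult (real N) p)"
  using assms
proof (induction p rule: pCons_induct)
  case 0
  then show ?case by (intro exI[of _ 1]) (simp add: int_coeffs_def)
next
  case (pCons a p)
  have "coeff p i \<in> \<rat>" for i using pCons.prems[of "Suc i"] by simp
  then obtain N :: nat where N: "N \<ge> 1" "int_coeffs (smult (real N) p)" using pCons.IH by blast
  have "a \<in> \<rat>" using pCons.prems[of 0] by simp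
  then obtain m n :: int where mn: "n > 0" "a = of_int m / of_int n" by (rule Rats_cases')
  have "int_coeffs (smult (real (N * nat n)) (pCons a p))"
    unfolding int_coeffs_def
  proof
    fix i
    show "coeff (smult (real (N * nat n)) (pCons a p)) i \<in> \<int>"
    proof (cases i)
      case 0
      then show ?thesis using mn by simp
    next
      case (Suc k)
      have "real N * coeff p k \<in> \<int>" using N(2) by (simp add: int_coeffs_def)
      then have "of_int n * (real N * coeff p k) \<in> \<int>" by (rule Ints_mult[OF Ints_of_int])
      then show ?thesis using Suc mn(1) by (simp add: mult.assoc mult.left_commute)
    qed
  qed
  moreover have "N * nat n \<ge> 1" using N(1) mn(1) by simp
  ultimately show ?case by blast
qed

lemma int_coeffsE:
  assumes "int_coeffs p"
  obtains q :: "int poly" where "p = map_poly of_int q"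
  using assms intpolyE[of p] unfolding int_coeffs_def by blast

text \<open>Take the least \<open>N\<close> that clears denominators. The content divides the
  coefficient \<open>N\<close> at \<open>k\<close>, and dividing it out would leave a smaller
  multiplier.\<close>

lemma primitive_multiple:
  fixes p :: "real poly"
  assumes "\<And>i. coeff p i \<in> \<rat>" "coeff p k = 1"
  obtains N :: nat and q :: "int poly"
  where "N \<ge> 1" "smult (real N) p = map_poly of_int q" "content q = 1"
proof -
  let ?P = "\<lambda>N::nat. N \<ge> 1 \<and> int_coeffs (smult (real N) p)"
  define N where "N = (LEAST N. ?P N)"
  have N: "?P N" unfolding N_def using common_denominator[OF assms(1)] by (rule LeastI_ex)
  then obtain q where q: "smult (real N) p = map_poly of_int q" using int_coeffsE by blast
  have cq: "real_of_int (coeff q i) = real N * coeff p i" for i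
    using arg_cong[OF q, of "\<lambda>r. coeff r i"] by (simp add: coeff_map_poly)
  have qk: "coeff q k = int N" using cq[of k] assms(2) by simp
  have "content q = 1"
  proof -
    let ?c = "content q"
    have "?c dvd coeff q k" by (rule content_dvd_coeff)
    then obtain M where M: "int N = ?c * M" unfolding qk by (rule dvdE)
    have "?c \<noteq> 0" using M N by auto
    moreover have "?c = \<bar>?c\<bar>" using normalize_content[of q] by (simp only: normalize_int_def)
    ultimately have c: "?c > 0" by linarith
    have "int N > 0" using N by simp
    then have Mpos: "M > 0" using M c by (simp add: zero_less_mult_iff)
    have "int_coeffs (smult (real (nat M)) p)"
      unfolding int_coeffs_def
    proof
      fix i
      have "?c dvd coeff q i" by (rule content_dvd_coeff)
      then obtain x where "coeff q i = ?c * x" by (rule dvdE)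
      then have "real_of_int (?c * x) = real N * coeff p i" using cq[of i] by simp
      moreover have "real N = real_of_int (?c * M)" using arg_cong[OF M, of real_of_int] by simp
      ultimately have eq: "real_of_int ?c * real_of_int x = real_of_int ?c * (real_of_int M * coeff p i)"
        by (simp only: of_int_mult mult.assoc)
      have "real_of_int ?c \<noteq> 0" using c by linarith
      with eq have "real_of_int x = real_of_int M * coeff p i" by (rule mult_left_cancel[THEN iffD1, rotated])
      then show "coeff (smult (real (nat M)) p) i \<in> \<int>" using Mpos by (simp flip: \<open>real_of_int x = _\<close>)
    qed
    moreover have "nat M \<ge> 1" using Mpos by simp
    ultimately have "N \<le> nat M" unfolding N_def by (intro Least_le) simp
    then have "int N \<le> M" using Mpos by linarith
    then have "?c * M \<le> M" unfolding M .
    then have "?c \<le> 1" using Mpos by simp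
    then show ?thesis using c by simp
  qed
  then show thesis using that N q by blast
qed

text \<open>Since \<open>D\<close> has constant term 1, division coefficient by coefficient makes
  \<open>Q\<close> rational, with lowest coefficient 1 at \<open>p\<close>. Both factors thus have
  primitive integer multiples \<open>N D\<close> and \<open>M Q\<close>; every coefficient of the
  product of these is divisible by \<open>N * M\<close>, while its content is 1 by the Gauss lemma,
  so \<open>N * M = 1\<close>.\<close>

lemma int_coeffs_dvd:
  assumes D: "\<And>i. coeff D i \<in> \<rat>" "coeff D 0 = 1" and K: "K \<ge> 1"
    and eq: "D * Q = monom 1 p - monom 1 (p + K)"
  shows "int_coeffs D"
proof -
  have co: "(\<Sum>i\<le>m. coeff D i * coeff Q (m - i)) = (if m = p then 1 else if m = p + K then - 1 else 0)" for m
    using arg_cong[OF eq, of "\<lambda>r. coeff r m"] K by (auto simp: coeff_mult split: if_splits)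
  have split: "(\<Sum>i\<le>m. coeff D i * coeff Q (m - i)) = coeff Q m + (\<Sum>i<m. coeff D (Suc i) * coeff Q (m - Suc i))" for m
    using D(2) by (cases m) (simp_all add: sum.atMost_Suc_shift lessThan_Suc_atMost del: sum.atMost_Suc)
  have Q: "coeff Q m \<in> \<rat>" for m
  proof (induction m rule: less_induct)
    case (less m)
    have "coeff Q m = (if m = p then 1 else if m = p + K then - 1 else 0) - (\<Sum>i<m. coeff D (Suc i) * coeff Q (m - Suc i))"
      using co[of m] split[of m] by simp
    moreover have "(\<Sum>i<m. coeff D (Suc i) * coeff Q (m - Suc i)) \<in> \<rat>"
      using less by (intro Rats_sum Rats_mult D(1)) simp
    moreover have "(if m = p then 1 else if m = p + K then - 1 else 0 :: real) \<in> \<rat>" by simp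
    ultimately show ?case by (simp only: Rats_diff)
  qed
  have Q0: "coeff Q m = 0" if "m < p" for m
    using that
  proof (induction m rule: less_induct)
    case (less m)
    then show ?case using co[of m] split[of m] by simp
  qed
  have Qp: "coeff Q p = 1" using co[of p] split[of p] Q0 by simp
  obtain N P where P: "N \<ge> 1" "smult (real N) D = map_poly of_int P" "content P = 1"
    using primitive_multiple[OF D] by blast
  obtain M R where R: "M \<ge> 1" "smult (real M) Q = map_poly of_int R" "content R = 1"
    using primitive_multiple[OF Q Qp] by blast
  have "real_of_int (coeff (P * R) i) = coeff (smult (real N) D * smult (real M) Q) i" for i
    unfolding P(2) R(2) by (simp add: coeff_mult coeff_map_poly)
  then have "real_of_int (coeff (P * R) i) = real N * real M * coeff (monom 1 p - monom 1 (p + K)) i" for i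
    unfolding mult_smult_left mult_smult_right eq by simp
  then have "real_of_int (coeff (P * R) i)
      = of_int (int (N * M) * coeff (monom 1 p - monom 1 (p + K) :: int poly) i)" for i
    by simp
  then have "coeff (P * R) i = int (N * M) * coeff (monom 1 p - monom 1 (p + K)) i" for i
    by (simp only: of_int_eq_iff)
  then have "int (N * M) dvd coeff (P * R) i" for i by simp
  then have "int (N * M) dvd content (P * R)"
    unfolding const_poly_dvd_iff_dvd_content[symmetric] const_poly_dvd_iff by blast
  then have "N * M = 1" using P(3) R(3) by (simp add: content_mult flip: of_nat_mult)
  then have "D = map_poly of_int P" using P(2) by simp
  then show ?thesis by (simp add: int_coeffs_def coeff_map_poly)
qed

section \<open>Scattering on generalized Bethe trees\<close>

text \<open>The diagonal coin entry 2/deg - 1 at a vertex with a parent and \<open>d\<close>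
  children.\<close>

definition refl_coeff :: "nat \<Rightarrow> real" where
  "refl_coeff d = (1 - real d) / (1 + real d)"

text \<open>A wave with parameter \<open>z\<close> running down from level \<open>i - 1\<close> to level \<open>i\<close> is reflected with the
  amplitude \<open>scatA (drop i ds) / scatB (drop i ds)\<close>; composing the vertex of
  reflection coefficient \<open>r\<close> with the subtrees below it is a step of the Schur algorithm.\<close>

fun scat :: "nat list \<Rightarrow> real poly \<times> real poly" where
  "scat [] = (1, 1)"
| "scat (d # ds) = (smult (refl_coeff d) (snd (scat ds)) + monom 1 2 * fst (scat ds),
     snd (scat ds) + smult (refl_coeff d) (monom 1 2 * fst (scat ds)))"

definition scatA where "scatA ds = fst (scat ds)"
definition scatB where "scatB ds = snd (scat ds)"

lemma scat_simps:
  "scatA [] = 1" "scatB [] = 1"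
  "scatA (d # ds) = smult (refl_coeff d) (scatB ds) + monom 1 2 * scatA ds"
  "scatB (d # ds) = scatB ds + smult (refl_coeff d) (monom 1 2 * scatA ds)"
  by (simp_all add: scatA_def scatB_def)

lemma coeff_scat_rat: "coeff (scatA ds) i \<in> \<rat>" "coeff (scatB ds) i \<in> \<rat>"
proof (induction ds arbitrary: i)
  case (Cons d ds)
  have r: "refl_coeff d \<in> \<rat>" unfolding refl_coeff_def by simp
  have m: "coeff (monom 1 2 * scatA ds) i \<in> \<rat>" for i
    using Cons(1) by (simp add: coeff_monom_mult)
  {
    case 1
    show ?case using r m Cons(2) by (simp add: scat_simps Rats_add Rats_mult)
  next
    case 2
    show ?case using r m Cons(2) by (simp add: scat_simps Rats_add Rats_mult)
  }
qed (simp_all add: scat_simps)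

lemma coeff_scatB_0: "coeff (scatB ds) 0 = 1"
  by (induction ds) (simp_all add: scat_simps coeff_monom_mult)

text \<open>The denominators D of the resolvent for antisymmetric (\<open>scat_plus\<close>) and
  radial (\<open>scat_minus\<close>) vectors. Their zeros express that a wave reflected below, and
  with factor -1 or 1 at the top, returns unchanged.\<close>

definition scat_plus where "scat_plus ds = scatB ds + monom 1 2 * scatA ds"
definition scat_minus where "scat_minus ds = scatB ds - monom 1 2 * scatA ds"

lemma (in pair_graph) grover_step_linear:
  "grover_step G (\<lambda>e. c * \<psi> e + d * \<phi> e) = (\<lambda>e. c * grover_step G \<psi> e + d * grover_step G \<phi> e)"
  by (rule ext) (simp add: grover_step_def sum.distrib algebra_simps add_divide_distrib flip: sum_distrib_left)

lemma (in pair_graph) grover_step_pow_linear: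
  "(grover_step G ^^ k) (\<lambda>e. c * \<psi> e + d * \<phi> e)
    = (\<lambda>e. c * (grover_step G ^^ k) \<psi> e + d * (grover_step G ^^ k) \<phi> e)"
  by (induction k) (simp_all add: grover_step_linear)

text \<open>Multiply \<open>(1 - z U) V = D \<delta>\<close> by the geometric sum of the
  \<open>z^m U^m\<close> with \<open>m < K\<close>; by \<open>U^K = 1\<close> it telescopes to
  \<open>1 - z^K\<close>. For a fixed \<open>\<delta>\<close> each entry of the sum is a polynomial
  in z.\<close>

lemma resolvent_identity:
  assumes "pair_graph G" "grover_power_is_id G K"
    and V: "\<And>e. e \<in> parcs G \<Longrightarrow> V e = z * grover_step G V e + D * \<delta> e"
    and e: "e \<in> parcs G"
  shows "(1 - z ^ K) * V e = D * (\<Sum>m<K. z ^ m * (grover_step G ^^ m) \<delta> e)"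
proof -
  interpret pair_graph G by fact
  let ?U = "grover_step G"
  have "V e = z ^ m * (?U ^^ m) V e + D * (\<Sum>i<m. z ^ i * (?U ^^ i) \<delta> e)" for m
  proof (induction m)
    case (Suc m)
    have "(?U ^^ m) V e = (?U ^^ m) (\<lambda>e. z * ?U V e + D * \<delta> e) e"
      using V e by (rule grover_step_pow_cong)
    also have "\<dots> = z * (?U ^^ m) (?U V) e + D * (?U ^^ m) \<delta> e"
      by (simp only: grover_step_pow_linear)
    also have "(?U ^^ m) (?U V) = (?U ^^ Suc m) V" by (simp only: funpow_swap1 funpow.simps comp_apply)
    finally show ?case using Suc by (simp add: algebra_simps)
  qed simp
  from this[of K] have "V e = z ^ K * V e + D * (\<Sum>i<K. z ^ i * (?U ^^ i) \<delta> e)"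
    using assms(2) e unfolding grover_power_is_id_iff[OF assms(1)] by simp
  then show ?thesis by (simp add: algebra_simps)
qed

text \<open>A sign pattern \<open>\<sigma>\<close> on the vertices below level \<open>j\<close> that is constant on subtrees and is an
  eigenvector, with eigenvalue \<open>\<epsilon>\<close>, of the reflection at the vertices of level \<open>j\<close>. It is used
  for the radial vectors (\<open>j = 0\<close>, \<open>\<epsilon> = 1\<close>) and for the vectors that are antisymmetric in two
  branches (\<open>\<epsilon> = -1\<close>).\<close>

locale bethe_wave =
  fixes ds :: "nat list" and j :: nat and \<sigma> :: "nat list \<Rightarrow> real" and \<epsilon> :: real
  assumes pos: "\<And>d. d \<in> set ds \<Longrightarrow> d \<ge> 1" and j: "j < length ds"
    and \<sigma>_low: "\<And>xs. xs \<noteq> [] \<Longrightarrow> length xs \<le> j \<Longrightarrow> \<sigma> xs = 0"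
    and \<sigma>_top: "\<And>xs c. length xs = j \<Longrightarrow> c < ds ! j \<Longrightarrow>
      2 / real ((if xs = [] then 0 else 1) + ds ! j) * (\<Sum>b<ds ! j. \<sigma> (xs @ [b])) = (1 + \<epsilon>) * \<sigma> (xs @ [c])"
    and \<sigma>_bal: "\<And>xs. xs \<noteq> [] \<Longrightarrow> length xs = j \<Longrightarrow> (\<Sum>b<ds ! j. \<sigma> (xs @ [b])) = 0"
    and \<sigma>_high: "\<And>xs c. length xs > j \<Longrightarrow> \<sigma> (xs @ [c]) = \<sigma> xs"
    and \<sigma>_leaf: "\<sigma> (replicate (length ds) 0) = 1"
begin

text \<open>Crossing a vertex with d children costs a factor \<open>2 / (1 + d)\<close>. The inverse
  factors of the levels below \<open>i\<close> normalise the wave to 1 on the arcs into the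
  leaves.\<close>

definition amp :: "nat \<Rightarrow> real" where
  "amp i = (\<Prod>l\<in>{i<..<length ds}. (1 + real (ds ! l)) / 2)"

text \<open>The amplitude on arcs from level \<open>i\<close> to \<open>Suc i\<close>, with delay
  \<open>i - j\<close> from the source. Multiplying by \<open>scatB\<close> clears the denominator
  of the reflection, so that \<open>down\<close> and \<open>up\<close> are polynomials in z; at the
  bottom \<open>scatB\<close> is 1.\<close>

definition down :: "real \<Rightarrow> nat \<Rightarrow> real" where
  "down z i = z ^ (i - j) * amp i * poly (scatB (drop (Suc i) ds)) z"

definition up :: "real \<Rightarrow> nat \<Rightarrow> real" where
  "up z i = z ^ Suc (i - j) * amp i * poly (scatA (drop (Suc i) ds)) z"

definition wave :: "real \<Rightarrow> nat list \<times> nat list \<Rightarrow> real" where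
  "wave z e = (if length (snd e) = Suc (length (fst e)) then \<sigma> (snd e) * down z (length (fst e))
     else \<sigma> (fst e) * up z (length (snd e)))"

definition source :: "nat list \<times> nat list \<Rightarrow> real" where
  "source e = (if length (fst e) = j \<and> length (snd e) = Suc j then \<sigma> (snd e) * amp j else 0)"

lemma wave_simps: "wave z (xs, xs @ [c]) = \<sigma> (xs @ [c]) * down z (length xs)"
    "wave z (xs @ [c], xs) = \<sigma> (xs @ [c]) * up z (length xs)"
  by (simp_all add: wave_def)

lemma amp_Suc:
  assumes "Suc i < length ds"
  shows "amp i = (1 + real (ds ! Suc i)) / 2 * amp (Suc i)"
proof -
  have "{i<..<length ds} = insert (Suc i) {Suc i<..<length ds}" using assms by auto
  then show ?thesis by (simp add: amp_def)
qed

text \<open>These are the equations of \<open>V = z U V\<close> at a vertex of level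
  \<open>Suc i\<close>. With \<open>2 / (1 + d) = 1 + r\<close> and
  \<open>d * (1 + r) = 1 - r\<close>, the vertex transmits with \<open>1 + r\<close> downwards and
  \<open>1 - r\<close> upwards, and reflects with \<open>r\<close> from above and \<open>- r\<close>
  from below; the recursion of \<open>scat\<close> solves exactly this.\<close>

lemma down_up_rec:
  assumes "j \<le> i" "Suc i < length ds"
  defines "d \<equiv> real (ds ! Suc i)"
  shows "up z i = z * (2 / (1 + d) * (down z i + d * up z (Suc i)) - down z i)"
    and "down z (Suc i) = z * (2 / (1 + d) * (down z i + d * up z (Suc i)) - up z (Suc i))"
proof -
  have drop: "drop (Suc i) ds = (ds ! Suc i) # drop (Suc (Suc i)) ds"
    using assms(2) by (simp add: Cons_nth_drop_Suc)
  define r where "r = refl_coeff (ds ! Suc i)"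
  have d0: "1 + d > 0" by (simp add: d_def)
  have r: "2 / (1 + d) = 1 + r" "d * (1 + r) = 1 - r"
    using d0 by (simp_all add: r_def refl_coeff_def d_def field_simps)
  have C: "amp (Suc i) = (1 + r) * amp i"
    using d0 unfolding amp_Suc[OF assms(2)] r(1)[symmetric] d_def by (simp add: field_simps)
  define m where "m = i - j"
  have m: "i - j = m" "Suc i - j = Suc m" using assms(1) by (simp_all add: m_def)
  let ?A = "poly (scatA (drop (Suc (Suc i)) ds)) z" and ?B = "poly (scatB (drop (Suc (Suc i)) ds)) z"
  have A: "poly (scatA (drop (Suc i) ds)) z = r * ?B + z\<^sup>2 * ?A"
    and B: "poly (scatB (drop (Suc i) ds)) z = ?B + r * (z\<^sup>2 * ?A)"
    unfolding drop scat_simps r_def by (simp_all add: poly_monom)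
  have e: "2 / (1 + d) * (down z i + d * up z (Suc i)) = (1 + r) * down z i + (1 - r) * up z (Suc i)"
    unfolding r(1) by (simp add: algebra_simps flip: r(2))
  show "up z i = z * (2 / (1 + d) * (down z i + d * up z (Suc i)) - down z i)"
    unfolding e unfolding up_def down_def m C A B by (simp add: algebra_simps power2_eq_square)
  show "down z (Suc i) = z * (2 / (1 + d) * (down z i + d * up z (Suc i)) - up z (Suc i))"
    unfolding e unfolding up_def down_def m C A B by (simp add: algebra_simps power2_eq_square)
qed

text \<open>Above level \<open>j\<close> everything vanishes, below it the equation is
  \<open>down_up_rec\<close> or total reflection at a leaf, and level \<open>j\<close> is the only
  place with a defect.\<close>

lemma wave_resolvent:
  assumes e: "e \<in> parcs (bethe_graph ds)"
  shows "wave z e = z * grover_step (bethe_graph ds) (wave z) e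
    + poly (scatB (drop (Suc j) ds) - smult \<epsilon> (monom 1 2 * scatA (drop (Suc j) ds))) z * source e"
proof -
  let ?D = "poly (scatB (drop (Suc j) ds) - smult \<epsilon> (monom 1 2 * scatA (drop (Suc j) ds))) z"
  obtain xs c where xs: "xs @ [c] \<in> bethe_verts ds" and e: "e = (xs, xs @ [c]) \<or> e = (xs @ [c], xs)"
    using e by (rule bethe_graph_arc_cases)
  have V: "xs \<in> bethe_verts ds" and len: "length xs < length ds" and c: "c < ds ! length xs"
    using xs by (simp_all add: bethe_verts_snoc)
  let ?y = "xs @ [c]" and ?i = "length xs"
  have low: "(\<Sum>b<n. \<sigma> (ys @ [b]) * x) = 0" if "length ys < j" for ys x n
    using that \<sigma>_low[of "ys @ [_]"] by simp
  have high: "(\<Sum>b<n. \<sigma> (ys @ [b]) * x) = real n * \<sigma> ys * x" if "length ys > j" for ys x n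
    using \<sigma>_high[OF that] by simp
  show ?thesis
    using e
  proof
    assume e: "e = (?y, xs)"
    have src: "source e = 0" by (simp add: e source_def)
    have step: "grover_step (bethe_graph ds) (wave z) e =
      2 / real (1 + (if Suc ?i < length ds then ds ! Suc ?i else 0)) * (\<sigma> ?y * down z ?i +
        (if Suc ?i < length ds then \<Sum>b<ds ! Suc ?i. \<sigma> (?y @ [b]) * up z (Suc ?i) else 0)) - \<sigma> ?y * down z ?i"
      unfolding e grover_step_bethe_graph[OF xs] using wave_simps(2)[of z ?y] by (simp add: wave_simps(1))
    have W: "wave z e = \<sigma> ?y * up z ?i" by (simp add: e wave_simps)
    consider "?i < j" | "j \<le> ?i" "Suc ?i < length ds" | "j \<le> ?i" "Suc ?i = length ds" using len by linarith
    then show ?thesis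
    proof cases
      case 1
      then have y: "\<sigma> ?y = 0" by (intro \<sigma>_low) simp_all
      \<comment> \<open>At a vertex of level \<open>j\<close> the children cancel, so nothing leaks
        to its parent.\<close>
      have "(\<Sum>b<ds ! Suc ?i. \<sigma> (?y @ [b]) * up z (Suc ?i)) = 0"
      proof (cases "Suc ?i = j")
        case True
        then show ?thesis using \<sigma>_bal[of ?y] by (simp flip: sum_distrib_right)
      next
        case False
        then show ?thesis using 1 by (intro low) simp
      qed
      then show ?thesis unfolding step W src by (simp add: y)
    next
      case 2
      have "(\<Sum>b<ds ! Suc ?i. \<sigma> (?y @ [b]) * up z (Suc ?i)) = real (ds ! Suc ?i) * \<sigma> ?y * up z (Suc ?i)"
        using 2 by (intro high) simp
      then show ?thesis
        unfolding step W src down_up_rec(1)[OF 2, of z] using 2 by (simp add: algebra_simps)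
    next
      case 3
      have "up z ?i = z * down z ?i" using 3 by (simp add: up_def down_def scat_simps)
      then show ?thesis unfolding step W src using 3 by simp
    qed
  next
    assume e: "e = (xs, ?y)"
    let ?deg = "real ((if xs = [] then 0 else 1) + ds ! ?i)"
    have W: "wave z e = \<sigma> ?y * down z ?i" by (simp add: e wave_simps)
    have "wave z (butlast xs, xs) = \<sigma> xs * down z (?i - 1)" if "xs \<noteq> []"
      using that wave_simps(1)[of z "butlast xs" "last xs"] by simp
    then have step: "grover_step (bethe_graph ds) (wave z) e =
      2 / ?deg * ((if xs = [] then 0 else \<sigma> xs * down z (?i - 1)) + (\<Sum>b<ds ! ?i. \<sigma> (xs @ [b]) * up z ?i))
        - \<sigma> ?y * up z ?i"
      unfolding e grover_step_bethe_graph[OF V] using len by (simp add: wave_simps(2))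
    consider "?i < j" | "?i = j" | "j < ?i" by linarith
    then show ?thesis
    proof cases
      case 1
      then have "\<sigma> ?y = 0" "xs \<noteq> [] \<Longrightarrow> \<sigma> xs = 0" by (simp_all add: \<sigma>_low)
      moreover have "source e = 0" using 1 by (simp add: e source_def)
      ultimately show ?thesis unfolding W step low[OF 1] by auto
    next
      case 2
      \<comment> \<open>Level \<open>j\<close> reflects the upward wave with factor
        \<open>\<epsilon>\<close>. The defect \<open>down z j - \<epsilon> * z * up z j\<close> is
        \<open>amp j\<close> times D(z).\<close>
      have "grover_step (bethe_graph ds) (wave z) e = 2 / ?deg * (\<Sum>b<ds ! ?i. \<sigma> (xs @ [b])) * up z ?i - \<sigma> ?y * up z ?i"
        unfolding step using \<sigma>_low[of xs] 2 by (simp flip: sum_distrib_right)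
      also have "2 / ?deg * (\<Sum>b<ds ! ?i. \<sigma> (xs @ [b])) = (1 + \<epsilon>) * \<sigma> ?y"
        using \<sigma>_top[of xs c] c 2 by simp
      finally have "grover_step (bethe_graph ds) (wave z) e = \<epsilon> * \<sigma> ?y * up z ?i" by (simp add: algebra_simps)
      moreover have "source e = \<sigma> ?y * amp j" using 2 by (simp add: e source_def)
      ultimately show ?thesis
        unfolding W using 2 by (simp add: up_def down_def poly_monom algebra_simps power2_eq_square)
    next
      case 3
      then obtain i where i: "?i = Suc i" by (cases ?i) auto
      have ne: "xs \<noteq> []" using 3 by auto
      have "j \<le> i" "Suc i < length ds" using 3 i len by simp_all
      note rec = down_up_rec(2)[OF this, of z]
      have "source e = 0" using 3 by (simp add: e source_def)
      moreover have "\<sigma> ?y = \<sigma> xs" using 3 by (rule \<sigma>_high)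
      ultimately show ?thesis
        unfolding W step high[OF 3] i rec using ne by (simp add: algebra_simps)
    qed
  qed
qed

lemma int_coeffs_of_periodic:
  assumes "periodic_grover_walk (bethe_graph ds)" "\<epsilon> \<in> \<rat>"
  shows "int_coeffs (scatB (drop (Suc j) ds) - smult \<epsilon> (monom 1 2 * scatA (drop (Suc j) ds)))"
proof -
  let ?D = "scatB (drop (Suc j) ds) - smult \<epsilon> (monom 1 2 * scatA (drop (Suc j) ds))"
  let ?G = "bethe_graph ds"
  obtain K where K: "K \<ge> 1" "grover_power_is_id ?G K"
    using assms(1) unfolding periodic_grover_walk_def by blast
  define n where "n = length ds - 1"
  have n: "length ds = Suc n" "j \<le> n" using j by (simp_all add: n_def)
  \<comment> \<open>The parent of the leftmost leaf; on the arc into that leaf the wave is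
    \<open>z ^ (n - j)\<close>.\<close>
  let ?x = "replicate n 0 :: nat list"
  have x: "?x @ [0] = replicate (length ds) 0" by (simp add: n replicate_append_same)
  have "ds ! i > 0" if "i < length ds" for i using pos[of "ds ! i"] that by (simp add: Suc_le_eq)
  then have "?x @ [0] \<in> bethe_verts ds" unfolding x by (simp add: bethe_verts_def)
  then have e: "(?x, ?x @ [0]) \<in> parcs ?G" by (rule bethe_graph_arcI)
  define Q where "Q = (\<Sum>m<K. monom ((grover_step ?G ^^ m) source (?x, ?x @ [0])) m)"
  have "wave z (?x, ?x @ [0]) = z ^ (n - j)" for z
  proof -
    have "{n<..<Suc n} = {}" by auto
    then have "amp n = 1" by (simp add: amp_def n)
    then show ?thesis unfolding wave_simps unfolding x \<sigma>_leaf by (simp add: down_def n scat_simps)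
  qed
  then have "(1 - z ^ K) * z ^ (n - j) = poly ?D z * poly Q z" for z
    using resolvent_identity[OF pair_graph_bethe_graph K(2), of "wave z" z "poly ?D z" source, OF wave_resolvent e]
    by (simp add: Q_def poly_sum poly_monom mult.commute)
  then have "poly (?D * Q) z = poly (monom 1 (n - j) - monom 1 (n - j + K)) z" for z
    by (simp only: poly_mult poly_diff poly_monom) (simp add: algebra_simps power_add)
  then have "?D * Q = monom 1 (n - j) - monom 1 (n - j + K)"
    by (simp only: poly_eq_poly_eq_iff[symmetric] fun_eq_iff) blast
  moreover have "coeff ?D i \<in> \<rat>" for i
    using assms(2) coeff_scat_rat by (simp add: coeff_monom_mult Rats_diff Rats_mult)
  moreover have "coeff ?D 0 = 1" by (simp add: coeff_scatB_0 coeff_monom_mult)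
  ultimately show ?thesis using K(1) by (intro int_coeffs_dvd)
qed

end

text \<open>Radial vectors: the root reflects a constant vector with factor 1.\<close>

lemma int_coeffs_scat_minus:
  assumes "\<And>d. d \<in> set ds \<Longrightarrow> d \<ge> 1" "ds \<noteq> []" "periodic_grover_walk (bethe_graph ds)"
  shows "int_coeffs (scat_minus (tl ds))"
proof -
  interpret bethe_wave ds 0 "\<lambda>_. 1" 1
  proof
    show "d \<in> set ds \<Longrightarrow> 1 \<le> d" for d by (rule assms(1))
    show "0 < length ds" using assms(2) by simp
  qed auto
  show ?thesis
    using int_coeffs_of_periodic[OF assms(3)] by (simp add: scat_minus_def drop_Suc)
qed

lemma int_coeffs_scat_plus:
  assumes "\<And>d. d \<in> set ds \<Longrightarrow> d \<ge> 1" "j < length ds" "ds ! j \<ge> 2" "periodic_grover_walk (bethe_graph ds)"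
  shows "int_coeffs (scat_plus (drop (Suc j) ds))"
proof -
  define x where "x = (replicate j 0 :: nat list)"
  \<comment> \<open>Values 1 and -1 on the first two branches below the leftmost vertex
    \<open>x\<close> of level \<open>j\<close>, and 0 elsewhere: the sum over the children of
    \<open>x\<close> vanishes, so \<open>x\<close> reflects with factor -1.\<close>
  define \<sigma> :: "nat list \<Rightarrow> real" where
    "\<sigma> xs = (if length xs \<le> j \<or> take j xs \<noteq> x then 0 else if xs ! j = 0 then 1 else if xs ! j = 1 then - 1 else 0)" for xs
  have bal: "(\<Sum>b<ds ! j. \<sigma> (xs @ [b])) = 0" if "length xs = j" for xs
  proof (cases "xs = x")
    case True
    obtain m where m: "ds ! j = Suc (Suc m)" using assms(3) by (metis add_2_eq_Suc le_Suc_ex)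
    have "\<sigma> (xs @ [b]) = (if b = 0 then 1 else if b = 1 then - 1 else 0)" for b
      using that True by (simp add: \<sigma>_def nth_append)
    then show ?thesis unfolding m sum.lessThan_Suc_shift by simp
  next
    case False
    then show ?thesis using that by (simp add: \<sigma>_def)
  qed
  interpret bethe_wave ds j \<sigma> "- 1"
  proof
    show "d \<in> set ds \<Longrightarrow> 1 \<le> d" for d by (rule assms(1))
    show "j < length ds" by (rule assms(2))
    show "\<sigma> xs = 0" if "length xs \<le> j" for xs using that by (simp add: \<sigma>_def)
    show "(\<Sum>b<ds ! j. \<sigma> (xs @ [b])) = 0" if "length xs = j" for xs by (rule bal[OF that])
    show "2 / real ((if xs = [] then 0 else 1) + ds ! j) * (\<Sum>b<ds ! j. \<sigma> (xs @ [b])) = (1 + - 1) * \<sigma> (xs @ [c])"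
      if "length xs = j" for xs c
      by (simp add: bal[OF that])
    show "\<sigma> (xs @ [c]) = \<sigma> xs" if "j < length xs" for xs c
      using that by (simp add: \<sigma>_def nth_append)
    show "\<sigma> (replicate (length ds) 0) = 1"
      using assms(2) by (simp add: \<sigma>_def x_def min_def)
  qed
  show ?thesis
    using int_coeffs_of_periodic[OF assms(4)] by (simp add: scat_plus_def)
qed

section \<open>Classification\<close>

lemma refl_coeff_1: "refl_coeff 1 = 0"
  by (simp add: refl_coeff_def)

lemma refl_coeff_bounds: "d \<ge> 2 \<Longrightarrow> - 1 < refl_coeff d" "d \<ge> 2 \<Longrightarrow> refl_coeff d < 0"
  by (simp_all add: refl_coeff_def field_simps)

lemma not_Ints_unit_interval: "- 1 < x \<Longrightarrow> x < 0 \<Longrightarrow> (x :: real) \<notin> \<int>"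
  by (auto elim!: Ints_cases)

lemma refl_coeff_not_int: "d \<ge> 2 \<Longrightarrow> refl_coeff d \<notin> \<int>"
  using refl_coeff_bounds by (intro not_Ints_unit_interval)

text \<open>The only integer strictly between -2 and 0 is -1. This is where the degree 3 comes
  from.\<close>

lemma refl_coeff_half_int: "d \<ge> 2 \<Longrightarrow> 2 * refl_coeff d \<in> \<int> \<Longrightarrow> d = 3"
proof -
  assume d: "d \<ge> 2" and i: "2 * refl_coeff d \<in> \<int>"
  obtain k where k: "2 * refl_coeff d = of_int k" using i by (rule Ints_cases)
  have "- 2 < real_of_int k" "real_of_int k < 0" using refl_coeff_bounds[OF d] k by linarith+
  then have "k = - 1" by linarith
  then have "2 * (1 - real d) = - (1 + real d)" using k by (simp add: refl_coeff_def field_simps)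
  then have "real d = 3" by (simp add: algebra_simps)
  then show "d = 3" by simp
qed

lemma scat_replicate_1:
  "scatA (replicate p 1 @ ds) = monom 1 (2 * p) * scatA ds" "scatB (replicate p 1 @ ds) = scatB ds"
proof (induction p)
  case (Suc p)
  have "monom 1 2 * (monom 1 (2 * p) * scatA ds) = monom 1 (2 * Suc p) * scatA ds"
    by (simp only: mult.assoc[symmetric] mult_monom) simp
  then show "scatA (replicate (Suc p) 1 @ ds) = monom 1 (2 * Suc p) * scatA ds"
    using Suc by (simp add: scat_simps refl_coeff_1[unfolded One_nat_def])
  show "scatB (replicate (Suc p) 1 @ ds) = scatB ds"
    using Suc by (simp add: scat_simps refl_coeff_1[unfolded One_nat_def])
qed simp_all

text \<open>Levels with one child are transparent. Together with the step below the vertex above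
  them, \<open>p - 1\<close> of them delay a round trip by \<open>2 * p\<close>.\<close>

lemma scat_block:
  assumes "p \<ge> 1"
  shows "monom 1 2 * scatA (replicate (p - 1) 1 @ ds) = monom 1 (2 * p) * scatA ds"
    "scatB (replicate (p - 1) 1 @ ds) = scatB ds"
proof -
  have "2 + 2 * (p - 1) = 2 * p" using assms by simp
  then show "monom 1 2 * scatA (replicate (p - 1) 1 @ ds) = monom 1 (2 * p) * scatA ds"
    unfolding scat_replicate_1 mult.assoc[symmetric] mult_monom by simp
  show "scatB (replicate (p - 1) 1 @ ds) = scatB ds" by (rule scat_replicate_1)
qed

lemma coeff_scat_one:
  assumes "p \<ge> 1"
  shows "coeff (scatA (d # replicate (p - 1) 1)) i = (if i = 0 then refl_coeff d else 0) + (if i = 2 * p then 1 else 0)"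
    "coeff (scatB (d # replicate (p - 1) 1)) i = (if i = 0 then 1 else 0) + (if i = 2 * p then refl_coeff d else 0)"
  using scat_block[OF assms, of "[]"] by (simp_all add: scat_simps coeff_pCons split: nat.splits)

text \<open>With A and B belonging to the lower block, \<open>scatB\<close> is
  \<open>B + refl_coeff d * z^(2p) * A\<close>, and only the constant term
  \<open>refl_coeff e\<close> of A reaches the exponent \<open>2 * p\<close>.\<close>

lemma coeff_scat_two:
  assumes "p \<ge> 1"
  shows "i < 2 * p \<Longrightarrow> coeff (scatA (d # replicate (p - 1) 1 @ e # replicate (p - 1) 1)) i
      = (if i = 0 then refl_coeff d else 0)"
    "coeff (scatB (d # replicate (p - 1) 1 @ e # replicate (p - 1) 1)) (2 * p)
      = refl_coeff e * (1 + refl_coeff d)"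
  using assms unfolding scat_simps(3,4)[of d] scat_block[OF assms]
  by (simp_all only: coeff_add coeff_smult coeff_monom_mult coeff_scat_one[OF assms])
    (simp_all add: algebra_simps)

lemma coeff_scat_sign:
  assumes "s \<ge> 1" "p \<ge> 1"
  shows "coeff (scat_plus (replicate (s - 1) 1 @ ds)) (2 * p)
      = coeff (scatB ds) (2 * p) + (if s \<le> p then coeff (scatA ds) (2 * p - 2 * s) else 0)"
    "coeff (scat_minus (replicate (s - 1) 1 @ ds)) (2 * p)
      = coeff (scatB ds) (2 * p) - (if s \<le> p then coeff (scatA ds) (2 * p - 2 * s) else 0)"
  unfolding scat_plus_def scat_minus_def scat_block[OF assms(1)] by (auto simp: coeff_monom_mult)

text \<open>Splits off the lowest branching level. The \<open>p - 1\<close> ones after it put it at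
  distance \<open>p\<close> from the end of the list.\<close>

lemma ones_decomp:
  assumes "\<forall>d\<in>set ds. (d::nat) \<ge> 1"
  obtains (ones) p where "p \<ge> 1" "ds = replicate (p - 1) 1"
  | (branch) xs d p where "p \<ge> 1" "d \<ge> 2" "ds = xs @ d # replicate (p - 1) 1"
proof -
  have "(\<exists>p. ds = replicate p 1) \<or> (\<exists>xs d p. d \<ge> 2 \<and> ds = xs @ d # replicate p 1)"
    using assms
  proof (induction ds)
    case (Cons d ds)
    then consider p where "ds = replicate p 1" | xs e p where "e \<ge> 2" "ds = xs @ e # replicate p 1" by auto
    then show ?case
    proof cases
      case 1
      show ?thesis
      proof (cases "d = 1")
        case True
        then have "d # ds = replicate (Suc p) 1" using 1 by simp
        then show ?thesis by blast
      next
        case False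
        then have "d \<ge> 2" using Cons.prems by auto
        moreover have "d # ds = [] @ d # replicate p 1" using 1 by simp
        ultimately show ?thesis by blast
      qed
    next
      case 2
      then have "d # ds = (d # xs) @ e # replicate p 1" by simp
      with 2(1) show ?thesis by blast
    qed
  qed simp
  then show thesis
  proof (elim disjE exE conjE)
    fix p assume "ds = replicate p 1"
    then show thesis by (intro ones[of "Suc p"]) simp_all
  next
    fix xs d p assume "2 \<le> d" "ds = xs @ d # replicate p 1"
    then show thesis by (intro branch[of "Suc p" d xs]) simp_all
  qed
qed

text \<open>The hypotheses are used only for the coefficient of \<open>z\<^bsup>2p\<^esup>\<close>, where the lowest branching level
  has distance \<open>p\<close> to the leaves.\<close>

lemma bethe_classification:
  assumes pos: "\<forall>d\<in>set ds. d \<ge> 1" and ne: "ds \<noteq> []"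
    and minus: "int_coeffs (scat_minus (tl ds))"
    and plus: "\<forall>xs d ys. ds = xs @ d # ys \<longrightarrow> d \<ge> 2 \<longrightarrow> int_coeffs (scat_plus ys)"
  obtains (path) n where "n \<ge> 1" "ds = replicate n 1"
  | (star) s k where "s \<ge> 2" "k \<ge> 1" "ds = s # replicate (k - 1) 1"
  | (star_leaf) d k where "d \<ge> 2" "k \<ge> 1" "ds = 1 # replicate (k - 1) 1 @ d # replicate (k - 1) 1"
  | (s3) s k where "s \<ge> 2" "k \<ge> 1" "ds = s # replicate (k - 1) 1 @ 3 # replicate (k - 1) 1"
  | (b123) k where "k \<ge> 1"
      "ds = 1 # replicate (k - 1) 1 @ 2 # replicate (k - 1) 1 @ 3 # replicate (k - 1) 1"
proof -
  have plusD: "coeff (scat_plus ys) i \<in> \<int>" if "ds = xs @ d # ys" "d \<ge> 2" for xs d ys i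
    using plus that unfolding int_coeffs_def by blast
  have minusD: "coeff (scat_minus (tl ds)) i \<in> \<int>" for i
    using minus by (simp add: int_coeffs_def)
  obtain d0 tl where ds: "ds = d0 # tl" using ne by (cases ds) auto
  have d0: "d0 \<ge> 1" and tl_pos: "\<forall>d\<in>set tl. d \<ge> 1" using pos ds by auto
  from tl_pos show thesis
  proof (cases rule: ones_decomp)
    case (ones p)
    show thesis
    proof (cases "d0 = 1")
      case True
      then have "ds = replicate p 1" using ones ds by (cases p) auto
      then show thesis using path ones(1) by blast
    next
      case False
      then show thesis using star[of d0 p] ones ds d0 by simp
    qed
  next
    case (branch xs d p)
    have xs_pos: "\<forall>d\<in>set xs. d \<ge> 1" using tl_pos branch(3) by simp
    let ?r = "refl_coeff d"
    from xs_pos show thesis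
    proof (cases rule: ones_decomp)
      case (ones q)
      have "coeff (scat_minus tl) (2 * p) \<in> \<int>" using minusD ds by simp
      \<comment> \<open>The path of length \<open>q\<close> above this level contributes at exponent
        \<open>2 * p\<close> only if \<open>q = p\<close>; otherwise \<open>?r\<close> itself would
        be an integer.\<close>
      then have m: "?r - (if q = p then ?r else 0) \<in> \<int>"
        unfolding branch(3) ones(2) coeff_scat_sign(2)[OF ones(1) branch(1)] coeff_scat_one[OF branch(1)]
        using ones(1) branch(1) by (auto split: if_splits)
      then have q: "q = p" using refl_coeff_not_int[OF branch(2)] by (auto split: if_splits)
      show thesis
      proof (cases "d0 = 1")
        case True
        then show thesis using star_leaf[of d p] branch ones q ds by simp
      next
        case False
        then have d0: "d0 \<ge> 2" using d0 by simp
        \<comment> \<open>At \<open>q = p\<close> the radial terms cancel and say nothing about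
          \<open>d\<close>. A branching root also admits antisymmetric vectors, where they add
          up.\<close>
        have "coeff (scat_plus tl) (2 * p) \<in> \<int>" using plusD[of "[]" d0 tl] ds d0 by simp
        then have "2 * ?r \<in> \<int>"
          unfolding branch(3) ones(2) coeff_scat_sign(1)[OF ones(1) branch(1)] coeff_scat_one[OF branch(1)]
          using q branch(1) by simp
        then have "d = 3" by (rule refl_coeff_half_int[OF branch(2)])
        then show thesis using s3[of d0 p] d0 branch ones q ds by simp
      qed
    next
      case b2: (branch ys e q)
      let ?t = "refl_coeff e"
      have ds2: "ds = (d0 # ys) @ e # (replicate (q - 1) 1 @ d # replicate (p - 1) 1)"
        using ds branch(3) b2(3) by simp
      \<comment> \<open>Antisymmetric vectors below the second branching level from the bottom
        already fix the spacing and the degree of the lowest one, whatever lies above.\<close>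
      have "coeff (scat_plus (replicate (q - 1) 1 @ d # replicate (p - 1) 1)) (2 * p) \<in> \<int>"
        by (rule plusD[OF ds2 b2(2)])
      then have m: "?r + (if q = p then ?r else 0) \<in> \<int>"
        unfolding coeff_scat_sign(1)[OF b2(1) branch(1)] coeff_scat_one[OF branch(1)]
        using b2(1) branch(1) by (auto split: if_splits)
      then have q: "q = p" using refl_coeff_not_int[OF branch(2)] by (auto split: if_splits)
      then have "d = 3" using m by (intro refl_coeff_half_int[OF branch(2)]) simp
      then have r: "?r = - 1 / 2" by (simp add: refl_coeff_def)
      define zs where "zs = e # replicate (p - 1) 1 @ d # replicate (p - 1) 1"
      have e1: "1 + real e > 0" by simp
      have tp: "1 + ?t = 2 / (1 + real e)" using e1 by (simp add: refl_coeff_def field_simps)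
      have B: "coeff (scatB zs) (2 * p) = - 1 / (1 + real e)"
        unfolding zs_def coeff_scat_two(2)[OF branch(1)] r tp by simp
      have A: "(if s \<le> p then coeff (scatA zs) (2 * p - 2 * s) else 0) = (if s = p then ?t else 0)"
        if "s \<ge> 1" for s
        using that branch(1) coeff_scat_two(1)[OF branch(1), of "2 * p - 2 * s"] unfolding zs_def by auto
      have 1: "- 1 / (1 + real e) + ?t = - real e / (1 + real e)"
        and 2: "- 1 / (1 + real e) - ?t = (real e - 2) / (1 + real e)"
        by (simp_all add: refl_coeff_def diff_divide_distrib add_divide_distrib)
      \<comment> \<open>Both numbers lie strictly between -1 and 0: the lower levels alone, or
        combined antisymmetrically with the level above, never give an integer.\<close>
      have small: "- 1 / (1 + real e) \<notin> \<int>" "- 1 / (1 + real e) + ?t \<notin> \<int>"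
        unfolding 1 using b2(2) by (intro not_Ints_unit_interval; simp add: field_simps)+
      have zs: "tl = ys @ zs" using branch(3) b2(3) q by (simp add: zs_def)
      have ys_pos: "\<forall>d\<in>set ys. d \<ge> 1" using xs_pos b2(3) by simp
      from ys_pos show thesis
      proof (cases rule: ones_decomp)
        case (ones s)
        have "coeff (scat_minus tl) (2 * p) \<in> \<int>" using minusD ds by simp
        then have m: "- 1 / (1 + real e) - (if s = p then ?t else 0) \<in> \<int>"
          unfolding zs ones(2) coeff_scat_sign(2)[OF ones(1) branch(1)] A[OF ones(1)] B .
        then have s: "s = p" using small(1) by (auto split: if_splits)
        \<comment> \<open>Radially the quotient lies in the interval from 0 inclusive to 1
          exclusive, so it is 0.\<close>
        then have "(real e - 2) / (1 + real e) \<in> \<int>" using m unfolding 2[symmetric] by simp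
        then obtain k where k: "(real e - 2) / (1 + real e) = of_int k" by (rule Ints_cases)
        have "0 \<le> (real e - 2) / (1 + real e)" "(real e - 2) / (1 + real e) < 1"
          using b2(2) by (simp_all add: field_simps)
        then have "k = 0" unfolding k by linarith
        then have "real e = 2" using k e1 by simp
        then have e: "e = 2" by simp
        show thesis
        proof (cases "d0 = 1")
          case True
          then show thesis
            using b123[of p] branch(1) ds s e \<open>d = 3\<close> unfolding zs ones(2) zs_def by simp
        next
          case False
          then have "d0 \<ge> 2" using d0 by simp
          then have "coeff (scat_plus tl) (2 * p) \<in> \<int>" using plusD[of "[]" d0 tl] ds by simp
          then have "- 1 / (1 + real e) + ?t \<in> \<int>"
            unfolding zs ones(2) coeff_scat_sign(1)[OF ones(1) branch(1)] A[OF ones(1)] B using s by simp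
          then show thesis using small(2) by simp
        qed
      next
        case b3: (branch ws f s)
        have "ds = (d0 # ws) @ f # (replicate (s - 1) 1 @ zs)" using ds zs b3(3) by simp
        \<comment> \<open>A third branching level below the root would carry antisymmetric vectors,
          whose coefficient is one of the two non-integers in \<open>small\<close>.\<close>
        then have "coeff (scat_plus (replicate (s - 1) 1 @ zs)) (2 * p) \<in> \<int>" using b3(2) by (rule plusD)
        then have "- 1 / (1 + real e) + (if s = p then ?t else 0) \<in> \<int>"
          unfolding coeff_scat_sign(1)[OF b3(1) branch(1)] A[OF b3(1)] B .
        then show thesis using small by (auto split: if_splits)
      qed
    qed
  qed
qed

section \<open>Periods of the four families and the final classification\<close>

lemma bethe_graph_arcs_nonempty: "d \<ge> 1 \<Longrightarrow> parcs (bethe_graph (d # ds)) \<noteq> {}"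
  using bethe_graph_arcI(1)[of "[]" 0 "d # ds"] by (auto simp: bethe_verts_1)

text \<open>The path with \<open>n\<close> edges is the \<open>n\<close>-subdivision of a single
  edge, which has period 2.\<close>

lemma walk_path_graph:
  assumes "n \<ge> 1"
  shows "periodic_grover_walk (path_graph (n + 1))" "grover_period (path_graph (n + 1)) = 2 * n"
proof -
  let ?S = "subdivision_graph n (bethe_graph [1])"
  have "stretch n [1] = replicate n 1" using assms by (cases n) (simp_all add: stretch_def)
  then have S: "leveled_tree (replicate n 1) (\<lambda>M. \<Sum>x\<in>#M. length x) (replicate_mset n []) ?S"
    using leveled_tree_subdivision[OF leveled_tree_bethe_graph assms, of "[1]"] by simp
  note iso = grover_walk_iso[OF pair_graph_leveled_tree[OF leveled_tree_path_graph] pair_graph_leveled_tree[OF S]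
      leveled_tree_unique[OF leveled_tree_path_graph S]]
  have "parcs (bethe_graph [1]) \<noteq> {}" by (rule bethe_graph_arcs_nonempty) simp
  note sub = grover_period_subdivision[OF pair_graph_bethe_graph this assms period_edge(1)]
  show "periodic_grover_walk (path_graph (n + 1))" using iso(1) sub(1) by simp
  show "grover_period (path_graph (n + 1)) = 2 * n" using iso(2) sub(2) period_edge(2) by simp
qed

lemma walk_subdivided_star_graph:
  assumes "k \<ge> 1" "l \<ge> 3"
  shows "periodic_grover_walk (subdivision_graph k (star_graph l))"
    "grover_period (subdivision_graph k (star_graph l)) = 4 * k"
proof -
  have l: "l \<ge> 2" "l - 1 \<ge> 2" using assms(2) by simp_all
  note iso = grover_walk_iso[OF pair_graph_star_graph pair_graph_bethe_graph
      leveled_tree_unique[OF leveled_tree_star_graph[OF l(1)] leveled_tree_bethe_graph]]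
  have star: "periodic_grover_walk (star_graph l)" "grover_period (star_graph l) = 4"
    using iso period_star[OF l(2)] by simp_all
  have "(0, 1) \<in> parcs (star_graph l)" using l by (simp add: star_graph_def)
  then have "parcs (star_graph l) \<noteq> {}" by blast
  note sub = grover_period_subdivision[OF pair_graph_star_graph this assms(1) star(1)]
  show "periodic_grover_walk (subdivision_graph k (star_graph l))" by (rule sub(1))
  show "grover_period (subdivision_graph k (star_graph l)) = 4 * k" using sub(2) star(2) by simp
qed

lemma walk_subdivided_bethe_graph:
  assumes "k \<ge> 1" "ds = [1, 2, 3] \<or> (\<exists>s\<ge>2. ds = [s, 3])"
  shows "periodic_grover_walk (subdivision_graph k (bethe_graph ds))"
    "grover_period (subdivision_graph k (bethe_graph ds)) = 12 * k"
proof -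
  have per: "periodic_grover_walk (bethe_graph ds)" "grover_period (bethe_graph ds) = 12"
    using assms(2) period_bethe_123 period_bethe_s3 by auto
  have "parcs (bethe_graph ds) \<noteq> {}"
    using assms(2) bethe_graph_arcs_nonempty[of 1] bethe_graph_arcs_nonempty[of _ "[3]"] by fastforce
  note sub = grover_period_subdivision[OF pair_graph_bethe_graph this assms(1) per(1)]
  show "periodic_grover_walk (subdivision_graph k (bethe_graph ds))" by (rule sub(1))
  show "grover_period (subdivision_graph k (bethe_graph ds)) = 12 * k" using sub(2) per(2) by simp
qed

lemma leveled_tree_iso_subdivision:
  assumes "leveled_tree ds lev r G" "leveled_tree es lev' r' H" "k \<ge> 1" "stretch k es = ds"
  shows "G \<simeq>\<^sub>g subdivision_graph k H"
  using leveled_tree_unique[OF assms(1) leveled_tree_subdivision[OF assms(2,3), unfolded assms(4)]] .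

lemma leveled_tree_classification:
  assumes G: "leveled_tree ds lev r G" and ds: "ds \<noteq> []" "\<forall>d\<in>set ds. d \<ge> 1"
    and per: "periodic_grover_walk G"
  shows "(\<exists>n\<ge>1. G \<simeq>\<^sub>g path_graph (n + 1)) \<or>
    (\<exists>k\<ge>1. \<exists>l\<ge>3. G \<simeq>\<^sub>g subdivision_graph k (star_graph l)) \<or>
    (\<exists>k\<ge>1. G \<simeq>\<^sub>g subdivision_graph k (bethe_graph [1, 2, 3])) \<or>
    (\<exists>k\<ge>1. \<exists>s\<ge>2. G \<simeq>\<^sub>g subdivision_graph k (bethe_graph [s, 3]))"
proof -
  have per': "periodic_grover_walk (bethe_graph ds)"
    using grover_walk_iso(1)[OF pair_graph_leveled_tree[OF G] pair_graph_bethe_graph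
        leveled_tree_unique[OF G leveled_tree_bethe_graph]] per by simp
  have pos: "d \<ge> 1" if "d \<in> set ds" for d using ds(2) that by blast
  have minus: "int_coeffs (scat_minus (tl ds))"
    by (rule int_coeffs_scat_minus[OF _ ds(1) per']) (rule pos)
  have plus: "\<forall>xs d ys. ds = xs @ d # ys \<longrightarrow> d \<ge> 2 \<longrightarrow> int_coeffs (scat_plus ys)"
  proof (intro allI impI)
    fix xs d ys assume "ds = xs @ d # ys" "d \<ge> 2"
    then show "int_coeffs (scat_plus ys)"
      using int_coeffs_scat_plus[OF pos _ _ per', of "length xs"] by simp
  qed
  note sub = leveled_tree_iso_subdivision[OF G]
  from ds(2,1) minus plus show ?thesis
  proof (cases rule: bethe_classification)
    case (path n)
    have "G \<simeq>\<^sub>g path_graph (n + 1)"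
      by (rule leveled_tree_unique[OF G[unfolded path(2)] leveled_tree_path_graph])
    with path(1) show ?thesis by blast
  next
    case (star s k)
    then have L: "leveled_tree [s] (\<lambda>v. if v = 0 then 0 else 1) 0 (star_graph (s + 1))"
      using leveled_tree_star_graph[of "s + 1"] by simp
    have "G \<simeq>\<^sub>g subdivision_graph k (star_graph (s + 1))"
      by (rule sub[OF L star(2)]) (simp add: stretch_def star(3))
    moreover have "s + 1 \<ge> 3" using star by simp
    ultimately show ?thesis using star(2) by blast
  next
    case (star_leaf d k)
    then have L: "leveled_tree [1, d] (\<lambda>v. if v = 1 then 0 else if v = 0 then 1 else 2) 1 (star_graph (d + 2))"
      using leveled_tree_star_graph_leaf[of "d + 2"] by simp
    have "G \<simeq>\<^sub>g subdivision_graph k (star_graph (d + 2))"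
      by (rule sub[OF L star_leaf(2)]) (simp add: stretch_def star_leaf(3))
    moreover have "d + 2 \<ge> 3" using star_leaf by simp
    ultimately show ?thesis using star_leaf(2) by blast
  next
    case (s3 s k)
    have "G \<simeq>\<^sub>g subdivision_graph k (bethe_graph [s, 3])"
      by (rule sub[OF leveled_tree_bethe_graph s3(2)]) (simp add: stretch_def s3(3))
    with s3(1,2) show ?thesis by blast
  next
    case (b123 k)
    have "G \<simeq>\<^sub>g subdivision_graph k (bethe_graph [1, 2, 3])"
      by (rule sub[OF leveled_tree_bethe_graph b123(1)]) (simp add: stretch_def b123(2))
    with b123(1) show ?thesis by blast
  qed
qed

theorem theorem1p1:
  fixes G :: "'a pair_pre_digraph" and ds :: "nat list"
  assumes "generalized_bethe_tree ds G"
  shows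
    "(periodic_grover_walk G \<longleftrightarrow>
        (\<exists>n\<ge>1. G \<simeq>\<^sub>g path_graph (n + 1)) \<or>
        (\<exists>k\<ge>1. \<exists>l\<ge>3. G \<simeq>\<^sub>g subdivision_graph k (star_graph l)) \<or>
        (\<exists>k\<ge>1. G \<simeq>\<^sub>g subdivision_graph k (bethe_graph [1, 2, 3])) \<or>
        (\<exists>k\<ge>1. \<exists>s\<ge>2. G \<simeq>\<^sub>g subdivision_graph k (bethe_graph [s, 3])))
     \<and> (\<forall>n\<ge>1. G \<simeq>\<^sub>g path_graph (n + 1) \<longrightarrow> grover_period G = 2 * n)
     \<and> (\<forall>k\<ge>1. \<forall>l\<ge>3. G \<simeq>\<^sub>g subdivision_graph k (star_graph l) \<longrightarrow> grover_period G = 4 * k)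
     \<and> (\<forall>k\<ge>1. G \<simeq>\<^sub>g subdivision_graph k (bethe_graph [1, 2, 3]) \<longrightarrow> grover_period G = 12 * k)
     \<and> (\<forall>k\<ge>1. \<forall>s\<ge>2. G \<simeq>\<^sub>g subdivision_graph k (bethe_graph [s, 3]) \<longrightarrow> grover_period G = 12 * k)"
proof -
  have ds: "ds \<noteq> []" "\<forall>d\<in>set ds. d \<ge> 1" using assms by (simp_all add: generalized_bethe_tree_def)
  obtain lev r where lt: "leveled_tree ds lev r G" using generalized_bethe_tree_leveled[OF assms] by blast
  have G: "pair_graph G" using lt by (rule pair_graph_leveled_tree)
  have path: "periodic_grover_walk G \<and> grover_period G = 2 * n" if "n \<ge> 1" "G \<simeq>\<^sub>g path_graph (n + 1)" for n
    using grover_walk_iso[OF G pair_graph_leveled_tree[OF leveled_tree_path_graph] that(2)]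
      walk_path_graph[OF that(1)] by simp
  have star: "periodic_grover_walk G \<and> grover_period G = 4 * k"
    if "k \<ge> 1" "l \<ge> 3" "G \<simeq>\<^sub>g subdivision_graph k (star_graph l)" for k l
    using grover_walk_iso[OF G pair_graph_subdivision_graph[OF pair_graph_star_graph] that(3)]
      walk_subdivided_star_graph[OF that(1,2)] by simp
  have bethe: "periodic_grover_walk G \<and> grover_period G = 12 * k"
    if "k \<ge> 1" "es = [1, 2, 3] \<or> (\<exists>s\<ge>2. es = [s, 3])" "G \<simeq>\<^sub>g subdivision_graph k (bethe_graph es)" for k es
    using grover_walk_iso[OF G pair_graph_subdivision_graph[OF pair_graph_bethe_graph] that(3)]
      walk_subdivided_bethe_graph[OF that(1,2)] by simp
  show ?thesis
  proof (intro conjI allI impI iffI)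
    assume "periodic_grover_walk G"
    then show "(\<exists>n\<ge>1. G \<simeq>\<^sub>g path_graph (n + 1)) \<or>
        (\<exists>k\<ge>1. \<exists>l\<ge>3. G \<simeq>\<^sub>g subdivision_graph k (star_graph l)) \<or>
        (\<exists>k\<ge>1. G \<simeq>\<^sub>g subdivision_graph k (bethe_graph [1, 2, 3])) \<or>
        (\<exists>k\<ge>1. \<exists>s\<ge>2. G \<simeq>\<^sub>g subdivision_graph k (bethe_graph [s, 3]))"
      by (rule leveled_tree_classification[OF lt ds])
  next
    assume "(\<exists>n\<ge>1. G \<simeq>\<^sub>g path_graph (n + 1)) \<or>
        (\<exists>k\<ge>1. \<exists>l\<ge>3. G \<simeq>\<^sub>g subdivision_graph k (star_graph l)) \<or>
        (\<exists>k\<ge>1. G \<simeq>\<^sub>g subdivision_graph k (bethe_graph [1, 2, 3])) \<or>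
        (\<exists>k\<ge>1. \<exists>s\<ge>2. G \<simeq>\<^sub>g subdivision_graph k (bethe_graph [s, 3]))"
    then show "periodic_grover_walk G"
      using path star bethe by (elim disjE exE conjE) blast+
  next
    fix n :: nat assume "1 \<le> n" "G \<simeq>\<^sub>g path_graph (n + 1)"
    then show "grover_period G = 2 * n" using path by blast
  next
    fix k l :: nat assume "1 \<le> k" "3 \<le> l" "G \<simeq>\<^sub>g subdivision_graph k (star_graph l)"
    then show "grover_period G = 4 * k" using star by blast
  next
    fix k :: nat assume "1 \<le> k" "G \<simeq>\<^sub>g subdivision_graph k (bethe_graph [1, 2, 3])"
    then show "grover_period G = 12 * k" using bethe by blast
  next
    fix k s :: nat assume "1 \<le> k" "2 \<le> s" "G \<simeq>\<^sub>g subdivision_graph k (bethe_graph [s, 3])"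
    then show "grover_period G = 12 * k" using bethe by blast
  qed
qed

end
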